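(* Let $n\in\mathbb{N}$, $s\in\mathbb{R}$, and let $V_s\subset H^s(\mathbb{R}^n)$ be a closed shift-invariant space with associated range function $J_s$. Let $L:V_s\to V_s$ be a shift-preserving operator with corresponding range operator $R_s$ on $J_s$. Then: (1) The adjoint operator $L^*:V_s\to V_s$ is also shift-preserving, and its corresponding range operator $R_s^*$ is given by $R_s^*(t)=(R_s(t))^*$ for a.e. $t\in\mathbb{T}^n$. (2) For real numbers $A\leqslant B$: $L$ is self-adjoint and $\sigma(L)\subseteq[A,B]$ if and only if, for a.e. $t\in\mathbb{T}^n$, $R_s(t)$ is self-adjoint and $\sigma(R_s(t))\subseteq[A,B]$. (3) $L$ is unitary if and only if $R_s(t)$ is a unitary operator for a.e. $t\in\mathbb{T}^n$.
   Context: Notation: $\mathbb{T}^n=[-\frac12,\frac12)^n$ and $\mu_s(x)=(1+|x|^2)^{s/2}$ for $x\in\mathbb{R}^n$. The Fourier transform is $\widehat f(t)=\int_{\mathbb{R}^n}f(x)e^{-2\pi\sqrt{-1}\langle x,t\rangle}\,dx$, extended to tempered distributions. The Sobolev space $H^s=H^s(\mathbb{R}^n)$ consists of all $f\in\mathcal{S}'(\mathbb{R}^n)$ with $\widehat f\mu_s\in L^2(\mathbb{R}^n)$, with inner product $\langle f,g\rangle_{H^s}=\int_{\mathbb{R}^n}\widehat f(t)\overline{\widehat g(t)}\mu_s^2(t)\,dt$. The Hilbert space $\ell^2_s=\ell_s^2(\mathbb{Z}^n)$ consists of sequences $c=(c_k)_{k\in\mathbb{Z}^n}$ with $\sum_k|c_k|^2\mu_s^2(k)<\infty$,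 with inner product $\langle c,d\rangle_{\ell^2_s}=\sum_{k\in\mathbb{Z}^n}c_k\overline{d_k}\mu_s^2(k)$. $H(\mathbb{T}^n,\ell_s^2)$ is the Hilbert space of measurable $F:\mathbb{T}^n\to\ell^2_s$ with $\int_{\mathbb{T}^n}\|F(t)\|^2_{\ell_s^2}\,dt<\infty$ and inner product $\int_{\mathbb{T}^n}\langle F_1(t),F_2(t)\rangle_{\ell_s^2}\,dt$. The map $\mathcal{T}_s:H^s\to H(\mathbb{T}^n,\ell_s^2)$ is the isometric isomorphism defined as follows: for $f=(1-\frac{\Delta}{4\pi^2})^{-s/2}g$ with $g\in L^2(\mathbb{R}^n)$ (i.e. $\widehat g=\mu_s\widehat f$), $\mathcal{T}_sf(t)=\left(\frac{\widehat g(t+k)}{\mu_s(k)}\right)_{k\in\mathbb{Z}^n}=\left(\frac{\mu_s(t+k)}{\mu_s(k)}\widehat f(t+k)\right)_{k\in\mathbb{Z}^n}$. For $k\in\mathbb{Z}^n$, $T_kf=f(\cdot-k)$. A subspace $W\subset H^s$ is shift-invariant (SI) if $f\in W$ implies $T_kf\in W$ for all $k\in\mathbb{Z}^n$. A range function is a mapping $J_s:\mathbb{T}^n\to\{\text{closed subspaces of }\ell_s^2\}$; it is measurable if $t\mapsto\langle P_{J_s}(t)a,b\rangle_{\ell_s^2}$ is measurable for all $a,b\in\ell_s^2$, where $P_{J_s}(t)$ is the orthogonal projection of $\ell_s^2$ onto $J_s(t)$. Every closed SI space $V_s\subset H^s$ has an associated measurable range function $J_s$, unique up to a.e. equality, such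 that $V_s=\{\varphi\in H^s:\mathcal{T}_s\varphi(t)\in J_s(t)\text{ for a.e. }t\in\mathbb{T}^n\}$. A bounded linear operator $L:V_s\to H^s$ is shift-preserving if $LT_k=T_kL$ for all $k\in\mathbb{Z}^n$. A range operator $R_s$ on $J_s$ assigns to $t\in\mathbb{T}^n$ a bounded linear operator $R_s(t)$ defined on a closed subspace of $\ell_s^2$, with values in $\ell_s^2$, such that the domain of $R_s(t)$ is $J_s(t)$ for a.e. $t$; it is measurable if $t\mapsto\langle R_s(t)P_{J_s}(t)a,b\rangle_{\ell_s^2}$ is measurable for all $a,b\in\ell_s^2$. Range operators equal a.e. are identified. Every shift-preserving $L:V_s\to H^s$ has a unique corresponding measurable range operator $R_s$ on $J_s$, characterized by $\mathcal{T}_s(Lf)(t)=R_s(t)(\mathcal{T}_sf(t))$ for a.e. $t\in\mathbb{T}^n$ and all $f\in V_s$. When $L$ maps $V_s$ into $V_s$, $R_s(t)$ maps $J_s(t)$ into $J_s(t)$ for a.e. $t$, and $(R_s(t))^*$, $\sigma(R_s(t))$, self-adjointness and unitarity refer to $R_s(t)$ as an operator on the Hilbert space $J_s(t)\subset\ell_s^2$. $\sigma(\cdot)$ denotes the spectrum. *)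

theory Defs
  imports "HOL-Analysis.Analysis"
begin

section \<open>Operators on complex inner product spaces of functions\<close>

text \<open>
  Both Hilbert spaces below (Sobolev space and weighted sequence space) consist of complex-valued
  functions on some index type, with pointwise vector space operations. A space is therefore given
  by a carrier set together with an inner product \<open>ip\<close>, linear in the first argument.
  Operators are total functions; only their values on the carrier are relevant.
\<close>

definition hnorm :: "(('x \<Rightarrow> complex) \<Rightarrow> ('x \<Rightarrow> complex) \<Rightarrow> complex) \<Rightarrow> ('x \<Rightarrow> complex) \<Rightarrow> real" where
  "hnorm ip u = sqrt (Re (ip u u))"

definition lin_subspace :: "('x \<Rightarrow> complex) set \<Rightarrow> bool" where
  "lin_subspace W \<longleftrightarrow>
     (\<lambda>p. 0) \<in> W \<and>
     (\<forall>u\<in>W. \<forall>v\<in>W. (\<lambda>p. u p + v p) \<in> W) \<and>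
     (\<forall>c. \<forall>u\<in>W. (\<lambda>p. c * u p) \<in> W)"

definition closed_subspace ::
  "(('x \<Rightarrow> complex) \<Rightarrow> ('x \<Rightarrow> complex) \<Rightarrow> complex) \<Rightarrow> ('x \<Rightarrow> complex) set \<Rightarrow> ('x \<Rightarrow> complex) set \<Rightarrow> bool" where
  "closed_subspace ip H W \<longleftrightarrow>
     W \<subseteq> H \<and> lin_subspace W \<and>
     (\<forall>X u. (\<forall>m::nat. X m \<in> W) \<and> u \<in> H \<and> (\<lambda>m. hnorm ip (\<lambda>p. X m p - u p)) \<longlonglongrightarrow> 0 \<longrightarrow> u \<in> W)"

definition bounded_operator ::
  "(('x \<Rightarrow> complex) \<Rightarrow> ('x \<Rightarrow> complex) \<Rightarrow> complex) \<Rightarrow> ('x \<Rightarrow> complex) set \<Rightarrow> ('x \<Rightarrow> complex) set \<Rightarrow>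
   (('x \<Rightarrow> complex) \<Rightarrow> ('x \<Rightarrow> complex)) \<Rightarrow> bool" where
  "bounded_operator ip W U T \<longleftrightarrow>
     (\<forall>u\<in>W. T u \<in> U) \<and>
     (\<forall>u\<in>W. \<forall>v\<in>W. T (\<lambda>p. u p + v p) = (\<lambda>p. T u p + T v p)) \<and>
     (\<forall>c. \<forall>u\<in>W. T (\<lambda>p. c * u p) = (\<lambda>p. c * T u p)) \<and>
     (\<exists>K. \<forall>u\<in>W. hnorm ip (T u) \<le> K * hnorm ip u)"

definition orth_proj ::
  "(('x \<Rightarrow> complex) \<Rightarrow> ('x \<Rightarrow> complex) \<Rightarrow> complex) \<Rightarrow> ('x \<Rightarrow> complex) set \<Rightarrow> ('x \<Rightarrow> complex) \<Rightarrow> ('x \<Rightarrow> complex)" where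
  "orth_proj ip W u = (THE v. v \<in> W \<and> (\<forall>w\<in>W. ip (\<lambda>p. u p - v p) w = 0))"

definition adjoint_on ::
  "(('x \<Rightarrow> complex) \<Rightarrow> ('x \<Rightarrow> complex) \<Rightarrow> complex) \<Rightarrow> ('x \<Rightarrow> complex) set \<Rightarrow>
   (('x \<Rightarrow> complex) \<Rightarrow> ('x \<Rightarrow> complex)) \<Rightarrow> (('x \<Rightarrow> complex) \<Rightarrow> ('x \<Rightarrow> complex))" where
  "adjoint_on ip W T v = (THE w. w \<in> W \<and> (\<forall>u\<in>W. ip (T u) v = ip u w))"

definition selfadjoint_on ::
  "(('x \<Rightarrow> complex) \<Rightarrow> ('x \<Rightarrow> complex) \<Rightarrow> complex) \<Rightarrow> ('x \<Rightarrow> complex) set \<Rightarrow>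
   (('x \<Rightarrow> complex) \<Rightarrow> ('x \<Rightarrow> complex)) \<Rightarrow> bool" where
  "selfadjoint_on ip W T \<longleftrightarrow>
     bounded_operator ip W W T \<and> (\<forall>u\<in>W. adjoint_on ip W T u = T u)"

definition unitary_on ::
  "(('x \<Rightarrow> complex) \<Rightarrow> ('x \<Rightarrow> complex) \<Rightarrow> complex) \<Rightarrow> ('x \<Rightarrow> complex) set \<Rightarrow>
   (('x \<Rightarrow> complex) \<Rightarrow> ('x \<Rightarrow> complex)) \<Rightarrow> bool" where
  "unitary_on ip W T \<longleftrightarrow>
     bounded_operator ip W W T \<and>
     (\<forall>u\<in>W. adjoint_on ip W T (T u) = u \<and> T (adjoint_on ip W T u) = u)"

definition spectrum_on ::
  "(('x \<Rightarrow> complex) \<Rightarrow> ('x \<Rightarrow> complex) \<Rightarrow> complex) \<Rightarrow> ('x \<Rightarrow> complex) set \<Rightarrow>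
   (('x \<Rightarrow> complex) \<Rightarrow> ('x \<Rightarrow> complex)) \<Rightarrow> complex set" where
  "spectrum_on ip W T =
     {c. \<not> (\<exists>S. bounded_operator ip W W S \<and>
               (\<forall>u\<in>W. S (\<lambda>p. T u p - c * u p) = u \<and> (\<lambda>p. T (S u) p - c * S u p) = u))}"


section \<open>Schwartz functions and tempered distributions\<close>

text \<open>Iterated partial derivatives are indexed by lists of coordinates instead of multi-indices.\<close>

primrec iter_partial :: "'n list \<Rightarrow> (real^'n::finite \<Rightarrow> complex) \<Rightarrow> (real^'n \<Rightarrow> complex)" where
  "iter_partial [] \<phi> = \<phi>"
| "iter_partial (j # js) \<phi> = (\<lambda>x. frechet_derivative (iter_partial js \<phi>) (at x) (axis j 1))"

definition schwartz :: "(real^'n::finite \<Rightarrow> complex) set" where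
  "schwartz =
     {\<phi>. \<forall>js. (\<forall>x. iter_partial js \<phi> differentiable (at x)) \<and>
             (\<forall>m::nat. \<exists>C. \<forall>x. (1 + norm x) ^ m * norm (iter_partial js \<phi> x) \<le> C)}"

definition schwartz_seminorm :: "nat \<Rightarrow> 'n list \<Rightarrow> (real^'n::finite \<Rightarrow> complex) \<Rightarrow> real" where
  "schwartz_seminorm m js \<phi> = (SUP x. (1 + norm x) ^ m * norm (iter_partial js \<phi> x))"

text \<open>
  A distribution is a functional on all functions that vanishes outside the Schwartz space, so
  that equality of distributions is equality of functions. Continuity of a linear functional is
  expressed through the seminorms defining the topology of the Schwartz space.
\<close>

definition tempered :: "((real^'n::finite \<Rightarrow> complex) \<Rightarrow> complex) set" where
  "tempered =
     {f. (\<forall>\<phi>. \<phi> \<notin> schwartz \<longrightarrow> f \<phi> = 0) \<and>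
         (\<forall>\<phi>\<in>schwartz. \<forall>\<psi>\<in>schwartz. f (\<lambda>x. \<phi> x + \<psi> x) = f \<phi> + f \<psi>) \<and>
         (\<forall>c. \<forall>\<phi>\<in>schwartz. f (\<lambda>x. c * \<phi> x) = c * f \<phi>) \<and>
         (\<exists>C N. \<forall>\<phi>\<in>schwartz.
            norm (f \<phi>) \<le> C * (\<Sum>js\<in>{js. length js \<le> N}. schwartz_seminorm N js \<phi>))}"

definition fourier :: "(real^'n::finite \<Rightarrow> complex) \<Rightarrow> (real^'n \<Rightarrow> complex)" where
  "fourier \<phi> t = (LINT x|lebesgue. \<phi> x * exp (- 2 * complex_of_real pi * \<i> * complex_of_real (x \<bullet> t)))"

definition fourier_dist ::
  "((real^'n::finite \<Rightarrow> complex) \<Rightarrow> complex) \<Rightarrow> ((real^'n \<Rightarrow> complex) \<Rightarrow> complex)" where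
  "fourier_dist f \<phi> = (if \<phi> \<in> schwartz then f (fourier \<phi>) else 0)"

definition represents ::
  "(real^'n::finite \<Rightarrow> complex) \<Rightarrow> ((real^'n \<Rightarrow> complex) \<Rightarrow> complex) \<Rightarrow> bool" where
  "represents h f \<longleftrightarrow>
     h \<in> borel_measurable lebesgue \<and>
     (\<forall>\<phi>\<in>schwartz. integrable lebesgue (\<lambda>x. h x * \<phi> x) \<and> f \<phi> = (LINT x|lebesgue. h x * \<phi> x))"

text \<open>
  A representative of the Fourier transform of \<open>f\<close>, when that is a function;
  representatives are determined up to a null set.
\<close>

definition fourier_fun :: "((real^'n::finite \<Rightarrow> complex) \<Rightarrow> complex) \<Rightarrow> (real^'n \<Rightarrow> complex)" where
  "fourier_fun f = (SOME h. represents h (fourier_dist f))"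


section \<open>Sobolev spaces and weighted sequence spaces\<close>

definition mu :: "real \<Rightarrow> real^'n::finite \<Rightarrow> real" where
  "mu s x = (1 + (norm x)\<^sup>2) powr (s / 2)"

definition lattice_vec :: "int^'n::finite \<Rightarrow> real^'n" where
  "lattice_vec k = (\<chi> i. real_of_int (k $ i))"

definition sobolev :: "real \<Rightarrow> ((real^'n::finite \<Rightarrow> complex) \<Rightarrow> complex) set" where
  "sobolev s =
     {f \<in> tempered. \<exists>h. represents h (fourier_dist f) \<and>
                       integrable lebesgue (\<lambda>t. (norm (h t * complex_of_real (mu s t)))\<^sup>2)}"

definition sobolev_inner ::
  "real \<Rightarrow> ((real^'n::finite \<Rightarrow> complex) \<Rightarrow> complex) \<Rightarrow> ((real^'n \<Rightarrow> complex) \<Rightarrow> complex) \<Rightarrow> complex" where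
  "sobolev_inner s f g =
     (LINT t|lebesgue. fourier_fun f t * cnj (fourier_fun g t) * complex_of_real ((mu s t)\<^sup>2))"

definition ell2 :: "real \<Rightarrow> (int^'n::finite \<Rightarrow> complex) set" where
  "ell2 s = {c. (\<lambda>k. (norm (c k))\<^sup>2 * (mu s (lattice_vec k))\<^sup>2) summable_on UNIV}"

definition ell2_inner ::
  "real \<Rightarrow> (int^'n::finite \<Rightarrow> complex) \<Rightarrow> (int^'n \<Rightarrow> complex) \<Rightarrow> complex" where
  "ell2_inner s c d = (\<Sum>\<^sub>\<infinity>k. c k * cnj (d k) * complex_of_real ((mu s (lattice_vec k))\<^sup>2))"


section \<open>Shift-invariant spaces, range functions and range operators\<close>

definition torus :: "(real^'n::finite) set" where
  "torus = {t. \<forall>i. - 1/2 \<le> t $ i \<and> t $ i < 1/2}"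

definition fiber_map ::
  "real \<Rightarrow> ((real^'n::finite \<Rightarrow> complex) \<Rightarrow> complex) \<Rightarrow> real^'n \<Rightarrow> (int^'n \<Rightarrow> complex)" where
  "fiber_map s f t =
     (\<lambda>k. complex_of_real (mu s (t + lattice_vec k) / mu s (lattice_vec k))
           * fourier_fun f (t + lattice_vec k))"

text \<open>The distribution \<open>f(\<cdot> - k)\<close> acts on a test function \<open>\<phi>\<close> as \<open>f\<close> acts on \<open>\<phi>(\<cdot> + k)\<close>.\<close>

definition shift ::
  "int^'n::finite \<Rightarrow> ((real^'n \<Rightarrow> complex) \<Rightarrow> complex) \<Rightarrow> ((real^'n \<Rightarrow> complex) \<Rightarrow> complex)" where
  "shift k f = (\<lambda>\<phi>. f (\<lambda>x. \<phi> (x + lattice_vec k)))"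

definition closed_shift_invariant ::
  "real \<Rightarrow> ((real^'n::finite \<Rightarrow> complex) \<Rightarrow> complex) set \<Rightarrow> bool" where
  "closed_shift_invariant s V \<longleftrightarrow>
     closed_subspace (sobolev_inner s) (sobolev s) V \<and> (\<forall>f\<in>V. \<forall>k. shift k f \<in> V)"

definition measurable_range_function ::
  "real \<Rightarrow> (real^'n::finite \<Rightarrow> (int^'n \<Rightarrow> complex) set) \<Rightarrow> bool" where
  "measurable_range_function s J \<longleftrightarrow>
     (\<forall>t\<in>torus. closed_subspace (ell2_inner s) (ell2 s) (J t)) \<and>
     (\<forall>a\<in>ell2 s. \<forall>b\<in>ell2 s.
        (\<lambda>t. ell2_inner s (orth_proj (ell2_inner s) (J t) a) b) \<in> borel_measurable (lebesgue_on torus))"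

definition associated_range_function ::
  "real \<Rightarrow> ((real^'n::finite \<Rightarrow> complex) \<Rightarrow> complex) set \<Rightarrow> (real^'n \<Rightarrow> (int^'n \<Rightarrow> complex) set) \<Rightarrow> bool" where
  "associated_range_function s V J \<longleftrightarrow>
     measurable_range_function s J \<and>
     V = {f \<in> sobolev s. AE t in lebesgue_on torus. fiber_map s f t \<in> J t}"

definition shift_preserving ::
  "real \<Rightarrow> ((real^'n::finite \<Rightarrow> complex) \<Rightarrow> complex) set \<Rightarrow> ((real^'n \<Rightarrow> complex) \<Rightarrow> complex) set \<Rightarrow>
   (((real^'n \<Rightarrow> complex) \<Rightarrow> complex) \<Rightarrow> ((real^'n \<Rightarrow> complex) \<Rightarrow> complex)) \<Rightarrow> bool" where
  "shift_preserving s V W L \<longleftrightarrow>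
     bounded_operator (sobolev_inner s) V W L \<and>
     (\<forall>k. \<forall>f\<in>V. L (shift k f) = shift k (L f))"

text \<open>
  The domain of \<open>R t\<close> is \<open>J t\<close> for almost every \<open>t\<close>. For the remaining \<open>t\<close> nothing is required
  of \<open>R t\<close>, since range operators are identified if they agree almost everywhere.
\<close>

definition measurable_range_operator ::
  "real \<Rightarrow> (real^'n::finite \<Rightarrow> (int^'n \<Rightarrow> complex) set) \<Rightarrow>
   (real^'n \<Rightarrow> (int^'n \<Rightarrow> complex) \<Rightarrow> (int^'n \<Rightarrow> complex)) \<Rightarrow> bool" where
  "measurable_range_operator s J R \<longleftrightarrow>
     (AE t in lebesgue_on torus. bounded_operator (ell2_inner s) (J t) (ell2 s) (R t)) \<and>
     (\<forall>a\<in>ell2 s. \<forall>b\<in>ell2 s.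
        (\<lambda>t. ell2_inner s (R t (orth_proj (ell2_inner s) (J t) a)) b) \<in> borel_measurable (lebesgue_on torus))"

definition corresponding_range_operator ::
  "real \<Rightarrow> ((real^'n::finite \<Rightarrow> complex) \<Rightarrow> complex) set \<Rightarrow> (real^'n \<Rightarrow> (int^'n \<Rightarrow> complex) set) \<Rightarrow>
   (((real^'n \<Rightarrow> complex) \<Rightarrow> complex) \<Rightarrow> ((real^'n \<Rightarrow> complex) \<Rightarrow> complex)) \<Rightarrow>
   (real^'n \<Rightarrow> (int^'n \<Rightarrow> complex) \<Rightarrow> (int^'n \<Rightarrow> complex)) \<Rightarrow> bool" where
  "corresponding_range_operator s V J L R \<longleftrightarrow>
     measurable_range_operator s J R \<and>
     (\<forall>f\<in>V. AE t in lebesgue_on torus. fiber_map s (L f) t = R t (fiber_map s f t))"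

end

theory Submission
  imports Defs
begin

text \<open>
  The fiber map is an isometric isomorphism of \<open>H\<^sup>s\<close> onto the square integrable fields over the torus,
  and it maps \<open>V\<close> onto the fields with values in \<open>J t\<close>. Hence \<open>V\<close> is stable under multiplying fibers by
  indicator functions, and this localises identities and inequalities between inner products on \<open>V\<close> to
  almost every fiber. It also contains, for every sequence \<open>a\<close>, an element with fibers
  \<open>t \<mapsto> P\<^bsub>J(t)\<^esub> a\<close>; letting \<open>a\<close> range over a countable dense set turns statements about the fibers of
  each element of \<open>V\<close> into statements about all of \<open>J t\<close> outside one null set. This gives
  \<open>R\<^sup>*(t) = (R t)\<^sup>*\<close> and with it self-adjointness and unitarity. The spectrum of a self-adjoint operator
  lies in \<open>[A, B]\<close> iff its quadratic form lies between \<open>A\<close> and \<open>B\<close>, which again is a fiberwise condition.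

  Completeness of \<open>H\<^sup>s\<close> and surjectivity of the fiber map rest on the Fourier transform being a bijection
  of the Schwartz space, and on a function being determined by its integrals against Schwartz functions.
\<close>

section \<open>Operators on Hilbert spaces of functions\<close>

text \<open>The spectrum does not pass to fibers directly: fiberwise resolvents would need
  measurability in \<open>t\<close> and an essential bound before they could be reassembled into an
  operator on \<open>V\<close>. Bounds of the quadratic form involve inner products only, and these
  are integrals over the torus of inner products of fibers.

  The order of quantifiers is the main obstacle. A relation such as
  \<open>fib (L f) t = R t (fib f t)\<close> holds off a null set depending on \<open>f\<close>,
  while the claims about \<open>R t\<close> concern every vector of \<open>J t\<close> at once.
  Boundedness of each single \<open>R t\<close> extends them from a dense set.

  A second obstacle is that \<open>fourier_fun\<close> is a choice of representative, so equations
  between transforms hold almost everywhere only. Equality of two elements of the Sobolev space is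
  recovered from definiteness of the inner product, which in turn requires that a distribution is
  determined by its values on transforms of Schwartz functions.

  Adjoints and spectra are treated in one abstract Hilbert space over a carrier set, so that the
  same lemmas serve \<open>V\<close> and every \<open>J t\<close>.\<close>

lemma lin_subspace_zero: "lin_subspace W \<Longrightarrow> (\<lambda>p. 0) \<in> W"
  and lin_subspace_add: "lin_subspace W \<Longrightarrow> u \<in> W \<Longrightarrow> v \<in> W \<Longrightarrow> (\<lambda>p. u p + v p) \<in> W"
  and lin_subspace_scale: "lin_subspace W \<Longrightarrow> u \<in> W \<Longrightarrow> (\<lambda>p. c * u p) \<in> W"
  by (auto simp: lin_subspace_def)

lemma lin_subspace_diff:
  assumes "lin_subspace W" "u \<in> W" "v \<in> W" shows "(\<lambda>p. u p - v p) \<in> W"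
  using lin_subspace_add[OF assms(1,2) lin_subspace_scale[OF assms(1,3), of "-1"]] by simp

lemma lin_subspace_diff_scale:
  assumes "lin_subspace W" "u \<in> W" "v \<in> W" shows "(\<lambda>p. u p - c * v p) \<in> W"
  using assms by (intro lin_subspace_diff lin_subspace_scale)

lemma bounded_operatorD:
  assumes "bounded_operator ip' U U' T"
  shows "u \<in> U \<Longrightarrow> T u \<in> U'"
    and "u \<in> U \<Longrightarrow> v \<in> U \<Longrightarrow> T (\<lambda>p. u p + v p) = (\<lambda>p. T u p + T v p)"
    and "u \<in> U \<Longrightarrow> T (\<lambda>p. c * u p) = (\<lambda>p. c * T u p)"
  using assms by (auto simp: bounded_operator_def)

lemma bounded_operator_diff:
  assumes "bounded_operator ip' U U' T" "lin_subspace U" "u \<in> U" "v \<in> U"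
  shows "T (\<lambda>p. u p - v p) = (\<lambda>p. T u p - T v p)"
  using bounded_operatorD(2)[OF assms(1,3) lin_subspace_scale[OF assms(2,4)], of "-1"]
    bounded_operatorD(3)[OF assms(1,4), of "-1"] by simp

text \<open>All axioms quantify over the carrier only, so linear subspaces inherit them; this is how
  \<open>V\<close> and the fibers \<open>J t\<close> become instances. Definiteness asks for the
  zero function itself, not for a null class.\<close>

locale inner_fun =
  fixes ip :: "('x \<Rightarrow> complex) \<Rightarrow> ('x \<Rightarrow> complex) \<Rightarrow> complex" and W :: "('x \<Rightarrow> complex) set"
  assumes sub: "lin_subspace W"
    and ip_add: "\<And>u v w. u \<in> W \<Longrightarrow> v \<in> W \<Longrightarrow> w \<in> W \<Longrightarrow> ip (\<lambda>p. u p + v p) w = ip u w + ip v w"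
    and ip_scale: "\<And>c u w. u \<in> W \<Longrightarrow> w \<in> W \<Longrightarrow> ip (\<lambda>p. c * u p) w = c * ip u w"
    and ip_sym: "\<And>u v. u \<in> W \<Longrightarrow> v \<in> W \<Longrightarrow> ip v u = cnj (ip u v)"
    and ip_ge: "\<And>u. u \<in> W \<Longrightarrow> Re (ip u u) \<ge> 0"
    and ip_definite: "\<And>u. u \<in> W \<Longrightarrow> ip u u = 0 \<Longrightarrow> u = (\<lambda>p. 0)"
begin

lemmas mem_zero = lin_subspace_zero[OF sub]
lemmas mem_add = lin_subspace_add[OF sub]
lemmas mem_scale = lin_subspace_scale[OF sub]
lemmas mem_diff = lin_subspace_diff[OF sub]
lemmas mem_diff_scale = lin_subspace_diff_scale[OF sub]
lemmas mem = mem_zero mem_add mem_scale mem_diff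

lemma ip_diff:
  assumes "u \<in> W" "v \<in> W" "w \<in> W" shows "ip (\<lambda>p. u p - v p) w = ip u w - ip v w"
  using ip_add[OF assms(1) mem_scale[OF assms(2), of "-1"] assms(3)] ip_scale[OF assms(2,3), of "-1"]
  by simp

lemma ip_add_right:
  assumes "u \<in> W" "v \<in> W" "w \<in> W" shows "ip w (\<lambda>p. u p + v p) = ip w u + ip w v"
  using ip_add[OF assms] ip_sym[OF mem_add[OF assms(1,2)] assms(3)] ip_sym[OF assms(1,3)] ip_sym[OF assms(2,3)]
  by simp

lemma ip_scale_right:
  assumes "u \<in> W" "w \<in> W" shows "ip w (\<lambda>p. c * u p) = cnj c * ip w u"
  using ip_scale[OF assms] ip_sym[OF mem_scale[OF assms(1)] assms(2)] ip_sym[OF assms]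
  by simp

lemma ip_diff_right:
  assumes "u \<in> W" "v \<in> W" "w \<in> W" shows "ip w (\<lambda>p. u p - v p) = ip w u - ip w v"
  using ip_diff[OF assms] ip_sym[OF mem_diff[OF assms(1,2)] assms(3)] ip_sym[OF assms(1,3)] ip_sym[OF assms(2,3)]
  by simp

lemmas ip_lin = ip_add ip_scale ip_diff ip_add_right ip_scale_right ip_diff_right

lemma ip_zero: "w \<in> W \<Longrightarrow> ip (\<lambda>p. 0) w = 0" "w \<in> W \<Longrightarrow> ip w (\<lambda>p. 0) = 0"
  using ip_scale[of "\<lambda>p. 0" w 0] ip_scale_right[of "\<lambda>p. 0" w 0] mem_zero by auto

lemma ip_self: "u \<in> W \<Longrightarrow> ip u u = complex_of_real ((hnorm ip u)\<^sup>2)"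
  using ip_sym[of u u] ip_ge[of u] by (auto simp: complex_eq_iff hnorm_def)

lemma hnorm_ge: "u \<in> W \<Longrightarrow> 0 \<le> hnorm ip u"
  using ip_ge by (simp add: hnorm_def)

lemma hnorm_square: "u \<in> W \<Longrightarrow> (hnorm ip u)\<^sup>2 = Re (ip u u)"
  using ip_ge by (simp add: hnorm_def)

lemma hnorm_definite: "u \<in> W \<Longrightarrow> hnorm ip u = 0 \<Longrightarrow> u = (\<lambda>p. 0)"
  using ip_self ip_definite by auto

lemma hnorm_zero: "hnorm ip (\<lambda>p. 0) = 0"
  using ip_zero(1)[OF mem_zero] by (simp add: hnorm_def)

text \<open>The free scalar \<open>c\<close> makes one expansion serve homogeneity (first vector
  zero), the triangle inequality (\<open>c = 1\<close>), Cauchy-Schwarz and the variational proof of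
  Riesz' theorem.\<close>

lemma hnorm_square_add:
  assumes "u \<in> W" "v \<in> W"
  shows "(hnorm ip (\<lambda>p. u p + c * v p))\<^sup>2
     = (hnorm ip u)\<^sup>2 + 2 * Re (c * ip v u) + (cmod c)\<^sup>2 * (hnorm ip v)\<^sup>2"
proof -
  have *: "ip u v = cnj (ip v u)" using ip_sym assms by blast
  have "(hnorm ip (\<lambda>p. u p + c * v p))\<^sup>2 = Re (ip u u + c * ip v u + cnj c * ip u v + c * cnj c * ip v v)"
    using assms by (subst hnorm_square) (simp_all add: mem ip_lin algebra_simps)
  also have "\<dots> = (hnorm ip u)\<^sup>2 + 2 * Re (c * ip v u) + (cmod c)\<^sup>2 * (hnorm ip v)\<^sup>2"
    unfolding * by (simp add: ip_self assms complex_mult_cnj cmod_power2 del: Re_complex_of_real of_real_power)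
       (simp add: algebra_simps)
  finally show ?thesis .
qed

lemma hnorm_scale: "u \<in> W \<Longrightarrow> hnorm ip (\<lambda>p. c * u p) = cmod c * hnorm ip u"
  using hnorm_square_add[of "\<lambda>p. 0" u c] hnorm_zero ip_zero(2)[of u] mem_zero hnorm_ge[of u] hnorm_ge[OF mem_scale, of u c]
  by (simp add: flip: power_mult_distrib)

lemma hnorm_minus_commute:
  assumes "u \<in> W" "v \<in> W" shows "hnorm ip (\<lambda>p. u p - v p) = hnorm ip (\<lambda>p. v p - u p)"
  using hnorm_scale[OF mem_diff[OF assms], of "-1"] by simp

lemma Cauchy_Schwarz:
  assumes u: "u \<in> W" and v: "v \<in> W" shows "cmod (ip u v) \<le> hnorm ip u * hnorm ip v"
proof (cases "hnorm ip v = 0")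
  case True
  then show ?thesis using hnorm_definite[OF v] ip_zero(2)[OF u] by simp
next
  case False
  then have pos: "hnorm ip v > 0" using hnorm_ge[OF v] by simp
  define N where "N = (hnorm ip v)\<^sup>2"
  \<comment> \<open>With this \<open>c\<close> the vector \<open>u + c v\<close> is the component of
    \<open>u\<close> orthogonal to \<open>v\<close>; nonnegativity of its squared norm is the
    claim.\<close>
  define c where "c = - ip u v / N"
  have N: "N > 0" using pos by (simp add: N_def)
  have *: "ip v u = cnj (ip u v)" using ip_sym assms by blast
  have "0 \<le> (hnorm ip (\<lambda>p. u p + c * v p))\<^sup>2" by simp
  also have "\<dots> = (hnorm ip u)\<^sup>2 + 2 * Re (c * ip v u) + (cmod c)\<^sup>2 * N"
    unfolding N_def by (rule hnorm_square_add[OF assms])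
  also have "c * ip v u = complex_of_real (- (cmod (ip u v))\<^sup>2 / N)"
    unfolding c_def * by (simp add: complex_norm_square del: of_real_power)
  also have "(cmod c)\<^sup>2 * N = (cmod (ip u v))\<^sup>2 / N"
    using N by (simp add: c_def norm_divide power_divide power2_eq_square)
  finally have "(cmod (ip u v))\<^sup>2 / N \<le> (hnorm ip u)\<^sup>2" by simp
  then have "(cmod (ip u v))\<^sup>2 \<le> (hnorm ip u * hnorm ip v)\<^sup>2"
    using N by (simp add: pos_divide_le_eq power_mult_distrib N_def)
  then show ?thesis by (rule power2_le_imp_le) (simp add: hnorm_ge assms)
qed

lemma hnorm_triangle:
  assumes u: "u \<in> W" and v: "v \<in> W"
  shows "hnorm ip (\<lambda>p. u p + v p) \<le> hnorm ip u + hnorm ip v"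
proof (rule power2_le_imp_le)
  have "Re (ip v u) \<le> hnorm ip u * hnorm ip v"
    using Cauchy_Schwarz[OF v u] complex_Re_le_cmod[of "ip v u"] by (simp add: mult.commute)
  then show "(hnorm ip (\<lambda>p. u p + v p))\<^sup>2 \<le> (hnorm ip u + hnorm ip v)\<^sup>2"
    using hnorm_square_add[OF u v, of 1] by (simp add: power2_sum)
qed (simp add: hnorm_ge assms)

lemma hnorm_diff_triangle:
  assumes "u \<in> W" "v \<in> W" "w \<in> W"
  shows "hnorm ip (\<lambda>p. u p - w p) \<le> hnorm ip (\<lambda>p. u p - v p) + hnorm ip (\<lambda>p. v p - w p)"
  using hnorm_triangle[OF mem_diff[OF assms(1,2)] mem_diff[OF assms(2,3)]] by simp

lemma ip_eqI:
  assumes "u \<in> W" "v \<in> W" "\<And>w. w \<in> W \<Longrightarrow> ip w u = ip w v" shows "u = v"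
proof -
  let ?d = "\<lambda>p. u p - v p"
  have d: "?d \<in> W" by (rule mem_diff[OF assms(1,2)])
  have "ip ?d ?d = ip ?d u - ip ?d v"
    using ip_diff_right[OF assms(1,2) d] .
  then have "?d = (\<lambda>p. 0)" using assms(3)[OF d] ip_definite[OF d] by simp
  then show ?thesis by (metis eq_iff_diff_eq_0 ext)
qed

lemma ip_tendsto:
  assumes X: "\<And>m. X m \<in> W" and u: "u \<in> W" and w: "w \<in> W"
    and lim: "(\<lambda>m. hnorm ip (\<lambda>p. X m p - u p)) \<longlonglongrightarrow> 0"
  shows "(\<lambda>m. ip (X m) w) \<longlonglongrightarrow> ip u w"
proof (rule LIM_zero_cancel, rule tendsto_norm_zero_cancel, rule tendsto_sandwich[of "\<lambda>_. 0"])
  show "\<forall>\<^sub>F m in sequentially. cmod (ip (X m) w - ip u w) \<le> hnorm ip (\<lambda>p. X m p - u p) * hnorm ip w"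
    using Cauchy_Schwarz[OF mem_diff[OF X u] w] ip_diff[OF X u w] by simp
  show "(\<lambda>m. hnorm ip (\<lambda>p. X m p - u p) * hnorm ip w) \<longlonglongrightarrow> 0"
    using tendsto_mult_right[OF lim, of "hnorm ip w"] by simp
qed auto

end

section \<open>Completeness and the Riesz representation theorem\<close>

locale hilbert_fun = inner_fun +
  assumes complete: "\<And>X. (\<And>m::nat. X m \<in> W) \<Longrightarrow>
      (\<And>e. e > 0 \<Longrightarrow> \<exists>N. \<forall>m\<ge>N. \<forall>k\<ge>N. hnorm ip (\<lambda>p. X m p - X k p) < e) \<Longrightarrow>
      \<exists>u\<in>W. (\<lambda>m. hnorm ip (\<lambda>p. X m p - u p)) \<longlonglongrightarrow> 0"
begin

lemma closed_subspace_hilbert: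
  assumes "closed_subspace ip W U" shows "hilbert_fun ip U"
proof -
  have U: "U \<subseteq> W" "lin_subspace U" using assms by (auto simp: closed_subspace_def)
  have UW: "u \<in> U \<Longrightarrow> u \<in> W" for u using U by auto
  show ?thesis
  proof (unfold_locales)
    fix X assume X: "\<And>m::nat. X m \<in> U"
      and "\<And>e. e > 0 \<Longrightarrow> \<exists>N. \<forall>m\<ge>N. \<forall>k\<ge>N. hnorm ip (\<lambda>p. X m p - X k p) < e"
    then obtain u where "u \<in> W" "(\<lambda>m. hnorm ip (\<lambda>p. X m p - u p)) \<longlonglongrightarrow> 0"
      using complete[of X] UW by meson
    then show "\<exists>u\<in>U. (\<lambda>m. hnorm ip (\<lambda>p. X m p - u p)) \<longlonglongrightarrow> 0"
      using assms X unfolding closed_subspace_def by blast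
  qed (use U(2) in \<open>auto intro: ip_add ip_scale ip_sym ip_ge ip_definite UW\<close>)
qed

text \<open>Minimises \<open>|u|\<^sup>2 - 2 Re (\<phi> u)\<close>.\<close>

theorem Riesz:
  assumes add: "\<And>u v. u \<in> W \<Longrightarrow> v \<in> W \<Longrightarrow> \<phi> (\<lambda>p. u p + v p) = \<phi> u + \<phi> v"
    and scale: "\<And>c u. u \<in> W \<Longrightarrow> \<phi> (\<lambda>p. c * u p) = c * \<phi> u"
    and bound: "\<And>u. u \<in> W \<Longrightarrow> cmod (\<phi> u) \<le> K * hnorm ip u"
  shows "\<exists>w\<in>W. \<forall>u\<in>W. \<phi> u = ip u w"
proof -
  define Q where "Q u = (hnorm ip u)\<^sup>2 - 2 * Re (\<phi> u)" for u
  \<comment> \<open>Completing the square: \<open>Q u\<close> is at least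
    \<open>|u|^2 - 2 K |u|\<close>.\<close>
  have lower: "- K\<^sup>2 \<le> Q u" if "u \<in> W" for u
  proof -
    have "0 \<le> (hnorm ip u - K)\<^sup>2" by simp
    moreover have "Re (\<phi> u) \<le> K * hnorm ip u"
      using bound[OF that] complex_Re_le_cmod[of "\<phi> u"] by linarith
    ultimately show ?thesis by (simp add: Q_def power2_eq_square algebra_simps)
  qed
  define d where "d = Inf (Q ` W)"
  have bdd: "bdd_below (Q ` W)" using lower by (auto simp: bdd_below_def)
  have d_le: "d \<le> Q u" if "u \<in> W" for u
    unfolding d_def by (rule cInf_lower) (use that bdd in auto)
  have "\<exists>u\<in>W. Q u < d + 1 / Suc m" for m
  proof -
    have "Inf (Q ` W) < d + 1 / Suc m" by (simp add: d_def)
    then show ?thesis using cInf_lessD[of "Q ` W"] mem_zero by blast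
  qed
  then obtain X where X: "\<And>m. X m \<in> W" "\<And>m. Q (X m) < d + 1 / Suc m" by metis
  have \<phi>0: "\<phi> (\<lambda>p. u p + c * v p) = \<phi> u + c * \<phi> v" if "u \<in> W" "v \<in> W" for u v c
    using add[OF that(1) mem_scale[OF that(2)]] scale[OF that(2)] by simp
  have Qadd: "Q (\<lambda>p. u p + c * v p) = Q u + 2 * Re (c * (ip v u - \<phi> v)) + (cmod c)\<^sup>2 * (hnorm ip v)\<^sup>2"
    if "u \<in> W" "v \<in> W" for u v c
    unfolding Q_def hnorm_square_add[OF that] \<phi>0[OF that] by (simp add: algebra_simps)
  \<comment> \<open>\<open>Q\<close> at the midpoint of \<open>u\<close> and \<open>v\<close> is
    still at least \<open>d\<close>. Combined with the expansion at \<open>v\<close> this is the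
    parallelogram law, and it makes the minimising sequence Cauchy.\<close>
  have par: "(hnorm ip (\<lambda>p. u p - v p))\<^sup>2 \<le> 2 * (Q u - d) + 2 * (Q v - d)" if "u \<in> W" "v \<in> W" for u v
  proof -
    let ?w = "\<lambda>p. v p - u p"
    have w: "?w \<in> W" using that by (simp add: mem)
    have 1: "Q v = Q u + 2 * Re (ip ?w u - \<phi> ?w) + (hnorm ip ?w)\<^sup>2"
      using Qadd[OF that(1) w, of 1] by simp
    have "Q (\<lambda>p. u p + 1/2 * ?w p) = Q u + Re (ip ?w u - \<phi> ?w) + (hnorm ip ?w)\<^sup>2 / 4"
      using Qadd[OF that(1) w, of "1/2"] by (simp add: power2_eq_square)
    moreover have "(\<lambda>p. u p + 1/2 * ?w p) \<in> W" by (intro mem_add mem_scale that w)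
    ultimately have "d \<le> Q u + Re (ip ?w u - \<phi> ?w) + (hnorm ip ?w)\<^sup>2 / 4"
      using d_le by metis
    then show ?thesis unfolding hnorm_minus_commute[OF that] 1 by (simp add: field_simps)
  qed
  have "\<exists>N. \<forall>m\<ge>N. \<forall>k\<ge>N. hnorm ip (\<lambda>p. X m p - X k p) < e" if e: "e > 0" for e
  proof -
    obtain N :: nat where N: "4 / e\<^sup>2 < N" using reals_Archimedean2 by blast
    have "hnorm ip (\<lambda>p. X m p - X k p) < e" if "m \<ge> N" "k \<ge> N" for m k
    proof (rule power2_less_imp_less)
      have "(hnorm ip (\<lambda>p. X m p - X k p))\<^sup>2 < 2 * (1 / Suc m) + 2 * (1 / Suc k)"
        using par[OF X(1) X(1), of m k] X(2)[of m] X(2)[of k] by argo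
      also have "\<dots> \<le> 2 * (1 / Suc N) + 2 * (1 / Suc N)"
        using that by (intro add_mono mult_left_mono divide_left_mono) auto
      also have "\<dots> = 4 / Suc N" by simp
      also have "4 / Suc N < e\<^sup>2"
      proof -
        have "4 < e\<^sup>2 * N" using N e by (simp add: divide_less_eq mult.commute)
        also have "\<dots> \<le> e\<^sup>2 * Suc N" by (intro mult_left_mono) auto
        finally show ?thesis by (simp add: divide_less_eq)
      qed
      finally show "(hnorm ip (\<lambda>p. X m p - X k p))\<^sup>2 < e\<^sup>2" .
    qed (use e in simp)
    then show ?thesis by blast
  qed
  then have "\<exists>w\<in>W. (\<lambda>m. hnorm ip (\<lambda>p. X m p - w p)) \<longlonglongrightarrow> 0"
    by (rule complete[OF X(1)])
  then obtain w where w: "w \<in> W" and lim: "(\<lambda>m. hnorm ip (\<lambda>p. X m p - w p)) \<longlonglongrightarrow> 0" ..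
  have "\<phi> u = ip u w" if u: "u \<in> W" for u
  proof -
    \<comment> \<open>The \<open>+ 1\<close> keeps \<open>N\<close> positive when \<open>u\<close>
      is zero; it is an upper bound for the squared norm of \<open>u\<close> that may be divided
      by.\<close>
    define N where "N = (hnorm ip u)\<^sup>2 + 1"
    have N: "N > 0" "(hnorm ip u)\<^sup>2 \<le> N" by (auto simp: N_def add_nonneg_pos)
    have est: "(cmod (ip u (X m) - \<phi> u))\<^sup>2 \<le> N * (1 / Suc m)" for m
    proof -
      define \<delta> where "\<delta> = ip u (X m) - \<phi> u"
      \<comment> \<open>Moving from \<open>X m\<close> by \<open>c u\<close> lowers \<open>Q\<close>
        by at least \<open>|\<delta>|^2 / N\<close>, yet \<open>X m\<close> is within
        \<open>1 / Suc m\<close> of the infimum.\<close>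
      define c where "c = - cnj \<delta> / N"
      have "d \<le> Q (\<lambda>p. X m p + c * u p)" using mem_add[OF X(1) mem_scale[OF u]] d_le by blast
      also have "\<dots> = Q (X m) + 2 * Re (c * \<delta>) + (cmod c)\<^sup>2 * (hnorm ip u)\<^sup>2"
        unfolding Qadd[OF X(1) u] \<delta>_def ..
      also have "c * \<delta> = complex_of_real (- (cmod \<delta>)\<^sup>2 / N)"
        unfolding c_def by (simp add: complex_norm_square mult.commute del: of_real_power)
      also have "(cmod c)\<^sup>2 * (hnorm ip u)\<^sup>2 \<le> (cmod c)\<^sup>2 * N"
        by (intro mult_left_mono N) simp
      also have "\<dots> = (cmod \<delta>)\<^sup>2 / N"
        using N by (simp add: c_def norm_divide power_divide power2_eq_square)
      finally have "(cmod \<delta>)\<^sup>2 / N \<le> 1 / Suc m" using X(2)[of m] by simp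
      then show ?thesis unfolding \<delta>_def using N by (simp add: pos_divide_le_eq mult.commute)
    qed
    have "(\<lambda>m. (cmod (ip u (X m) - \<phi> u))\<^sup>2) \<longlonglongrightarrow> 0"
    proof (rule tendsto_sandwich[of "\<lambda>_. 0"])
      show "(\<lambda>m. N * (1 / Suc m)) \<longlonglongrightarrow> 0"
        using tendsto_mult_left[OF LIMSEQ_inverse_real_of_nat, of N] by (simp add: inverse_eq_divide)
    qed (use est in auto)
    then have 0: "(\<lambda>m. ip u (X m) - \<phi> u) \<longlonglongrightarrow> 0"
      using tendsto_real_sqrt[of "\<lambda>m. (cmod (ip u (X m) - \<phi> u))\<^sup>2" 0 sequentially]
      by (simp add: tendsto_norm_zero_iff)
    have "(\<lambda>m. ip u (X m)) \<longlonglongrightarrow> ip u w"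
      using tendsto_cnj[OF ip_tendsto[OF X(1) w u lim]] ip_sym[OF X(1) u] ip_sym[OF w u] by simp
    then have "ip u w - \<phi> u = 0"
      by (intro LIMSEQ_unique[OF tendsto_diff[OF _ tendsto_const] 0])
    then show ?thesis by simp
  qed
  then show ?thesis using w by blast
qed


section \<open>Adjoints and bounded inverses\<close>

lemma bounded_operator_bound:
  assumes "bounded_operator ip W U T"
  obtains K where "K > 0" "\<And>u. u \<in> W \<Longrightarrow> hnorm ip (T u) \<le> K * hnorm ip u"
proof -
  obtain K where K: "\<And>u. u \<in> W \<Longrightarrow> hnorm ip (T u) \<le> K * hnorm ip u"
    using assms unfolding bounded_operator_def by blast
  have "hnorm ip (T u) \<le> (\<bar>K\<bar> + 1) * hnorm ip u" if "u \<in> W" for u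
    using K[OF that] hnorm_ge[OF that] mult_right_mono[of K "\<bar>K\<bar> + 1" "hnorm ip u"] by linarith
  then show ?thesis using that[of "\<bar>K\<bar> + 1"] by simp
qed

text \<open>Riesz' theorem for the functional \<open>u \<mapsto> ip (T u) v\<close>, which is
  bounded by Cauchy-Schwarz. Uniqueness gives the definite description in \<open>adjoint_on\<close>
  its meaning.\<close>

lemma adjoint_exists:
  assumes T: "bounded_operator ip W W T" and v: "v \<in> W"
  shows "\<exists>!w. w \<in> W \<and> (\<forall>u\<in>W. ip (T u) v = ip u w)"
proof -
  obtain K where K: "K > 0" "\<And>u. u \<in> W \<Longrightarrow> hnorm ip (T u) \<le> K * hnorm ip u"
    using bounded_operator_bound[OF T] by blast
  note TD = bounded_operatorD[OF T]
  have "\<exists>w\<in>W. \<forall>u\<in>W. ip (T u) v = ip u w"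
  proof (rule Riesz)
    fix u assume u: "u \<in> W"
    have "cmod (ip (T u) v) \<le> hnorm ip (T u) * hnorm ip v" by (rule Cauchy_Schwarz[OF TD(1)[OF u] v])
    also have "\<dots> \<le> (K * hnorm ip u) * hnorm ip v" by (intro mult_right_mono K u hnorm_ge v)
    finally show "cmod (ip (T u) v) \<le> (K * hnorm ip v) * hnorm ip u" by (simp add: ac_simps)
  qed (simp_all add: TD ip_lin v)
  moreover have "w = w'" if "w \<in> W" "\<forall>u\<in>W. ip (T u) v = ip u w" "w' \<in> W" "\<forall>u\<in>W. ip (T u) v = ip u w'" for w w'
    using that by (intro ip_eqI) auto
  ultimately show ?thesis by blast
qed

lemma adjoint_mem: "bounded_operator ip W W T \<Longrightarrow> v \<in> W \<Longrightarrow> adjoint_on ip W T v \<in> W"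
  and ip_adjoint: "bounded_operator ip W W T \<Longrightarrow> v \<in> W \<Longrightarrow> u \<in> W \<Longrightarrow> ip u (adjoint_on ip W T v) = ip (T u) v"
  using theI'[OF adjoint_exists, of T v] by (auto simp: adjoint_on_def)

lemma adjoint_eqI:
  assumes T: "bounded_operator ip W W T" and "v \<in> W" "w \<in> W" "\<And>u. u \<in> W \<Longrightarrow> ip (T u) v = ip u w"
  shows "adjoint_on ip W T v = w"
  using assms by (intro ip_eqI adjoint_mem) (auto simp: ip_adjoint)

text \<open>With \<open>w\<close> the adjoint applied to \<open>v\<close>,
  \<open>|w|^2 = ip (T w) v\<close> is at most \<open>K |w| |v|\<close>, so the adjoint has the same
  bound as \<open>T\<close>. Linearity follows from uniqueness of the adjoint's values.\<close>

lemma adjoint_bounded: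
  assumes T: "bounded_operator ip W W T" shows "bounded_operator ip W W (adjoint_on ip W T)"
proof -
  note TD = bounded_operatorD[OF T]
  obtain K where K: "K > 0" "\<And>u. u \<in> W \<Longrightarrow> hnorm ip (T u) \<le> K * hnorm ip u"
    using bounded_operator_bound[OF T] by blast
  have bound: "hnorm ip (adjoint_on ip W T v) \<le> K * hnorm ip v" if v: "v \<in> W" for v
  proof -
    let ?w = "adjoint_on ip W T v"
    have w: "?w \<in> W" by (rule adjoint_mem[OF T v])
    have "(hnorm ip ?w)\<^sup>2 \<le> cmod (ip ?w ?w)"
      using ip_self[OF w] by (metis abs_le_D1 norm_of_real order_refl)
    also have "\<dots> = cmod (ip (T ?w) v)" by (simp add: ip_adjoint[OF T v w])
    also have "\<dots> \<le> hnorm ip (T ?w) * hnorm ip v" by (rule Cauchy_Schwarz[OF TD(1)[OF w] v])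
    also have "\<dots> \<le> (K * hnorm ip ?w) * hnorm ip v" by (intro mult_right_mono K w hnorm_ge v)
    finally have "hnorm ip ?w * hnorm ip ?w \<le> hnorm ip ?w * (K * hnorm ip v)"
      by (simp add: power2_eq_square ac_simps)
    moreover have "0 \<le> K * hnorm ip v" using K(1) hnorm_ge[OF v] by simp
    ultimately show ?thesis using hnorm_ge[OF w]
      by (metis mult_le_cancel_left_pos order_le_less)
  qed
  show ?thesis unfolding bounded_operator_def
  proof (intro conjI ballI allI)
    show "\<exists>K. \<forall>u\<in>W. hnorm ip (adjoint_on ip W T u) \<le> K * hnorm ip u" using bound by blast
  qed (auto intro!: adjoint_eqI[OF T] simp: mem adjoint_mem[OF T] ip_adjoint[OF T] ip_lin TD)
qed

lemma bounded_operator_shift: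
  assumes T: "bounded_operator ip W W T"
  shows "bounded_operator ip W W (\<lambda>u p. T u p - c * u p)"
proof -
  note TD = bounded_operatorD[OF T]
  obtain K where K: "K > 0" "\<And>u. u \<in> W \<Longrightarrow> hnorm ip (T u) \<le> K * hnorm ip u"
    using bounded_operator_bound[OF T] by blast
  have "hnorm ip (\<lambda>p. T u p - c * u p) \<le> (K + cmod c) * hnorm ip u" if u: "u \<in> W" for u
    using hnorm_triangle[OF TD(1)[OF u] mem_scale[OF u], of "-c"] hnorm_scale[OF u, of "-c"] K(2)[OF u]
    by (simp add: algebra_simps)
  then show ?thesis
    unfolding bounded_operator_def using TD
    by (intro conjI exI[of _ "K + cmod c"]) (auto simp: mem_diff_scale algebra_simps)
qed

text \<open>\<open>\<langle>S u, S v\<rangle>\<close> is an equivalent inner product, and Riesz' theorem for it solves \<open>T (S y) = v\<close>.\<close>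

lemma bounded_below_surj:
  assumes T: "bounded_operator ip W W T" and S: "bounded_operator ip W W S"
    and adj: "\<And>u v. u \<in> W \<Longrightarrow> v \<in> W \<Longrightarrow> ip (T u) v = ip u (S v)"
    and \<delta>: "\<delta> > 0" "\<And>u. u \<in> W \<Longrightarrow> \<delta> * hnorm ip u \<le> hnorm ip (S u)" and v: "v \<in> W"
  shows "\<exists>u\<in>W. T u = v"
proof -
  define a where "a u v = ip (S u) (S v)" for u v
  note TD = bounded_operatorD[OF T] and SD = bounded_operatorD[OF S]
  have norm_a: "hnorm a u = hnorm ip (S u)" for u by (simp add: hnorm_def a_def)
  obtain K where K: "K > 0" "\<And>u. u \<in> W \<Longrightarrow> hnorm ip (S u) \<le> K * hnorm ip u"
    using bounded_operator_bound[OF S] by blast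
  interpret a: hilbert_fun a W
  proof (unfold_locales)
    show "lin_subspace W" by (rule sub)
    show "a v u = cnj (a u v)" if "u \<in> W" "v \<in> W" for u v
      unfolding a_def using that by (intro ip_sym SD)
    show "u = (\<lambda>p. 0)" if u: "u \<in> W" and "a u u = 0" for u
    proof -
      have "hnorm ip (S u) = 0" using that unfolding a_def hnorm_def by simp
      then have "hnorm ip u = 0" using \<delta>(2)[OF u] \<delta>(1) hnorm_ge[OF u] by (simp add: mult_le_0_iff)
      then show ?thesis by (rule hnorm_definite[OF u])
    qed
    fix X assume X: "\<And>m::nat. X m \<in> W"
      and C: "\<And>e. e > 0 \<Longrightarrow> \<exists>N. \<forall>m\<ge>N. \<forall>k\<ge>N. hnorm a (\<lambda>p. X m p - X k p) < e"
    \<comment> \<open>The two norms are equivalent,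
      \<open>\<delta> |u| \<le> |S u| \<le> K |u|\<close>. The lower estimate makes the sequence
      Cauchy for \<open>ip\<close>, the upper one carries the limit back to
      \<open>a\<close>.\<close>
    have "\<exists>N. \<forall>m\<ge>N. \<forall>k\<ge>N. hnorm ip (\<lambda>p. X m p - X k p) < e" if e: "e > 0" for e
    proof -
      obtain N where N: "\<And>m k. m \<ge> N \<Longrightarrow> k \<ge> N \<Longrightarrow> hnorm a (\<lambda>p. X m p - X k p) < \<delta> * e"
        using C[of "\<delta> * e"] \<delta>(1) e by auto
      have "hnorm ip (\<lambda>p. X m p - X k p) < e" if "m \<ge> N" "k \<ge> N" for m k
        using N[OF that] \<delta>(2)[OF mem_diff[OF X X], of m k] \<delta>(1) unfolding norm_a
        by (meson le_less_trans mult_less_cancel_left_pos)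
      then show ?thesis by blast
    qed
    then have "\<exists>u\<in>W. (\<lambda>m. hnorm ip (\<lambda>p. X m p - u p)) \<longlonglongrightarrow> 0"
      by (rule complete[OF X])
    then obtain u where u: "u \<in> W" and lim: "(\<lambda>m. hnorm ip (\<lambda>p. X m p - u p)) \<longlonglongrightarrow> 0" ..
    have "(\<lambda>m. hnorm a (\<lambda>p. X m p - u p)) \<longlonglongrightarrow> 0"
    proof (rule tendsto_sandwich[of "\<lambda>_. 0"])
      show "(\<lambda>m. K * hnorm ip (\<lambda>p. X m p - u p)) \<longlonglongrightarrow> 0"
        using tendsto_mult_left[OF lim, of K] by simp
      show "\<forall>\<^sub>F m in sequentially. hnorm a (\<lambda>p. X m p - u p) \<le> K * hnorm ip (\<lambda>p. X m p - u p)"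
        using K(2)[OF mem_diff[OF X u]] by (simp add: norm_a)
      show "\<forall>\<^sub>F m in sequentially. 0 \<le> hnorm a (\<lambda>p. X m p - u p)"
        using hnorm_ge[OF SD(1)[OF mem_diff[OF X u]]] by (simp add: norm_a)
    qed auto
    then show "\<exists>u\<in>W. (\<lambda>m. hnorm a (\<lambda>p. X m p - u p)) \<longlonglongrightarrow> 0" using u by blast
  qed (simp_all add: a_def SD ip_lin ip_ge)
  have "\<exists>y\<in>W. \<forall>u\<in>W. ip u v = a u y"
  proof (rule a.Riesz)
    fix u assume u: "u \<in> W"
    have "cmod (ip u v) \<le> hnorm ip u * hnorm ip v" by (rule Cauchy_Schwarz[OF u v])
    also have "\<dots> \<le> (hnorm a u / \<delta>) * hnorm ip v"
      using \<delta>(2)[OF u] \<delta>(1) by (intro mult_right_mono hnorm_ge v) (simp add: norm_a pos_le_divide_eq mult.commute)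
    finally show "cmod (ip u v) \<le> (hnorm ip v / \<delta>) * hnorm a u" by (simp add: ac_simps)
  qed (simp_all add: ip_lin v)
  then obtain y where y: "y \<in> W" "\<And>u. u \<in> W \<Longrightarrow> ip u v = ip (S u) (S y)" by (auto simp: a_def)
  have "ip u (T (S y)) = ip u v" if u: "u \<in> W" for u
  proof -
    have "ip u (T (S y)) = cnj (ip (S y) (S u))"
      using ip_sym[OF TD(1)[OF SD(1)[OF y(1)]] u] adj[OF SD(1)[OF y(1)] u] by simp
    also have "\<dots> = ip (S u) (S y)" by (rule ip_sym[OF SD(1)[OF y(1)] SD(1)[OF u], symmetric])
    finally show ?thesis using y(2)[OF u] by simp
  qed
  then have "T (S y) = v" using TD(1) SD(1) y v by (intro ip_eqI) auto
  then show ?thesis using SD(1)[OF y(1)] by blast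
qed

text \<open>The lower bound gives injectivity and, read backwards, the bound
  \<open>1 / \<delta>\<close> for the inverse; linearity of the inverse follows from
  injectivity.\<close>

lemma bounded_inverse:
  assumes T: "bounded_operator ip W W T"
    and \<delta>: "\<delta> > 0" "\<And>u. u \<in> W \<Longrightarrow> \<delta> * hnorm ip u \<le> hnorm ip (T u)"
    and surj: "\<And>v. v \<in> W \<Longrightarrow> \<exists>u\<in>W. T u = v"
  shows "\<exists>S. bounded_operator ip W W S \<and> (\<forall>u\<in>W. S (T u) = u \<and> T (S u) = u)"
proof -
  note TD = bounded_operatorD[OF T]
  have inj: "u = v" if "u \<in> W" "v \<in> W" "T u = T v" for u v
  proof -
    have d: "(\<lambda>p. u p - v p) \<in> W" using that mem_diff by blast
    have "T (\<lambda>p. u p - v p) = (\<lambda>p. 0)" using bounded_operator_diff[OF T sub that(1,2)] that(3) by simp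
    then have "hnorm ip (\<lambda>p. u p - v p) = 0"
      using \<delta>(2)[OF d] hnorm_zero \<delta>(1) hnorm_ge[OF d] by (simp add: mult_le_0_iff)
    from hnorm_definite[OF d this] show ?thesis by (metis eq_iff_diff_eq_0 ext)
  qed
  define S where "S v = (SOME u. u \<in> W \<and> T u = v)" for v
  have S: "S v \<in> W \<and> T (S v) = v" if "v \<in> W" for v
    unfolding S_def by (rule someI_ex[of "\<lambda>u. u \<in> W \<and> T u = v"]) (use surj[OF that] in blast)
  have S_eq: "S v = u" if "u \<in> W" "T u = v" for u v
    by (rule inj) (use S[of v] TD(1)[OF that(1)] that in simp_all)
  have "hnorm ip (S v) \<le> (1 / \<delta>) * hnorm ip v" if "v \<in> W" for v
    using \<delta>(2)[of "S v"] S[OF that] \<delta>(1) by (simp add: pos_le_divide_eq mult.commute)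
  then have "bounded_operator ip W W S"
    unfolding bounded_operator_def using S
    by (intro conjI exI[of _ "1 / \<delta>"]) (auto intro!: S_eq simp: mem TD)
  then show ?thesis using S S_eq TD(1) by blast
qed

section \<open>Spectrum and quadratic form of a self-adjoint operator\<close>

lemma symmetric_Re:
  assumes T: "selfadjoint_on ip W T" and u: "u \<in> W"
  shows "ip (T u) u = complex_of_real (Re (ip (T u) u))"
proof -
  have b: "bounded_operator ip W W T" and "adjoint_on ip W T u = T u"
    using assms by (auto simp: selfadjoint_on_def)
  then have "ip (T u) u = cnj (ip (T u) u)"
    using ip_adjoint[OF b u u] ip_sym[OF bounded_operatorD(1)[OF b u] u] by simp
  then show ?thesis by (simp add: complex_eq_iff)
qed

lemma selfadjoint_ip:
  assumes T: "selfadjoint_on ip W T" and u: "u \<in> W" "v \<in> W"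
  shows "ip (T u) v = ip u (T v)"
  using assms ip_adjoint[of T v u] by (auto simp: selfadjoint_on_def)

text \<open>For nonzero \<open>u\<close> the Rayleigh quotient lies in \<open>[A, B]\<close>, at
  distance at least \<open>\<delta>\<close> from \<open>c\<close>, and Cauchy-Schwarz turns this
  into \<open>|(T - c) u| \<ge> \<delta> |u|\<close>. The same bound for \<open>cnj c\<close>, that
  is for the adjoint of \<open>T - c\<close>, gives surjectivity.\<close>

lemma selfadjoint_resolvent:
  assumes T: "selfadjoint_on ip W T"
    and form: "\<And>u. u \<in> W \<Longrightarrow> A * (hnorm ip u)\<^sup>2 \<le> Re (ip (T u) u)"
      "\<And>u. u \<in> W \<Longrightarrow> Re (ip (T u) u) \<le> B * (hnorm ip u)\<^sup>2"
    and c: "c \<notin> complex_of_real ` {A..B}"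
  shows "c \<notin> spectrum_on ip W T"
proof -
  have b: "bounded_operator ip W W T" using T by (simp add: selfadjoint_on_def)
  have "closed (complex_of_real ` {A..B})"
    by (intro compact_imp_closed compact_continuous_image continuous_intros) auto
  then obtain \<delta> where \<delta>: "\<delta> > 0" "\<And>x. x \<in> {A..B} \<Longrightarrow> \<delta> \<le> dist c (complex_of_real x)"
    using separate_point_closed[OF _ c] by blast
  have below: "\<delta> * hnorm ip u \<le> hnorm ip (\<lambda>p. T u p - c' * u p)"
    if u: "u \<in> W" and c': "c' = c \<or> c' = cnj c" for u c'
  proof (cases "hnorm ip u = 0")
    case True
    then have "u = (\<lambda>p. 0)" by (rule hnorm_definite[OF u])
    then show ?thesis using True hnorm_ge[OF bounded_operatorD(1)[OF bounded_operator_shift[OF b] u]] by simp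
  next
    case False
    then have pos: "hnorm ip u > 0" using hnorm_ge[OF u] by simp
    define x where "x = Re (ip (T u) u) / (hnorm ip u)\<^sup>2"
    have "x \<in> {A..B}" using form[OF u] pos by (simp add: x_def field_simps)
    then have "\<delta> \<le> dist c' (complex_of_real x)"
      using \<delta>(2) c' by (metis complex_cnj_complex_of_real complex_cnj_diff complex_mod_cnj dist_complex_def)
    then have "\<delta> * (hnorm ip u)\<^sup>2 \<le> cmod (x - c') * (hnorm ip u)\<^sup>2"
      by (intro mult_right_mono) (simp_all add: dist_norm norm_minus_commute)
    also have "\<dots> = cmod ((x - c') * (hnorm ip u)\<^sup>2)" by (simp add: norm_mult norm_power)
    also have "(x - c') * (hnorm ip u)\<^sup>2 = ip (\<lambda>p. T u p - c' * u p) u"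
      using pos symmetric_Re[OF T u]
      by (subst ip_diff) (simp_all add: mem u bounded_operatorD(1)[OF b u] ip_scale ip_self x_def algebra_simps)
    also have "cmod \<dots> \<le> hnorm ip (\<lambda>p. T u p - c' * u p) * hnorm ip u"
      by (intro Cauchy_Schwarz u mem_diff_scale bounded_operatorD(1)[OF b u])
    finally show ?thesis using pos by (simp add: power2_eq_square)
  qed
  let ?T = "\<lambda>c u p. T u p - c * u p"
  have surj: "\<exists>u\<in>W. ?T c u = v" if v: "v \<in> W" for v
  proof (rule bounded_below_surj[OF bounded_operator_shift[OF b] bounded_operator_shift[OF b, of "cnj c"]])
    show "ip (?T c u) v = ip u (?T (cnj c) v)" if "u \<in> W" "v \<in> W" for u v
      using that selfadjoint_ip[OF T that] bounded_operatorD(1)[OF b] by (simp add: ip_lin mem)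
  qed (use \<delta>(1) below v in auto)
  have "\<exists>S. bounded_operator ip W W S \<and> (\<forall>u\<in>W. S (?T c u) = u \<and> ?T c (S u) = u)"
    by (rule bounded_inverse[OF bounded_operator_shift[OF b] \<delta>(1) _ surj]) (use below in auto)
  then show ?thesis by (simp add: spectrum_on_def)
qed

text \<open>Here \<open>P = T - m\<close> has an inverse of bound \<open>M\<close>, and
  \<open>\<sigma> P\<close> is positive. For a positive operator of bound \<open>K\<close>,
  \<open>|P u|^2\<close> is at most \<open>K\<close> times the form at \<open>u\<close>; with
  \<open>|u| \<le> M |P u|\<close> the form is at least \<open>|u|^2 / (M^2 K)\<close>.\<close>

lemma selfadjoint_form_gap:
  assumes T: "selfadjoint_on ip W T" and \<sigma>: "\<sigma> = 1 \<or> \<sigma> = (-1::real)"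
    and form: "\<And>u. u \<in> W \<Longrightarrow> 0 \<le> \<sigma> * (Re (ip (T u) u) - m * (hnorm ip u)\<^sup>2)"
    and m: "complex_of_real m \<notin> spectrum_on ip W T"
  shows "\<exists>\<epsilon>>0. \<forall>u\<in>W. \<epsilon> * (hnorm ip u)\<^sup>2 \<le> \<sigma> * (Re (ip (T u) u) - m * (hnorm ip u)\<^sup>2)"
proof -
  have b: "bounded_operator ip W W T" using T by (simp add: selfadjoint_on_def)
  define P where "P u = (\<lambda>p. T u p - complex_of_real m * u p)" for u
  have P: "bounded_operator ip W W P" unfolding P_def by (rule bounded_operator_shift[OF b])
  note PD = bounded_operatorD[OF P]
  have Psym: "ip (P u) v = ip u (P v)" if "u \<in> W" "v \<in> W" for u v
    unfolding P_def using that selfadjoint_ip[OF T that] bounded_operatorD(1)[OF b] by (simp add: ip_lin mem)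
  have Pform: "Re (ip (P u) u) = Re (ip (T u) u) - m * (hnorm ip u)\<^sup>2" if "u \<in> W" for u
    unfolding P_def using that bounded_operatorD(1)[OF b that] by (simp add: ip_lin mem ip_self del: of_real_power)
  obtain S where S: "bounded_operator ip W W S" "\<And>u. u \<in> W \<Longrightarrow> S (P u) = u"
    using m by (auto simp: spectrum_on_def P_def)
  obtain K where K: "K > 0" "\<And>u. u \<in> W \<Longrightarrow> hnorm ip (P u) \<le> K * hnorm ip u"
    using bounded_operator_bound[OF P] by blast
  obtain M where M: "M > 0" "\<And>u. u \<in> W \<Longrightarrow> hnorm ip (S u) \<le> M * hnorm ip u"
    using bounded_operator_bound[OF S(1)] by blast
  have "1 / (M\<^sup>2 * K) * (hnorm ip u)\<^sup>2 \<le> \<sigma> * Re (ip (P u) u)" if u: "u \<in> W" for u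
  proof -
    \<comment> \<open>Positivity is applied to \<open>u - \<sigma> P u / K\<close>: the mixed terms
      contribute \<open>- 2 |P u|^2 / K\<close>, the quadratic one at most
      \<open>|P u|^2 / K\<close>.\<close>
    define r where "r = - \<sigma> / K"
    let ?w = "\<lambda>p. u p + complex_of_real r * P u p"
    have w: "?w \<in> W" using u PD(1)[OF u] by (intro mem)
    have PPu: "Re (\<sigma> * ip (P (P u)) (P u)) \<le> K * (hnorm ip (P u))\<^sup>2"
    proof -
      have "Re (\<sigma> * ip (P (P u)) (P u)) \<le> cmod (\<sigma> * ip (P (P u)) (P u))" by (rule complex_Re_le_cmod)
      also have "\<dots> = cmod (ip (P (P u)) (P u))" using \<sigma> by (auto simp: norm_mult)
      also have "\<dots> \<le> hnorm ip (P (P u)) * hnorm ip (P u)" by (intro Cauchy_Schwarz PD u)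
      also have "\<dots> \<le> (K * hnorm ip (P u)) * hnorm ip (P u)" by (intro mult_right_mono K hnorm_ge PD u)
      finally show ?thesis by (simp add: power2_eq_square)
    qed
    have "ip (P ?w) ?w = ip (P u) u + 2 * r * (hnorm ip (P u))\<^sup>2 + r\<^sup>2 * ip (P (P u)) (P u)"
    proof -
      have "P ?w = (\<lambda>p. P u p + complex_of_real r * P (P u) p)"
        using PD(2)[OF u mem_scale[OF PD(1)[OF u]]] PD(3)[OF PD(1)[OF u]] by simp
      then show ?thesis
        using u PD(1) Psym[OF PD(1)[OF u] u] ip_self[OF PD(1)[OF u]]
        by (simp add: ip_lin mem power2_eq_square algebra_simps del: of_real_power)
    qed
    then have "0 \<le> \<sigma> * Re (ip (P u) u + 2 * r * (hnorm ip (P u))\<^sup>2 + r\<^sup>2 * ip (P (P u)) (P u))"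
      using form[OF w] Pform[OF w] by (simp del: of_real_power)
    also have "\<dots> = \<sigma> * Re (ip (P u) u) + 2 * \<sigma> * r * (hnorm ip (P u))\<^sup>2 + r\<^sup>2 * Re (\<sigma> * ip (P (P u)) (P u))"
      by (simp add: algebra_simps flip: of_real_power)
    also have "\<dots> \<le> \<sigma> * Re (ip (P u) u) + 2 * \<sigma> * r * (hnorm ip (P u))\<^sup>2 + r\<^sup>2 * (K * (hnorm ip (P u))\<^sup>2)"
      using PPu by (intro add_left_mono mult_left_mono) auto
    also have "\<dots> = \<sigma> * Re (ip (P u) u) - (hnorm ip (P u))\<^sup>2 / K"
      using \<sigma> K(1) by (auto simp: r_def power2_eq_square field_simps)
    finally have 1: "(hnorm ip (P u))\<^sup>2 / K \<le> \<sigma> * Re (ip (P u) u)" by simp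
    have "hnorm ip u \<le> M * hnorm ip (P u)" using M(2)[OF PD(1)[OF u]] S(2)[OF u] by simp
    then have "(hnorm ip u)\<^sup>2 \<le> M\<^sup>2 * (hnorm ip (P u))\<^sup>2"
      using hnorm_ge[OF u] by (metis power_mono power_mult_distrib)
    then have "1 / (M\<^sup>2 * K) * (hnorm ip u)\<^sup>2 \<le> (hnorm ip (P u))\<^sup>2 / K"
      using M(1) K(1) by (simp add: field_simps)
    then show ?thesis using 1 by simp
  qed
  then show ?thesis using M(1) K(1) Pform by (intro exI[of _ "1 / (M\<^sup>2 * K)"]) auto
qed

text \<open>In one direction the resolvent estimate excludes points off the interval. In the other,
  the optimal bound of the form must be a point of the spectrum: otherwise the form keeps a positive
  gap from it and the bound could be improved.\<close>

theorem selfadjoint_spectrum_iff: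
  assumes T: "selfadjoint_on ip W T"
  shows "spectrum_on ip W T \<subseteq> complex_of_real ` {A..B} \<longleftrightarrow>
    (\<forall>u\<in>W. A * (hnorm ip u)\<^sup>2 \<le> Re (ip (T u) u) \<and> Re (ip (T u) u) \<le> B * (hnorm ip u)\<^sup>2)"
proof
  assume "\<forall>u\<in>W. A * (hnorm ip u)\<^sup>2 \<le> Re (ip (T u) u) \<and> Re (ip (T u) u) \<le> B * (hnorm ip u)\<^sup>2"
  then show "spectrum_on ip W T \<subseteq> complex_of_real ` {A..B}"
    using selfadjoint_resolvent[OF T] by blast
next
  assume spec: "spectrum_on ip W T \<subseteq> complex_of_real ` {A..B}"
  have b: "bounded_operator ip W W T" using T by (simp add: selfadjoint_on_def)
  obtain K where K: "K > 0" "\<And>u. u \<in> W \<Longrightarrow> hnorm ip (T u) \<le> K * hnorm ip u"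
    using bounded_operator_bound[OF b] by blast
  have bound: "\<bar>Re (ip (T u) u)\<bar> \<le> K * (hnorm ip u)\<^sup>2" if u: "u \<in> W" for u
  proof -
    have "\<bar>Re (ip (T u) u)\<bar> \<le> cmod (ip (T u) u)" by (rule abs_Re_le_cmod)
    also have "\<dots> \<le> hnorm ip (T u) * hnorm ip u" by (intro Cauchy_Schwarz bounded_operatorD(1)[OF b] u)
    also have "\<dots> \<le> (K * hnorm ip u) * hnorm ip u" by (intro mult_right_mono K hnorm_ge u)
    finally show ?thesis by (simp add: power2_eq_square)
  qed
  \<comment> \<open>\<open>\<sigma> = 1\<close> with \<open>C = A\<close> gives the lower bound,
    \<open>\<sigma> = -1\<close> with \<open>C = B\<close> the upper one.\<close>
  have key: "\<sigma> * (C * (hnorm ip u)\<^sup>2) \<le> \<sigma> * Re (ip (T u) u)"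
    if \<sigma>: "\<sigma> = 1 \<or> \<sigma> = (-1::real)" and C: "\<And>x. \<sigma> * x < \<sigma> * C \<Longrightarrow> complex_of_real x \<notin> spectrum_on ip W T"
      and u: "u \<in> W" for \<sigma> C u
  proof (rule ccontr)
    assume neg: "\<not> ?thesis"
    \<comment> \<open>All lower bounds of the form of \<open>\<sigma> T\<close>. The violating
      vector \<open>u\<close> bounds \<open>F\<close> from above by \<open>\<sigma> * C\<close>, and
      the supremum belongs to \<open>F\<close> because the defining inequalities are closed.\<close>
    define F where "F = {x. \<forall>u\<in>W. x * (hnorm ip u)\<^sup>2 \<le> \<sigma> * Re (ip (T u) u)}"
    have nz: "hnorm ip u > 0"
    proof (rule ccontr)
      assume "\<not> hnorm ip u > 0"
      then have "hnorm ip u = 0" using hnorm_ge[OF u] by simp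
      then show False using neg bound[OF u] by simp
    qed
    have F_less: "x < \<sigma> * C" if "x \<in> F" for x
    proof -
      have "x * (hnorm ip u)\<^sup>2 \<le> \<sigma> * Re (ip (T u) u)" using that u by (simp add: F_def)
      also have "\<dots> < \<sigma> * C * (hnorm ip u)\<^sup>2" using neg by (simp add: mult.assoc)
      finally show ?thesis using nz by simp
    qed
    have "- K \<in> F"
    proof -
      have "- K * (hnorm ip u)\<^sup>2 \<le> \<sigma> * Re (ip (T u) u)" if "u \<in> W" for u
        using bound[OF that] \<sigma> by auto
      then show ?thesis by (simp add: F_def)
    qed
    then have ne: "F \<noteq> {}" by blast
    have bdd: "bdd_above F" using F_less by (meson bdd_above.I less_imp_le)
    define m where "m = Sup F"
    have "m \<in> F"
      unfolding F_def
    proof (intro CollectI ballI)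
      fix w assume w: "w \<in> W"
      show "m * (hnorm ip w)\<^sup>2 \<le> \<sigma> * Re (ip (T w) w)"
      proof (cases "hnorm ip w = 0")
        case True then show ?thesis using bound[OF w] by simp
      next
        case False
        then have pos: "(hnorm ip w)\<^sup>2 > 0" by simp
        have "m \<le> \<sigma> * Re (ip (T w) w) / (hnorm ip w)\<^sup>2"
          unfolding m_def by (rule cSup_least[OF ne]) (use w pos in \<open>simp add: F_def pos_le_divide_eq\<close>)
        then show ?thesis using pos by (simp add: pos_le_divide_eq)
      qed
    qed
    then have m: "complex_of_real (\<sigma> * m) \<notin> spectrum_on ip W T"
      using F_less \<sigma> by (intro C) auto
    have "0 \<le> \<sigma> * (Re (ip (T w) w) - (\<sigma> * m) * (hnorm ip w)\<^sup>2)" if "w \<in> W" for w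
      using \<open>m \<in> F\<close> that \<sigma> by (auto simp: F_def)
    then obtain \<epsilon> where \<epsilon>: "\<epsilon> > 0"
      "\<And>w. w \<in> W \<Longrightarrow> \<epsilon> * (hnorm ip w)\<^sup>2 \<le> \<sigma> * (Re (ip (T w) w) - (\<sigma> * m) * (hnorm ip w)\<^sup>2)"
      using selfadjoint_form_gap[OF T \<sigma> _ m] by blast
    have "m + \<epsilon> \<in> F" using \<epsilon>(2) \<sigma> by (auto simp: F_def algebra_simps)
    then have "m + \<epsilon> \<le> m" unfolding m_def by (rule cSup_upper[OF _ bdd])
    then show False using \<epsilon>(1) by simp
  qed
  have "complex_of_real x \<notin> spectrum_on ip W T" if "x < A \<or> x > B" for x
    using spec that by auto
  then show "\<forall>u\<in>W. A * (hnorm ip u)\<^sup>2 \<le> Re (ip (T u) u) \<and> Re (ip (T u) u) \<le> B * (hnorm ip u)\<^sup>2"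
    using key[of 1 A] key[of "-1" B] by auto
qed

end

section \<open>Schwartz functions and the Fourier transform\<close>

definition partial :: "'n \<Rightarrow> (real^'n::finite \<Rightarrow> complex) \<Rightarrow> real^'n \<Rightarrow> complex" where
  "partial j f = (\<lambda>x. frechet_derivative f (at x) (axis j 1))"

lemma partial_eqI: "(f has_derivative f') (at x) \<Longrightarrow> partial j f x = f' (axis j 1)"
  by (simp add: partial_def frechet_derivative_at[symmetric])

lemma iter_partial_Cons: "iter_partial (j # js) f = partial j (iter_partial js f)"
  by (simp add: partial_def)

text \<open>Induction over the list of coordinates keeps all iterated derivatives in
  \<open>S\<close>. Each use only has to find a family closed under a single partial derivative, so
  no Leibniz formula for higher derivatives appears.\<close>

lemma schwartz_coinduct:
  assumes "f \<in> S"
    and diff: "\<And>g x. g \<in> S \<Longrightarrow> g differentiable (at x)"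
    and bound: "\<And>g m. g \<in> S \<Longrightarrow> \<exists>C. \<forall>x. (1 + norm x) ^ m * norm (g x) \<le> C"
    and closed: "\<And>g j. g \<in> S \<Longrightarrow> partial j g \<in> S"
  shows "f \<in> schwartz"
proof -
  have "iter_partial js f \<in> S" for js
    by (induction js) (simp_all add: assms iter_partial_Cons del: iter_partial.simps(2))
  then show ?thesis unfolding schwartz_def using diff bound by blast
qed

lemma schwartz_differentiable: "f \<in> schwartz \<Longrightarrow> f differentiable (at x)"
  unfolding schwartz_def using iter_partial.simps(1) by (metis (mono_tags, lifting) mem_Collect_eq)

lemma schwartz_iter_partial:
  assumes "f \<in> schwartz" shows "iter_partial js f \<in> schwartz"
proof -
  have "iter_partial ks (iter_partial js f) = iter_partial (ks @ js) f" for ks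
    by (induction ks) auto
  then show ?thesis using assms by (auto simp: schwartz_def)
qed

lemma schwartz_partial: "f \<in> schwartz \<Longrightarrow> partial j f \<in> schwartz"
  using schwartz_iter_partial[of f "[j]"] by (simp add: partial_def)

lemma schwartz_bound:
  assumes "f \<in> schwartz" obtains C where "C > 0" "\<And>x. (1 + norm x) ^ m * norm (f x) \<le> C"
proof -
  obtain C where "\<And>x. (1 + norm x) ^ m * norm (iter_partial [] f x) \<le> C"
    using assms unfolding schwartz_def by blast
  then have "(1 + norm x) ^ m * norm (f x) \<le> max C 1" for x by (simp add: le_max_iff_disj)
  then show ?thesis using that[of "max C 1"] by simp
qed

lemma schwartz_seminorm_ge:
  assumes "f \<in> schwartz" shows "(1 + norm x) ^ m * norm (iter_partial js f x) \<le> schwartz_seminorm m js f"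
proof -
  obtain C where "\<And>x. (1 + norm x) ^ m * norm (iter_partial js f x) \<le> C"
    using schwartz_bound[OF schwartz_iter_partial[OF assms]] by blast
  then show ?thesis unfolding schwartz_seminorm_def
    by (intro cSUP_upper bdd_aboveI[of _ C]) auto
qed

lemma schwartz_seminorm_nonneg: "f \<in> schwartz \<Longrightarrow> 0 \<le> schwartz_seminorm m js f"
  by (rule order_trans[OF _ schwartz_seminorm_ge[of f 0]]) auto

lemma schwartz_seminorm_mono:
  assumes "f \<in> schwartz" "m \<le> m'" shows "schwartz_seminorm m js f \<le> schwartz_seminorm m' js f"
  unfolding schwartz_seminorm_def[of m]
proof (rule cSUP_least)
  fix x
  have "(1 + norm x) ^ m * norm (iter_partial js f x) \<le> (1 + norm x) ^ m' * norm (iter_partial js f x)"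
    by (intro mult_right_mono power_increasing assms) auto
  also have "\<dots> \<le> schwartz_seminorm m' js f" by (rule schwartz_seminorm_ge[OF assms(1)])
  finally show "(1 + norm x) ^ m * norm (iter_partial js f x) \<le> schwartz_seminorm m' js f" .
qed simp

lemma schwartz_continuous: "f \<in> schwartz \<Longrightarrow> continuous_on S f"
  by (meson schwartz_differentiable continuous_at_imp_continuous_on differentiable_imp_continuous_within)

lemma schwartz_measurable: "f \<in> schwartz \<Longrightarrow> f \<in> borel_measurable borel"
  by (intro borel_measurable_continuous_onI schwartz_continuous)

lemma schwartz_frechet: "f \<in> schwartz \<Longrightarrow> (f has_derivative frechet_derivative f (at x)) (at x)"
  using schwartz_differentiable frechet_derivative_works by blast

lemma schwartz_has_derivative:
  assumes "f \<in> schwartz" shows "(f has_derivative (\<lambda>h. \<Sum>j\<in>UNIV. of_real (h $ j) * partial j f x)) (at x)"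
proof -
  let ?D = "frechet_derivative f (at x)"
  have D: "(f has_derivative ?D) (at x)"
    by (rule schwartz_frechet[OF assms])
  interpret bounded_linear ?D by (rule has_derivative_bounded_linear[OF D])
  have "?D h = (\<Sum>j\<in>UNIV. of_real (h $ j) * partial j f x)" for h
  proof -
    have "?D h = ?D (\<Sum>j\<in>UNIV. (h $ j) *\<^sub>R axis j 1)"
      using basis_expansion[of h] by (simp only: scalar_mult_eq_scaleR)
    also have "\<dots> = (\<Sum>j\<in>UNIV. of_real (h $ j) * partial j f x)"
      unfolding sum scaleR partial_def by (simp add: scaleR_conv_of_real)
    finally show ?thesis .
  qed
  then have "?D = (\<lambda>h. \<Sum>j\<in>UNIV. of_real (h $ j) * partial j f x)" by (rule ext)
  then show ?thesis using D by simp
qed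

lemma partial_add:
  assumes "f \<in> schwartz" "g \<in> schwartz"
  shows "partial j (\<lambda>x. f x + g x) = (\<lambda>x. partial j f x + partial j g x)"
proof
  fix x
  have "partial j (\<lambda>x. f x + g x) x = frechet_derivative f (at x) (axis j 1) + frechet_derivative g (at x) (axis j 1)"
    by (rule partial_eqI[where f'="\<lambda>h. frechet_derivative f (at x) h + frechet_derivative g (at x) h"])
       (intro has_derivative_add schwartz_frechet assms)
  then show "partial j (\<lambda>x. f x + g x) x = partial j f x + partial j g x" by (simp add: partial_def)
qed

lemma schwartz_add:
  fixes f g :: "real^'n::finite \<Rightarrow> complex"
  assumes "f \<in> schwartz" "g \<in> schwartz" shows "(\<lambda>x. f x + g x) \<in> schwartz"
proof (rule schwartz_coinduct[where S="{\<lambda>x. f x + g x | f g. f \<in> schwartz \<and> g \<in> schwartz}"])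
  fix h :: "real^'n \<Rightarrow> complex" and m assume "h \<in> {\<lambda>x. f x + g x | f g. f \<in> schwartz \<and> g \<in> schwartz}"
  then obtain f g where h: "h = (\<lambda>x. f x + g x)" "f \<in> schwartz" "g \<in> schwartz" by blast
  show "h differentiable (at x)" for x
    unfolding h(1) by (intro differentiable_add schwartz_differentiable h)
  show "partial j h \<in> {\<lambda>x. f x + g x | f g. f \<in> schwartz \<and> g \<in> schwartz}" for j
    unfolding h(1) partial_add[OF h(2,3)] using schwartz_partial[OF h(2)] schwartz_partial[OF h(3)] by blast
  obtain C where C: "\<And>x. (1 + norm x) ^ m * norm (f x) \<le> C" using schwartz_bound[OF h(2), of m] by blast
  obtain D where D: "\<And>x. (1 + norm x) ^ m * norm (g x) \<le> D" using schwartz_bound[OF h(3), of m] by blast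
  have "(1 + norm x) ^ m * norm (h x) \<le> C + D" for x
  proof -
    have "(1 + norm x) ^ m * norm (h x) \<le> (1 + norm x) ^ m * (norm (f x) + norm (g x))"
      unfolding h(1) by (intro mult_left_mono norm_triangle_ineq) simp
    also have "\<dots> \<le> C + D" using C[of x] D[of x] by (simp add: distrib_left)
    finally show ?thesis .
  qed
  then show "\<exists>C. \<forall>x. (1 + norm x) ^ m * norm (h x) \<le> C" by blast
qed (use assms in blast)

text \<open>One statement for three multipliers whose partial derivatives are affine in the
  multiplier itself: constants (\<open>a\<close> and \<open>b\<close> zero), coordinates
  (\<open>a\<close> zero) and characters (\<open>b\<close> zero). Linear growth is allowed for the
  sake of coordinates. The family of all \<open>e f + g\<close> is closed under derivatives, since
  \<open>g\<close> absorbs the terms without \<open>e\<close>.\<close>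

lemma schwartz_mult_smooth:
  fixes e :: "real^'n::finite \<Rightarrow> complex"
  assumes f: "f \<in> schwartz"
    and e: "\<And>x. (e has_derivative D x) (at x)" "\<And>x j. D x (axis j 1) = a j * e x + b j"
    and bound: "\<And>x. norm (e x) \<le> K * (1 + norm x)"
  shows "(\<lambda>x. e x * f x) \<in> schwartz"
    and "partial j (\<lambda>x. e x * f x) = (\<lambda>x. e x * partial j f x + a j * (e x * f x) + b j * f x)"
proof -
  let ?S = "{\<lambda>x. e x * f x + g x | f g. f \<in> schwartz \<and> g \<in> schwartz}"
  \<comment> \<open>Proved locally because \<open>schwartz_scale\<close> is itself an instance of
    this lemma.\<close>
  have scale: "(\<lambda>x. c * f x) \<in> schwartz" if "f \<in> schwartz" for c :: complex and f :: "real^'n \<Rightarrow> complex"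
  proof (rule schwartz_coinduct[where S="{\<lambda>x. c * f x | f. f \<in> schwartz}"])
    fix h :: "real^'n \<Rightarrow> complex" and m assume "h \<in> {\<lambda>x. c * f x | f. f \<in> schwartz}"
    then obtain f where h: "h = (\<lambda>x. c * f x)" "f \<in> schwartz" by blast
    show "h differentiable (at x)" for x
      unfolding h(1) by (intro differentiable_mult differentiable_const schwartz_differentiable h)
    have "partial j h = (\<lambda>x. c * partial j f x)" for j
    proof
      fix x show "partial j h x = c * partial j f x"
        unfolding h(1) partial_def[of j f]
        by (rule partial_eqI[where f'="\<lambda>h. c * frechet_derivative f (at x) h"])
          (intro has_derivative_mult_right schwartz_frechet h)
    qed
    then show "partial j h \<in> {\<lambda>x. c * f x | f. f \<in> schwartz}" for j
      using schwartz_partial[OF h(2)] by blast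
    obtain C where C: "\<And>x. (1 + norm x) ^ m * norm (f x) \<le> C" using schwartz_bound[OF h(2), of m] by blast
    have "(1 + norm x) ^ m * norm (h x) \<le> norm c * C" for x
      using mult_left_mono[OF C[of x], of "norm c"] by (simp add: h(1) norm_mult ac_simps)
    then show "\<exists>C. \<forall>x. (1 + norm x) ^ m * norm (h x) \<le> C" by blast
  qed (use that in blast)
  have dmul: "((\<lambda>x. e x * f x) has_derivative (\<lambda>h. e x * frechet_derivative f (at x) h + D x h * f x)) (at x)"
    if "f \<in> schwartz" for f x
    by (intro has_derivative_mult schwartz_frechet that e)
  have pmul: "partial j (\<lambda>x. e x * f x) = (\<lambda>x. e x * partial j f x + a j * (e x * f x) + b j * f x)"
    if "f \<in> schwartz" for f j
    using partial_eqI[OF dmul[OF that]] by (auto simp: e(2) partial_def algebra_simps)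
  have "(\<lambda>x. e x * f x + 0 * f x) \<in> schwartz"
  proof (rule schwartz_coinduct[where S="?S"])
    show "(\<lambda>x. e x * f x + 0 * f x) \<in> ?S"
      using f scale[OF f, of 0] by (intro CollectI exI[of _ f] exI[of _ "\<lambda>x. 0 * f x"]) simp
    fix h :: "real^'n \<Rightarrow> complex" and m assume "h \<in> ?S"
    then obtain f g where h: "h = (\<lambda>x. e x * f x + g x)" "f \<in> schwartz" "g \<in> schwartz" by blast
    have dh: "(h has_derivative (\<lambda>h. (e x * frechet_derivative f (at x) h + D x h * f x) + frechet_derivative g (at x) h)) (at x)" for x
      unfolding h(1) by (intro has_derivative_add dmul schwartz_frechet h)
    show "h differentiable (at x)" for x
      using dh differentiableI by blast
    show "partial j h \<in> ?S" for j
    proof -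
      have "partial j h = (\<lambda>x. e x * (partial j f x + a j * f x) + (b j * f x + partial j g x))"
        using partial_eqI[OF dh] by (auto simp: e(2) partial_def algebra_simps)
      moreover have "(\<lambda>x. partial j f x + a j * f x) \<in> schwartz" "(\<lambda>x. b j * f x + partial j g x) \<in> schwartz"
        by (intro schwartz_add scale schwartz_partial h)+
      ultimately show ?thesis
        by (intro CollectI exI[of _ "\<lambda>x. partial j f x + a j * f x"] exI[of _ "\<lambda>x. b j * f x + partial j g x"]) simp
    qed
    \<comment> \<open>One more power for \<open>f\<close> pays for the linear growth of
      \<open>e\<close>.\<close>
    obtain C where C: "\<And>x. (1 + norm x) ^ Suc m * norm (f x) \<le> C" using schwartz_bound[OF h(2), of "Suc m"] by blast
    obtain E where E: "\<And>x. (1 + norm x) ^ m * norm (g x) \<le> E" using schwartz_bound[OF h(3), of m] by blast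
    have K: "K \<ge> 0" using order_trans[OF norm_ge_zero bound[of 0]] by simp
    have "(1 + norm x) ^ m * norm (h x) \<le> K * C + E" for x
    proof -
      have "(1 + norm x) ^ m * norm (h x) \<le> (1 + norm x) ^ m * (norm (e x) * norm (f x) + norm (g x))"
        unfolding h(1) using norm_triangle_ineq[of "e x * f x" "g x"] by (intro mult_left_mono) (auto simp: norm_mult)
      also have "\<dots> \<le> (1 + norm x) ^ m * ((K * (1 + norm x)) * norm (f x) + norm (g x))"
        by (intro mult_left_mono add_right_mono mult_right_mono bound) auto
      also have "\<dots> = K * ((1 + norm x) ^ Suc m * norm (f x)) + (1 + norm x) ^ m * norm (g x)"
        by (simp add: algebra_simps)
      also have "\<dots> \<le> K * C + E" by (intro add_mono mult_left_mono C E K)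
      finally show ?thesis .
    qed
    then show "\<exists>C. \<forall>x. (1 + norm x) ^ m * norm (h x) \<le> C" by blast
  qed
  then show "(\<lambda>x. e x * f x) \<in> schwartz" by simp
  show "partial j (\<lambda>x. e x * f x) = (\<lambda>x. e x * partial j f x + a j * (e x * f x) + b j * f x)"
    by (rule pmul[OF f])
qed

lemma schwartz_scale: "f \<in> schwartz \<Longrightarrow> (\<lambda>x. c * f x) \<in> schwartz"
  by (rule schwartz_mult_smooth(1)[where D="\<lambda>_ _. 0" and a="\<lambda>_. 0" and b="\<lambda>_. 0" and K="norm c"])
     (auto simp: algebra_simps)

lemma schwartz_mult_coord:
  assumes "f \<in> schwartz" shows "(\<lambda>x. of_real (x $ i) * f x) \<in> schwartz"
proof (rule schwartz_mult_smooth(1)[OF assms, where D="\<lambda>_ h. of_real (h $ i)" and a="\<lambda>_. 0"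
      and b="\<lambda>j. if i = j then 1 else 0" and K=1])
  show "((\<lambda>x. complex_of_real (x $ i)) has_derivative (\<lambda>h. of_real (h $ i))) (at x)" for x :: "real^'a"
    by (intro has_derivative_of_real bounded_linear_imp_has_derivative bounded_linear_vec_nth)
  show "cmod (complex_of_real (x $ i)) \<le> 1 * (1 + norm x)" for x :: "real^'a"
    using component_le_norm_cart[of x i] by simp
qed (auto simp: axis_def)

section \<open>Characters and integrability of rapidly decreasing functions\<close>

definition fchar :: "real^'n::finite \<Rightarrow> real^'n \<Rightarrow> complex" where
  "fchar x t = exp (- 2 * complex_of_real pi * \<i> * complex_of_real (x \<bullet> t))"

lemma norm_fchar [simp]: "norm (fchar x t) = 1"
  by (simp add: fchar_def norm_exp_eq_Re)

lemma fchar_commute: "fchar x t = fchar t x"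
  by (simp add: fchar_def inner_commute)

lemma fchar_add: "fchar (x + y) t = fchar x t * fchar y t" "fchar t (x + y) = fchar t x * fchar t y"
  by (simp_all add: fchar_def inner_add algebra_simps flip: exp_add)

lemma fchar_minus: "fchar (- x) t = cnj (fchar x t)" "fchar x (- t) = cnj (fchar x t)"
  by (simp_all add: fchar_def exp_cnj)

lemma continuous_on_fchar [continuous_intros]:
  "continuous_on S f \<Longrightarrow> continuous_on S g \<Longrightarrow> continuous_on S (\<lambda>z. fchar (f z) (g z))"
  unfolding fchar_def by (intro continuous_intros)

lemma fourier_fchar: "fourier f t = (LINT x|lebesgue. f x * fchar x t)"
  by (simp add: fourier_def fchar_def)

lemma fchar_has_derivative:
  "((\<lambda>x. fchar x t) has_derivative (\<lambda>h. - 2 * complex_of_real pi * \<i> * complex_of_real (h \<bullet> t) * fchar x t)) (at x)"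
proof -
  have "((\<lambda>x. x \<bullet> t) has_derivative (\<lambda>h. h \<bullet> t)) (at x)"
    by (intro bounded_linear_imp_has_derivative bounded_linear_inner_left)
  then have "((\<lambda>x. complex_of_real (x \<bullet> t)) has_derivative (\<lambda>h. complex_of_real (h \<bullet> t))) (at x)"
    by (rule has_derivative_of_real)
  then have "((\<lambda>x. - 2 * complex_of_real pi * \<i> * complex_of_real (x \<bullet> t)) has_derivative
     (\<lambda>h. - 2 * complex_of_real pi * \<i> * complex_of_real (h \<bullet> t))) (at x)"
    by (rule has_derivative_mult_right)
  then show ?thesis unfolding fchar_def
    by (rule has_derivative_compose[OF _ DERIV_exp[unfolded has_field_derivative_def], THEN has_derivative_eq_rhs])
      (simp add: fun_eq_iff)
qed

lemma schwartz_mult_fchar: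
  assumes f: "f \<in> schwartz"
  shows "(\<lambda>x. fchar x t * f x) \<in> schwartz"
    and "partial j (\<lambda>x. fchar x t * f x)
       = (\<lambda>x. fchar x t * partial j f x - 2 * complex_of_real pi * \<i> * complex_of_real (t $ j) * (fchar x t * f x))"
proof -
  note * = schwartz_mult_smooth[OF f fchar_has_derivative[of t],
      where a="\<lambda>j. - 2 * complex_of_real pi * \<i> * complex_of_real (t $ j)" and b="\<lambda>_. 0" and K=1]
  show "(\<lambda>x. fchar x t * f x) \<in> schwartz"
    by (rule *) (auto simp: inner_axis')
  show "partial j (\<lambda>x. fchar x t * f x)
       = (\<lambda>x. fchar x t * partial j f x - 2 * complex_of_real pi * \<i> * complex_of_real (t $ j) * (fchar x t * f x))"
    by (subst *) (auto simp: inner_axis')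
qed

lemma integrable_lborel_inverse_1_plus_square: "integrable lborel (\<lambda>x::real. 1 / (1 + x\<^sup>2))"
proof (rule integrableI_bounded)
  let ?f = "\<lambda>x::real. 1 / (1 + x\<^sup>2)"
  have pos: "(\<integral>\<^sup>+x. ennreal (?f x) * indicator {0..} x \<partial>lborel) = ennreal (pi / 2 - arctan 0)"
    using DERIV_arctan
    by (intro nn_integral_FTC_atLeast[where F=arctan] tendsto_arctan_at_top) (simp_all add: inverse_eq_divide)
  have neg: "(\<integral>\<^sup>+x. ennreal (?f x) * indicator {..0} x \<partial>lborel) = ennreal (pi / 2 - arctan 0)"
    unfolding pos[symmetric]
    by (subst nn_integral_real_affine[where c="-1" and t=0]) (auto simp: indicator_def intro!: nn_integral_cong)
  have "(\<integral>\<^sup>+x. ennreal (norm (?f x)) \<partial>lborel)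
      \<le> (\<integral>\<^sup>+x. ennreal (?f x) * indicator {0..} x + ennreal (?f x) * indicator {..0} x \<partial>lborel)"
    by (intro nn_integral_mono) (auto simp: indicator_def)
  also have "\<dots> = ennreal (pi / 2 - arctan 0) + ennreal (pi / 2 - arctan 0)"
    by (subst nn_integral_add) (simp_all add: pos neg)
  also have "\<dots> < \<infinity>" by simp
  finally show "(\<integral>\<^sup>+x. ennreal (norm (?f x)) \<partial>lborel) < \<infinity>" .
qed measurable

text \<open>Each of the \<open>CARD('n)\<close> factors \<open>1 + (x \<bullet> b)\<^sup>2\<close>
  is at most \<open>(1 + norm x)\<^sup>2\<close>, whence the exponent; the product of their inverses
  integrates as a product of one-dimensional integrals.\<close>

lemma integrable_decay: "integrable lborel (\<lambda>x::real^'n::finite. 1 / (1 + norm x) ^ (2 * CARD('n)))"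
proof (rule Bochner_Integration.integrable_bound)
  let ?B = "Basis :: (real^'n) set"
  let ?P = "\<lambda>x::real^'n. \<Prod>b\<in>?B. 1 / (1 + (x \<bullet> b)\<^sup>2)"
  interpret product_sigma_finite "\<lambda>_::real^'n. lborel :: real measure" by standard
  have "integrable (\<Pi>\<^sub>M b\<in>?B. lborel) (\<lambda>x. \<Prod>b\<in>?B. 1 / (1 + (x b :: real)\<^sup>2))"
    by (rule product_integrable_prod[where f="\<lambda>_ y. 1 / (1 + y\<^sup>2)"]) (simp_all add: integrable_lborel_inverse_1_plus_square)
  then show "integrable lborel ?P"
    by (subst lborel_eq, subst integrable_distr_eq) (simp_all add: inner_sum_left_Basis cong: prod.cong)
  have "norm (1 / (1 + norm x) ^ (2 * CARD('n))) \<le> norm (?P x)" for x :: "real^'n"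
  proof -
    have "(\<Prod>b\<in>?B. 1 + (x \<bullet> b)\<^sup>2) \<le> (\<Prod>b\<in>?B. (1 + norm x)\<^sup>2)"
    proof (rule prod_mono)
      fix b assume "b \<in> ?B"
      then have "(x \<bullet> b)\<^sup>2 \<le> (norm x)\<^sup>2"
        using Basis_le_norm[of b x] by (simp add: abs_le_square_iff[symmetric])
      then show "0 \<le> 1 + (x \<bullet> b)\<^sup>2 \<and> 1 + (x \<bullet> b)\<^sup>2 \<le> (1 + norm x)\<^sup>2"
        by (auto simp: power2_sum intro: add_increasing2)
    qed
    also have "\<dots> = (1 + norm x) ^ (2 * CARD('n))"
      by (simp add: power_mult[symmetric])
    finally have "(\<Prod>b\<in>?B. 1 + (x \<bullet> b)\<^sup>2) \<le> (1 + norm x) ^ (2 * CARD('n))" .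
    moreover have "0 < (1 + norm x) ^ (2 * CARD('n))" by (intro zero_less_power add_pos_nonneg) auto
    ultimately have "1 / (1 + norm x) ^ (2 * CARD('n)) \<le> 1 / (\<Prod>b\<in>?B. 1 + (x \<bullet> b)\<^sup>2)"
      by (intro divide_left_mono mult_pos_pos prod_pos) (auto intro: add_pos_nonneg)
    also have "\<dots> = ?P x" by (simp add: prod_dividef)
    finally show ?thesis by (simp add: abs_of_nonneg prod_nonneg)
  qed
  then show "AE x in lborel. norm (1 / (1 + norm x) ^ (2 * CARD('n))) \<le> norm (?P x)" by simp
qed measurable

lemma integrable_rapid:
  fixes f :: "real^'n::finite \<Rightarrow> 'b::{banach, second_countable_topology}"
  assumes f: "f \<in> borel_measurable borel"
    and bound: "\<And>x. (1 + norm x) ^ (2 * CARD('n)) * norm (f x) \<le> C"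
  shows "integrable lborel f"
    and "norm (LINT x|lborel. f x) \<le> C * (LINT x::real^'n|lborel. 1 / (1 + norm x) ^ (2 * CARD('n)))"
proof -
  have b: "norm (f x) \<le> C * (1 / (1 + norm x) ^ (2 * CARD('n)))" for x
    using bound[of x] by (simp add: pos_le_divide_eq mult.commute add_pos_nonneg)
  have i: "integrable lborel (\<lambda>x::real^'n. C * (1 / (1 + norm x) ^ (2 * CARD('n))))"
    using integrable_mult_right[OF integrable_decay] .
  show f_int: "integrable lborel f"
    by (rule Bochner_Integration.integrable_bound[OF i]) (use f in simp, intro AE_I2 order_trans[OF b], simp add: divide_right_mono)
  have "norm (LINT x|lborel. f x) \<le> (LINT x|lborel. norm (f x))" by (rule integral_norm_bound)
  also have "\<dots> \<le> (LINT x::real^'n|lborel. C * (1 / (1 + norm x) ^ (2 * CARD('n))))"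
    by (intro integral_mono i integrable_norm f_int b)
  also have "\<dots> = C * (LINT x::real^'n|lborel. 1 / (1 + norm x) ^ (2 * CARD('n)))"
    by (rule integral_mult_right_zero)
  finally show "norm (LINT x|lborel. f x) \<le> C * (LINT x::real^'n|lborel. 1 / (1 + norm x) ^ (2 * CARD('n)))" .
qed

lemma schwartz_norm_integrable:
  fixes f :: "real^'n::finite \<Rightarrow> complex"
  assumes "f \<in> schwartz" shows "integrable lborel (\<lambda>x. (1 + norm x) ^ m * norm (f x))"
proof -
  obtain C where C: "\<And>x. (1 + norm x) ^ (2 * CARD('n) + m) * norm (f x) \<le> C" using schwartz_bound[OF assms] by blast
  show ?thesis
    by (rule integrable_rapid(1)[where C=C]) (use C schwartz_measurable[OF assms] in \<open>auto simp: power_add mult.assoc\<close>)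
qed

lemma schwartz_integrable:
  assumes "f \<in> schwartz" shows "integrable lborel f"
proof (rule integrable_norm_cancel)
  show "integrable lborel (\<lambda>x. norm (f x))" using schwartz_norm_integrable[OF assms, of 0] by simp
  show "f \<in> borel_measurable lborel" using schwartz_measurable[OF assms] by simp
qed

section \<open>The Fourier transform on the Schwartz space\<close>

lemma schwartz_fchar_integrable: "f \<in> schwartz \<Longrightarrow> integrable lborel (\<lambda>x. f x * fchar x t)"
  using schwartz_integrable[OF schwartz_mult_fchar(1)] by (simp add: mult.commute)

text \<open>The definition integrates over the completed measure, while Fubini, substitution and
  translation are applied to \<open>lborel\<close>; a Borel integrand has the same integral for
  both.\<close>

lemma fourier_schwartz_eq:
  assumes "f \<in> schwartz" shows "fourier f t = (LINT x|lborel. f x * fchar x t)"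
  unfolding fourier_fchar
  using borel_measurable_integrable[OF schwartz_fchar_integrable[OF assms]] by (intro integral_completion) simp

lemma fourier_add:
  assumes "f \<in> schwartz" "g \<in> schwartz"
  shows "fourier (\<lambda>x. f x + g x) t = fourier f t + fourier g t"
  using assms by (simp add: fourier_schwartz_eq schwartz_add schwartz_fchar_integrable distrib_right)

lemma fourier_scale:
  assumes "f \<in> schwartz" shows "fourier (\<lambda>x. c * f x) t = c * fourier f t"
  using assms by (simp add: fourier_schwartz_eq schwartz_scale mult.assoc)

text \<open>Linearising the character in \<open>t\<close> leaves an error of at most
  \<open>(2 pi)^2 |h|^2 (1 + |x|)^2\<close>, and \<open>(1 + |x|)^2 |f|\<close> is integrable; the
  error of the candidate derivative is therefore at most \<open>M |h|^2\<close>.\<close>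

lemma fourier_has_derivative:
  fixes f :: "real^'n::finite \<Rightarrow> complex"
  assumes f: "f \<in> schwartz"
  shows "(fourier f has_derivative
     (\<lambda>h. \<Sum>j\<in>UNIV. of_real (h $ j) * fourier (\<lambda>x. (- 2 * complex_of_real pi * \<i>) * (of_real (x $ j) * f x)) t)) (at t)"
    (is "(_ has_derivative ?D) _")
proof -
  let ?k = "- 2 * complex_of_real pi * \<i>"
  define M where "M = (2 * pi)\<^sup>2 * (LINT x|lborel. (1 + norm x) ^ 2 * norm (f x))"
  let ?g = "\<lambda>j x. ?k * (of_real (x $ j) * f x)"
  have g: "?g j \<in> schwartz" for j by (rule schwartz_scale[OF schwartz_mult_coord[OF f]])
  have bl: "bounded_linear ?D"
    by (rule bounded_linear_sum,
        rule bounded_linear_mult_const[OF bounded_linear_compose[OF bounded_linear_of_real bounded_linear_vec_nth]])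
  have sum_eq: "(\<Sum>j\<in>UNIV. of_real (h $ j) * ?g j x) = ?k * complex_of_real (x \<bullet> h) * f x" for h x
    by (simp add: inner_vec_def sum_distrib_left sum_distrib_right ac_simps)
  have D: "?D h = (LINT x|lborel. ?k * complex_of_real (x \<bullet> h) * f x * fchar x t)" for h
  proof -
    have "?D h = (\<Sum>j\<in>UNIV. LINT x|lborel. of_real (h $ j) * (?g j x * fchar x t))"
      using g by (simp add: fourier_schwartz_eq)
    also have "\<dots> = (LINT x|lborel. (\<Sum>j\<in>UNIV. of_real (h $ j) * (?g j x * fchar x t)))"
      by (rule Bochner_Integration.integral_sum[symmetric]) (rule integrable_mult_right[OF schwartz_fchar_integrable[OF g]])
    also have "(\<lambda>x. \<Sum>j\<in>UNIV. of_real (h $ j) * (?g j x * fchar x t)) = (\<lambda>x. ?k * complex_of_real (x \<bullet> h) * f x * fchar x t)"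
      unfolding sum_eq[symmetric] sum_distrib_right by (simp add: mult.assoc)
    finally show ?thesis .
  qed
  have int_D: "integrable lborel (\<lambda>x. ?k * complex_of_real (x \<bullet> h) * f x * fchar x t)" for h
    unfolding sum_eq[symmetric] sum_distrib_right mult.assoc[of "of_real _"]
    by (rule Bochner_Integration.integrable_sum, rule integrable_mult_right[OF schwartz_fchar_integrable[OF g]])
  have est: "norm (fourier f y - fourier f t - ?D (y - t)) / norm (y - t) \<le> M * norm (y - t)" if "y \<noteq> t" for y
  proof -
    let ?h = "y - t"
    have "norm (fourier f y - fourier f t - ?D ?h)
       = norm (LINT x|lborel. f x * fchar x y - f x * fchar x t - ?k * complex_of_real (x \<bullet> ?h) * f x * fchar x t)"
      unfolding D fourier_schwartz_eq[OF f]
      by (simp only: Bochner_Integration.integral_diff Bochner_Integration.integrable_diff schwartz_fchar_integrable[OF f] int_D)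
    also have "\<dots> \<le> (LINT x|lborel. norm (f x * fchar x y - f x * fchar x t - ?k * complex_of_real (x \<bullet> ?h) * f x * fchar x t))"
      by (rule integral_norm_bound)
    also have "\<dots> \<le> (LINT x|lborel. ((2 * pi)\<^sup>2 * (norm ?h)\<^sup>2) * ((1 + norm x) ^ 2 * norm (f x)))"
    proof (rule integral_mono)
      fix x
      let ?a = "?k * complex_of_real (x \<bullet> ?h)"
      have "fchar x y = fchar x t * exp ?a"
        using fchar_add(2)[of x t "?h"] by (simp add: fchar_def)
      then have "f x * fchar x y - f x * fchar x t - ?a * f x * fchar x t = f x * fchar x t * (exp ?a - (\<Sum>i\<le>1. ?a ^ i / fact i))"
        by (simp add: algebra_simps)
      then have "norm (f x * fchar x y - f x * fchar x t - ?a * f x * fchar x t) = norm (f x) * norm (exp ?a - (\<Sum>i\<le>1. ?a ^ i / fact i))"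
        by (simp only: norm_mult norm_fchar mult_1_right)
      also have "\<dots> \<le> norm (f x) * ((2 * pi)\<^sup>2 * (norm ?h)\<^sup>2 * (1 + norm x) ^ 2)"
      proof (rule mult_left_mono)
        \<comment> \<open>\<open>?a\<close> is purely imaginary, so the exponential factor in
          Taylor's bound is 1.\<close>
        have "norm (exp ?a - (\<Sum>i\<le>1. ?a ^ i / fact i)) \<le> norm ?a ^ 2"
          using Taylor_exp[of ?a 1] by (simp add: power2_eq_square)
        also have "norm ?a ^ 2 = (2 * pi)\<^sup>2 * \<bar>x \<bullet> ?h\<bar>\<^sup>2" by (simp add: norm_mult power_mult_distrib)
        also have "\<dots> \<le> (2 * pi)\<^sup>2 * (norm ?h * (1 + norm x))\<^sup>2"
        proof (intro mult_left_mono power_mono)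
          show "\<bar>x \<bullet> ?h\<bar> \<le> norm ?h * (1 + norm x)"
            using Cauchy_Schwarz_ineq2[of x ?h] by (simp add: algebra_simps add_increasing)
        qed auto
        finally show "norm (exp ?a - (\<Sum>i\<le>1. ?a ^ i / fact i)) \<le> (2 * pi)\<^sup>2 * (norm ?h)\<^sup>2 * (1 + norm x) ^ 2"
          by (simp add: power_mult_distrib mult.assoc)
      qed simp
      finally show "norm (f x * fchar x y - f x * fchar x t - ?a * f x * fchar x t)
         \<le> ((2 * pi)\<^sup>2 * (norm ?h)\<^sup>2) * ((1 + norm x) ^ 2 * norm (f x))" by (simp add: ac_simps)
    qed (intro integrable_norm Bochner_Integration.integrable_diff schwartz_fchar_integrable[OF f] int_D
        integrable_mult_right schwartz_norm_integrable[OF f])+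
    also have "\<dots> = M * (norm ?h)\<^sup>2" by (simp add: M_def)
    finally have "norm (fourier f y - fourier f t - ?D ?h) \<le> M * norm ?h * norm ?h" by (simp add: power2_eq_square mult.assoc)
    then show "norm (fourier f y - fourier f t - ?D ?h) / norm ?h \<le> M * norm ?h"
      using that by (simp add: pos_divide_le_eq)
  qed
  have "((\<lambda>y. M * norm (y - t)) \<longlongrightarrow> M * norm (t - t)) (at t)"
    by (intro tendsto_intros)
  then show ?thesis
    by (intro has_derivativeI_sandwich[of 1 _ UNIV t _ "\<lambda>y. M * norm (y - t)"] bl est) simp_all
qed

lemma partial_fourier:
  assumes "f \<in> schwartz"
  shows "partial j (fourier f) = fourier (\<lambda>x. (- 2 * complex_of_real pi * \<i>) * (of_real (x $ j) * f x))"
proof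
  fix t
  have "partial j (fourier f) t = (\<Sum>i\<in>UNIV. of_real (axis j 1 $ i) * fourier (\<lambda>x. (- 2 * complex_of_real pi * \<i>) * (of_real (x $ i) * f x)) t)"
    by (rule partial_eqI[OF fourier_has_derivative[OF assms]])
  also have "\<dots> = (\<Sum>i\<in>UNIV. if i = j then fourier (\<lambda>x. (- 2 * complex_of_real pi * \<i>) * (of_real (x $ i) * f x)) t else 0)"
    by (intro sum.cong) (auto simp: axis_def)
  finally show "partial j (fourier f) t = fourier (\<lambda>x. (- 2 * complex_of_real pi * \<i>) * (of_real (x $ j) * f x)) t"
    by simp
qed

text \<open>Mean value inequality on a segment in a coordinate direction; it supplies the majorant
  for difference quotients.\<close>

lemma schwartz_increment:
  assumes f: "f \<in> schwartz" and s: "0 \<le> s"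
    and B: "\<And>u. 0 \<le> u \<Longrightarrow> u \<le> s \<Longrightarrow> norm (partial j f (x + u *\<^sub>R axis j 1)) \<le> B"
  shows "norm (f (x + s *\<^sub>R axis j 1) - f x) \<le> B * s"
proof -
  let ?g = "\<lambda>u. f (x + u *\<^sub>R axis j 1)"
  have "norm (?g s - ?g 0) \<le> B * norm (s - 0)"
  proof (rule differentiable_bound[of "{0..s}" ?g "\<lambda>u h. h *\<^sub>R partial j f (x + u *\<^sub>R axis j 1)"])
    fix u assume u: "u \<in> {0..s}"
    let ?D = "frechet_derivative f (at (x + u *\<^sub>R axis j 1))"
    have D: "(f has_derivative ?D) (at (x + u *\<^sub>R axis j 1))" by (rule schwartz_frechet[OF f])
    have "((\<lambda>u. x + u *\<^sub>R axis j 1) has_derivative (\<lambda>h. h *\<^sub>R axis j 1)) (at u)"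
      by (auto intro!: derivative_eq_intros)
    from has_derivative_compose[OF this D]
    have "(?g has_derivative (\<lambda>h. ?D (h *\<^sub>R axis j 1))) (at u)" .
    moreover have "?D (h *\<^sub>R axis j 1) = h *\<^sub>R partial j f (x + u *\<^sub>R axis j 1)" for h
      unfolding partial_def using linear_cmul[OF bounded_linear.linear[OF has_derivative_bounded_linear[OF D]]] .
    ultimately show "(?g has_derivative (\<lambda>h. h *\<^sub>R partial j f (x + u *\<^sub>R axis j 1))) (at u within {0..s})"
      using has_derivative_at_withinI by fastforce
    show "onorm (\<lambda>h. h *\<^sub>R partial j f (x + u *\<^sub>R axis j 1)) \<le> B"
    proof (rule onorm_bound)
      show "0 \<le> B" using B[of u] u by (meson atLeastAtMost_iff norm_ge_zero order_trans)
      show "norm (h *\<^sub>R partial j f (x + u *\<^sub>R axis j 1)) \<le> B * norm h" for h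
        using mult_left_mono[OF B[of u], of "norm h"] u by (simp add: mult.commute)
    qed
  qed (use s in auto)
  then show ?thesis using s by simp
qed

text \<open>Translation invariance makes the integrals of the difference quotients vanish.\<close>

lemma integral_partial_zero:
  fixes f :: "real^'n::finite \<Rightarrow> complex"
  assumes f: "f \<in> schwartz" shows "(LINT x|lborel. partial j f x) = 0"
proof -
  define a :: "real^'n" where "a = axis j 1"
  define r where "r i = 1 / real (Suc i)" for i
  define q where "q i x = of_real (real (Suc i)) * (f (x + r i *\<^sub>R a) - f x)" for i x
  have r: "0 < r i" "r i \<le> 1" for i by (simp_all add: r_def)
  let ?p = "2 * CARD('n)"
  obtain C where C: "C > 0" "\<And>x. (1 + norm x) ^ ?p * norm (partial j f x) \<le> C"
    using schwartz_bound[OF schwartz_partial[OF f]] by blast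
  have [measurable]: "f \<in> borel_measurable borel" "partial j f \<in> borel_measurable borel"
    by (intro schwartz_measurable schwartz_partial f)+
  have "(\<lambda>i. LINT x|lborel. q i x) \<longlonglongrightarrow> (LINT x|lborel. partial j f x)"
  proof (rule integral_dominated_convergence)
    show "partial j f \<in> borel_measurable lborel" "q i \<in> borel_measurable lborel" for i
      unfolding q_def by measurable
    show "integrable lborel (\<lambda>x::real^'n. (C * 2 ^ ?p) * (1 / (1 + norm x) ^ ?p))"
      using integrable_mult_right[OF integrable_decay] .
    show "AE x in lborel. norm (q i x) \<le> (C * 2 ^ ?p) * (1 / (1 + norm x) ^ ?p)" for i
    proof (rule AE_I2)
      fix x
      have "norm (f (x + r i *\<^sub>R a) - f x) \<le> (C * 2 ^ ?p) * (1 / (1 + norm x) ^ ?p) * r i"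
        unfolding a_def
      proof (rule schwartz_increment[OF f])
        \<comment> \<open>As the step has length at most 1, \<open>1 + norm x\<close> is at most
          twice \<open>1 + norm ?y\<close> on the segment; this is the factor \<open>2 ^ ?p\<close>
          of the majorant.\<close>
        fix u assume u: "0 \<le> u" "u \<le> r i"
        let ?y = "x + u *\<^sub>R axis j 1"
        have 1: "norm x \<le> norm ?y + u"
          using norm_triangle_ineq4[of ?y "u *\<^sub>R axis j 1"] u(1) by (simp add: norm_axis_1)
        have 2: "u \<le> 1" using u(2) r(2)[of i] by simp
        have 3: "0 \<le> norm ?y" by (rule norm_ge_zero)
        have "1 + norm x \<le> 2 * (1 + norm ?y)" using 1 2 3 by argo
        then have "(1 + norm x) ^ ?p \<le> (2 * (1 + norm ?y)) ^ ?p" by (intro power_mono) auto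
        from mult_right_mono[OF this norm_ge_zero[of "partial j f ?y"]]
        have "(1 + norm x) ^ ?p * norm (partial j f ?y) \<le> 2 ^ ?p * ((1 + norm ?y) ^ ?p * norm (partial j f ?y))"
          unfolding power_mult_distrib mult.assoc .
        also have "\<dots> \<le> 2 ^ ?p * C" by (intro mult_left_mono C) simp
        finally show "norm (partial j f ?y) \<le> (C * 2 ^ ?p) * (1 / (1 + norm x) ^ ?p)"
          by (simp add: pos_le_divide_eq add_pos_nonneg ac_simps)
      qed (use r[of i] in simp)
      then have "norm (f (x + r i *\<^sub>R a) - f x) / r i \<le> (C * 2 ^ ?p) * (1 / (1 + norm x) ^ ?p)"
        using r(1)[of i] by (simp only: pos_divide_le_eq)
      moreover have "norm (q i x) = norm (f (x + r i *\<^sub>R a) - f x) / r i"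
        unfolding q_def norm_mult norm_of_real by (simp add: r_def mult.commute)
      ultimately show "norm (q i x) \<le> (C * 2 ^ ?p) * (1 / (1 + norm x) ^ ?p)" by simp
    qed
    show "AE x in lborel. (\<lambda>i. q i x) \<longlonglongrightarrow> partial j f x"
    proof (rule AE_I2)
      fix x
      let ?D = "frechet_derivative f (at x)"
      have D: "(f has_derivative ?D) (at x)" by (rule schwartz_frechet[OF f])
      have lim: "filterlim (\<lambda>i. r i *\<^sub>R a) (at 0) sequentially"
        unfolding filterlim_at
      proof
        have "(\<lambda>i. r i *\<^sub>R a) \<longlonglongrightarrow> 0 *\<^sub>R a"
          using LIMSEQ_inverse_real_of_nat unfolding r_def inverse_eq_divide by (intro tendsto_scaleR tendsto_const) 
        then show "(\<lambda>i. r i *\<^sub>R a) \<longlonglongrightarrow> 0" by simp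
        show "\<forall>\<^sub>F i in sequentially. r i *\<^sub>R a \<in> UNIV \<and> r i *\<^sub>R a \<noteq> 0"
          using r by (auto simp: a_def axis_eq_0_iff less_imp_neq[THEN not_sym])
      qed
      have "((\<lambda>h. norm (f (x + h) - f x - ?D h) / norm h) \<longlongrightarrow> 0) (at 0)"
        using D unfolding has_derivative_at by simp
      from filterlim_compose[OF this lim]
      have "(\<lambda>i. norm (f (x + r i *\<^sub>R a) - f x - ?D (r i *\<^sub>R a)) / norm (r i *\<^sub>R a)) \<longlonglongrightarrow> 0" .
      moreover have "norm (f (x + r i *\<^sub>R a) - f x - ?D (r i *\<^sub>R a)) / norm (r i *\<^sub>R a) = norm (q i x - partial j f x)" for i
      proof -
        have "?D (r i *\<^sub>R a) = r i *\<^sub>R partial j f x"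
          unfolding partial_def a_def using linear_cmul[OF bounded_linear.linear[OF has_derivative_bounded_linear[OF D]]] .
        moreover have "f (x + r i *\<^sub>R a) - f x = of_real (r i) * q i x"
          by (simp add: q_def r_def flip: of_nat_Suc)
        ultimately have "f (x + r i *\<^sub>R a) - f x - ?D (r i *\<^sub>R a) = of_real (r i) * (q i x - partial j f x)"
          by (simp add: scaleR_conv_of_real algebra_simps)
        then show ?thesis using r(1)[of i] by (simp add: norm_mult a_def)
      qed
      ultimately have "(\<lambda>i. norm (q i x - partial j f x)) \<longlonglongrightarrow> 0" by simp
      then show "(\<lambda>i. q i x) \<longlonglongrightarrow> partial j f x"
        using tendsto_norm_zero_iff LIM_zero_iff by blast
    qed
  qed
  moreover have "(LINT x|lborel. q i x) = 0" for i
  proof -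
    have f': "integrable (distr lborel borel ((+) (r i *\<^sub>R a))) f"
      unfolding lborel_distr_plus by (rule schwartz_integrable[OF f])
    have "(LINT x|lborel. f x) = (LINT x|distr lborel borel ((+) (r i *\<^sub>R a)). f x)"
      by (simp add: lborel_distr_plus)
    also have "\<dots> = (LINT x|lborel. f (r i *\<^sub>R a + x))"
      by (subst integral_distr) auto
    finally have "(LINT x|lborel. f (x + r i *\<^sub>R a)) = (LINT x|lborel. f x)" by (simp add: add.commute)
    moreover have "integrable lborel (\<lambda>x. f (x + r i *\<^sub>R a))"
      using f' by (subst (asm) integrable_distr_eq) (auto simp: add.commute)
    ultimately show ?thesis using schwartz_integrable[OF f] by (simp add: q_def)
  qed
  ultimately show ?thesis using LIMSEQ_unique[OF _ tendsto_const] by simp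
qed

text \<open>Integration by parts: the partial derivative of \<open>f\<close> times the character has
  integral zero, and the product rule splits it into the two terms.\<close>

lemma fourier_partial:
  assumes f: "f \<in> schwartz"
  shows "fourier (partial j f) t = 2 * complex_of_real pi * \<i> * of_real (t $ j) * fourier f t"
proof -
  have "(LINT x|lborel. partial j f x * fchar x t - 2 * complex_of_real pi * \<i> * of_real (t $ j) * (f x * fchar x t)) = 0"
    using integral_partial_zero[OF schwartz_mult_fchar(1)[OF f, of t], of j]
    unfolding schwartz_mult_fchar(2)[OF f] by (simp add: mult.commute)
  then show ?thesis
    using f schwartz_partial[OF f]
    by (simp add: fourier_schwartz_eq schwartz_fchar_integrable)
qed

text \<open>Iterating one partial derivative controls pure powers of a single coordinate of the
  frequency; this bound assembles them into a power of the norm without mixed derivatives.\<close>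

lemma one_plus_norm_power_le:
  fixes t :: "real^'n::finite"
  shows "(1 + norm t) ^ m \<le> 2 ^ m * (1 + real CARD('n) ^ m * (\<Sum>j\<in>UNIV. \<bar>t $ j\<bar> ^ m))"
proof -
  obtain i where i: "\<And>j. \<bar>t $ j\<bar> \<le> \<bar>t $ i\<bar>"
  proof -
    let ?M = "Max (range (\<lambda>j. \<bar>t $ j\<bar>))"
    have "?M \<in> range (\<lambda>j. \<bar>t $ j\<bar>)" by (rule Max_in) auto
    then obtain i where "?M = \<bar>t $ i\<bar>" by blast
    then show ?thesis using that[of i] Max_ge[of "range (\<lambda>j. \<bar>t $ j\<bar>)"] by auto
  qed
  have "norm t \<le> (\<Sum>j\<in>UNIV. \<bar>t $ j\<bar>)" by (rule norm_le_l1_cart)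
  also have "\<dots> \<le> of_nat (card (UNIV::'n set)) * \<bar>t $ i\<bar>" by (rule sum_bounded_above) (rule i)
  finally have "norm t ^ m \<le> (real CARD('n) * \<bar>t $ i\<bar>) ^ m" by (intro power_mono) auto
  also have "\<dots> = real CARD('n) ^ m * \<bar>t $ i\<bar> ^ m" by (rule power_mult_distrib)
  also have "\<dots> \<le> real CARD('n) ^ m * (\<Sum>j\<in>UNIV. \<bar>t $ j\<bar> ^ m)"
    by (intro mult_left_mono member_le_sum) auto
  finally have 1: "norm t ^ m \<le> real CARD('n) ^ m * (\<Sum>j\<in>UNIV. \<bar>t $ j\<bar> ^ m)" .
  have "(1 + norm t) ^ m \<le> (2 * max 1 (norm t)) ^ m" by (intro power_mono) auto
  also have "\<dots> = 2 ^ m * max 1 (norm t) ^ m" by (rule power_mult_distrib)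
  also have "max 1 (norm t) ^ m \<le> 1 + norm t ^ m" by (cases "norm t \<le> 1") (auto simp: max_def)
  finally show ?thesis using 1 by (smt (verit) mult_left_mono zero_le_power)
qed

lemma fourier_iter_partial:
  assumes f: "f \<in> schwartz"
  shows "fourier (iter_partial (replicate m j) f) t = (2 * complex_of_real pi * \<i> * of_real (t $ j)) ^ m * fourier f t"
proof (induction m)
  case (Suc m)
  then show ?case
    using fourier_partial[OF schwartz_iter_partial[OF f], of j "replicate m j" t]
    by (simp add: iter_partial_Cons del: iter_partial.simps(2))
qed simp

lemma norm_fourier_le:
  fixes f :: "real^'n::finite \<Rightarrow> complex"
  assumes f: "f \<in> schwartz"
  shows "norm (fourier f t) \<le> schwartz_seminorm (2 * CARD('n)) [] f * (LINT x::real^'n|lborel. 1 / (1 + norm x) ^ (2 * CARD('n)))"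
  unfolding fourier_schwartz_eq[OF f]
proof (rule integrable_rapid(2))
  show "(\<lambda>x. f x * fchar x t) \<in> borel_measurable borel"
    using borel_measurable_integrable[OF schwartz_fchar_integrable[OF f]] by simp
  show "(1 + norm x) ^ (2 * CARD('n)) * norm (f x * fchar x t) \<le> schwartz_seminorm (2 * CARD('n)) [] f" for x
    using schwartz_seminorm_ge[OF f, of x "2 * CARD('n)" "[]"] by (simp add: norm_mult)
qed

text \<open>Stated with explicit seminorms and constants independent of \<open>f\<close>, because it
  later has to prove continuity of a functional and not only decay of one transform.\<close>

lemma fourier_decay:
  "\<exists>C N. C \<ge> 0 \<and> (\<forall>f\<in>schwartz. \<forall>t::real^'n::finite. (1 + norm t) ^ m * norm (fourier f t)
     \<le> C * (\<Sum>js\<in>{js. length js \<le> N}. schwartz_seminorm N js f))"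
proof (intro exI conjI ballI allI)
  define K where "K = (LINT x::real^'n|lborel. 1 / (1 + norm x) ^ (2 * CARD('n)))"
  \<comment> \<open>\<open>m\<close> derivatives produce the factor \<open>|t $ j| ^ m\<close>, and
    the weight \<open>2 * CARD('n)\<close> makes the integrand integrable.\<close>
  define N where "N = max m (2 * CARD('n))"
  define C where "C = 2 ^ m * (1 + real CARD('n) ^ m * real CARD('n)) * K"
  have K: "K \<ge> 0" unfolding K_def by (intro integral_nonneg_AE) simp
  show "C \<ge> 0" unfolding C_def using K by (intro mult_nonneg_nonneg add_nonneg_nonneg) auto
  fix f :: "real^'n \<Rightarrow> complex" and t assume f: "f \<in> schwartz"
  define S where "S = (\<Sum>js\<in>{js. length js \<le> N}. schwartz_seminorm N js f)"
  have fin: "finite {js :: 'n list. length js \<le> N}"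
    using finite_lists_length_le[of "UNIV :: 'n set" N] by simp
  have S: "schwartz_seminorm (2 * CARD('n)) js f \<le> S" if "length js \<le> N" for js
  proof -
    have "schwartz_seminorm (2 * CARD('n)) js f \<le> schwartz_seminorm N js f"
      by (rule schwartz_seminorm_mono[OF f]) (simp add: N_def)
    also have "\<dots> \<le> S" unfolding S_def
      by (intro member_le_sum) (use that fin schwartz_seminorm_nonneg[OF f] in auto)
    finally show ?thesis .
  qed
  have one: "norm (fourier f t) \<le> S * K"
    using norm_fourier_le[OF f, of t] mult_right_mono[OF S[of "[]"] K] unfolding K_def by simp
  have coord: "\<bar>t $ j\<bar> ^ m * norm (fourier f t) \<le> S * K" for j
  proof -
    let ?g = "iter_partial (replicate m j) f"
    have "\<bar>t $ j\<bar> \<le> 2 * pi * \<bar>t $ j\<bar>"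
      using pi_ge_two mult_right_mono[of 1 "2 * pi" "\<bar>t $ j\<bar>"] by simp
    then have "\<bar>t $ j\<bar> ^ m \<le> (2 * pi * \<bar>t $ j\<bar>) ^ m" by (intro power_mono) auto
    then have "\<bar>t $ j\<bar> ^ m * norm (fourier f t) \<le> (2 * pi * \<bar>t $ j\<bar>) ^ m * norm (fourier f t)"
      by (intro mult_right_mono) auto
    also have "\<dots> = norm (fourier ?g t)"
      unfolding fourier_iter_partial[OF f] by (simp add: norm_mult norm_power power_mult_distrib)
    also have "\<dots> \<le> schwartz_seminorm (2 * CARD('n)) [] ?g * K"
      unfolding K_def by (rule norm_fourier_le[OF schwartz_iter_partial[OF f]])
    also have "schwartz_seminorm (2 * CARD('n)) [] ?g = schwartz_seminorm (2 * CARD('n)) (replicate m j) f"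
      by (simp add: schwartz_seminorm_def)
    also have "\<dots> * K \<le> S * K" by (intro mult_right_mono S K) (simp add: N_def)
    finally show ?thesis .
  qed
  have "(1 + norm t) ^ m * norm (fourier f t)
      \<le> 2 ^ m * (1 + real CARD('n) ^ m * (\<Sum>j\<in>UNIV. \<bar>t $ j\<bar> ^ m)) * norm (fourier f t)"
    by (intro mult_right_mono one_plus_norm_power_le) simp
  also have "\<dots> = 2 ^ m * (norm (fourier f t) + real CARD('n) ^ m * (\<Sum>j\<in>UNIV. \<bar>t $ j\<bar> ^ m * norm (fourier f t)))"
    by (simp add: algebra_simps sum_distrib_left)
  also have "\<dots> \<le> 2 ^ m * (S * K + real CARD('n) ^ m * (\<Sum>j\<in>(UNIV::'n set). S * K))"
    by (intro mult_left_mono add_mono sum_mono one coord) auto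
  also have "\<dots> = C * S" by (simp add: C_def algebra_simps)
  finally show "(1 + norm t) ^ m * norm (fourier f t) \<le> C * (\<Sum>js\<in>{js. length js \<le> N}. schwartz_seminorm N js f)"
    unfolding S_def .
qed

text \<open>A partial derivative of a transform is the transform of a coordinate multiple, so the
  image of the Schwartz space is closed under derivatives; its decay is
  \<open>fourier_decay\<close>.\<close>

lemma fourier_in_schwartz:
  fixes f :: "real^'n::finite \<Rightarrow> complex"
  assumes "f \<in> schwartz" shows "fourier f \<in> schwartz"
proof (rule schwartz_coinduct[where S="fourier ` schwartz"])
  fix h :: "real^'n \<Rightarrow> complex" assume "h \<in> fourier ` schwartz"
  then obtain g where h: "h = fourier g" and g: "g \<in> schwartz" by blast
  show "h differentiable (at x)" for x
    unfolding h using fourier_has_derivative[OF g] by (rule differentiableI)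
  show "\<exists>C. \<forall>x. (1 + norm x) ^ m * norm (h x) \<le> C" for m
    unfolding h using fourier_decay[of m, where 'n='n] g by blast
  show "partial j h \<in> fourier ` schwartz" for j
    unfolding h partial_fourier[OF g] by (rule imageI[OF schwartz_scale[OF schwartz_mult_coord[OF g]]])
qed (use assms in blast)

section \<open>Gaussians\<close>

lemma real_polynomial_has_derivative:
  fixes p :: "'a::real_normed_vector \<Rightarrow> real"
  assumes "real_polynomial_function p"
  shows "\<exists>D. (\<forall>x. (p has_derivative D x) (at x)) \<and> (\<forall>h. real_polynomial_function (\<lambda>x. D x h))"
  using assms
proof induction
  case (linear f)
  then show ?case
    by (intro exI[of _ "\<lambda>_. f"]) (auto intro: bounded_linear_imp_has_derivative)
next
  case (const c)
  then show ?case by (intro exI[of _ "\<lambda>_ _. 0"]) auto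
next
  case (add f g)
  then obtain D E where "\<And>x. (f has_derivative D x) (at x)" "\<And>h. real_polynomial_function (\<lambda>x. D x h)"
    "\<And>x. (g has_derivative E x) (at x)" "\<And>h. real_polynomial_function (\<lambda>x. E x h)" by blast
  then show ?case
    by (intro exI[of _ "\<lambda>x h. D x h + E x h"]) (auto intro: has_derivative_add)
next
  case (mult f g)
  then obtain D E where "\<And>x. (f has_derivative D x) (at x)" "\<And>h. real_polynomial_function (\<lambda>x. D x h)"
    "\<And>x. (g has_derivative E x) (at x)" "\<And>h. real_polynomial_function (\<lambda>x. E x h)" by blast
  then show ?case using mult(1,2)
    by (intro exI[of _ "\<lambda>x h. f x * E x h + D x h * g x"] conjI allI has_derivative_mult
      real_polynomial_function.intros(3,4))
qed

lemma real_polynomial_growth: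
  fixes p :: "'a::real_normed_vector \<Rightarrow> real"
  assumes "real_polynomial_function p"
  shows "\<exists>C m. \<forall>x. \<bar>p x\<bar> \<le> C * (1 + norm x) ^ m"
  using assms
proof induction
  case (linear f)
  then obtain K where K: "\<And>x. norm (f x) \<le> norm x * K" "0 \<le> K" using bounded_linear.nonneg_bounded by blast
  have "\<bar>f x\<bar> \<le> K * (1 + norm x) ^ 1" for x using K(1)[of x] K(2) by (simp add: algebra_simps)
  then show ?case by blast
next
  case (const c)
  have "\<bar>c\<bar> \<le> \<bar>c\<bar> * (1 + norm x) ^ 0" for x :: 'a by simp
  then show ?case by blast
next
  case (add f g)
  then obtain C D m n where *: "\<And>x. \<bar>f x\<bar> \<le> C * (1 + norm x) ^ m" "\<And>x. \<bar>g x\<bar> \<le> D * (1 + norm x) ^ n" by blast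
  then have C: "C \<ge> 0" "D \<ge> 0" using order_trans[OF abs_ge_zero *(1)[of 0]] order_trans[OF abs_ge_zero *(2)[of 0]] by auto
  have "\<bar>f x + g x\<bar> \<le> (C + D) * (1 + norm x) ^ (m + n)" for x
  proof -
    have "\<bar>f x + g x\<bar> \<le> C * (1 + norm x) ^ m + D * (1 + norm x) ^ n"
      using *(1)[of x] *(2)[of x] by linarith
    also have "\<dots> \<le> C * (1 + norm x) ^ (m + n) + D * (1 + norm x) ^ (m + n)"
      by (intro add_mono mult_left_mono power_increasing C) auto
    finally show ?thesis by (simp add: distrib_right)
  qed
  then show ?case by blast
next
  case (mult f g)
  then obtain C D m n where *: "\<And>x. \<bar>f x\<bar> \<le> C * (1 + norm x) ^ m" "\<And>x. \<bar>g x\<bar> \<le> D * (1 + norm x) ^ n" by blast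
  have "\<bar>f x * g x\<bar> \<le> (C * D) * (1 + norm x) ^ (m + n)" for x
    using mult_mono'[OF *(1)[of x] *(2)[of x]] by (simp add: abs_mult power_add ac_simps)
  then show ?case by blast
qed

lemma power_le_fact_exp:
  assumes "0 \<le> (x::real)" shows "x ^ n \<le> fact n * exp x"
proof -
  have "(\<Sum>k\<in>{n}. x ^ k /\<^sub>R fact k) \<le> (\<Sum>k. x ^ k /\<^sub>R fact k)"
    by (rule sum_le_suminf[OF summable_exp_generic]) (use assms in auto)
  then show ?thesis by (simp add: exp_def field_simps)
qed

text \<open>Polynomial multiples of the exponential of a quadratic are closed under derivatives. The
  linear term \<open>b\<close> is there for products of Gaussians with different centres.\<close>

lemma schwartz_gaussian:
  fixes b :: "real^'n::finite"
  assumes a: "a > 0"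
  shows "(\<lambda>x. complex_of_real (exp (- a * (x \<bullet> x) + b \<bullet> x))) \<in> schwartz"
proof -
  define q where "q x = - a * (x \<bullet> x) + b \<bullet> x" for x :: "real^'n"
  define E where "E p = (\<lambda>x. complex_of_real (p x * exp (q x)))" for p :: "real^'n \<Rightarrow> real"
  define dq where "dq x h = - a * (x \<bullet> h + h \<bullet> x) + b \<bullet> h" for x h :: "real^'n"
  have q: "(q has_derivative dq x) (at x)" for x
    unfolding q_def dq_def by (auto intro!: derivative_eq_intros)
  have E: "(E p has_derivative (\<lambda>h. complex_of_real ((D x h + p x * dq x h) * exp (q x)))) (at x)"
    if "\<And>x. (p has_derivative D x) (at x)" for p D x
  proof -
    have "((\<lambda>x. exp (q x)) has_derivative (\<lambda>h. exp (q x) * dq x h)) (at x)"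
      by (rule has_derivative_eq_rhs[OF has_derivative_exp[OF q]]) (simp add: fun_eq_iff)
    from has_derivative_of_real[OF has_derivative_mult[OF that[of x] this]]
    show ?thesis unfolding E_def by (rule has_derivative_eq_rhs) (simp add: fun_eq_iff algebra_simps)
  qed
  have "E (\<lambda>_. 1) \<in> schwartz"
  proof (rule schwartz_coinduct[where S="{E p | p. real_polynomial_function p}"])
    fix f :: "real^'n \<Rightarrow> complex" assume "f \<in> {E p | p. real_polynomial_function p}"
    then obtain p where f: "f = E p" and p: "real_polynomial_function p" by blast
    obtain D where D: "\<And>x. (p has_derivative D x) (at x)" "\<And>h. real_polynomial_function (\<lambda>x. D x h)"
      using real_polynomial_has_derivative[OF p] by blast
    show "f differentiable (at x)" for x
      unfolding f using E[OF D(1)] by (rule differentiableI)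
    show "partial j f \<in> {E p | p. real_polynomial_function p}" for j
    proof -
      have "partial j f = E (\<lambda>x. D x (axis j 1) + p x * dq x (axis j 1))"
        unfolding f using partial_eqI[OF E[OF D(1)]] by (auto simp: E_def fun_eq_iff)
      moreover have "real_polynomial_function (\<lambda>x. dq x (axis j 1))"
        unfolding dq_def
        by (intro real_polynomial_function.intros bounded_linear_inner_left bounded_linear_inner_right)
      moreover from this have "real_polynomial_function (\<lambda>x. D x (axis j 1) + p x * dq x (axis j 1))"
        using D(2)[of "axis j 1"] p by (auto intro: real_polynomial_function.intros(3,4))
      ultimately show ?thesis by (intro CollectI exI conjI)
    qed
    fix m
    obtain C k where C: "\<And>x. \<bar>p x\<bar> \<le> C * (1 + norm x) ^ k"
      using real_polynomial_growth[OF p] by blast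
    have C0: "C \<ge> 0" using order_trans[OF abs_ge_zero C[of 0]] by simp
    \<comment> \<open>The exponential of the maximum over \<open>r\<close> of
      \<open>1 + r + |b| r - a r^2\<close>, found by completing the square.\<close>
    define M where "M = exp (1 + (1 + norm b)\<^sup>2 / (4 * a))"
    have "(1 + norm x) ^ m * norm (f x) \<le> C * (fact (m + k) * M)" for x
    proof -
      let ?r = "norm x"
      have "(1 + ?r) ^ (m + k) \<le> fact (m + k) * exp (1 + ?r)"
        using power_le_fact_exp[of "1 + ?r" "m + k"] by simp
      have "(1 + norm x) ^ m * norm (f x) = (1 + ?r) ^ m * (\<bar>p x\<bar> * exp (q x))"
        by (simp add: f E_def norm_mult)
      also have "\<dots> \<le> (1 + ?r) ^ m * ((C * (1 + ?r) ^ k) * exp (q x))"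
        by (intro mult_left_mono mult_right_mono C) auto
      also have "\<dots> = C * ((1 + ?r) ^ (m + k) * exp (q x))" by (simp add: power_add ac_simps)
      also have "\<dots> \<le> C * (fact (m + k) * M)"
      proof (rule mult_left_mono[OF _ C0])
        have "(1 + ?r) ^ (m + k) * exp (q x) \<le> (fact (m + k) * exp (1 + ?r)) * exp (q x)"
          by (intro mult_right_mono) (use \<open>(1 + ?r) ^ (m + k) \<le> _\<close> in auto)
        also have "\<dots> = fact (m + k) * exp (1 + ?r + q x)" by (simp add: exp_add)
        also have "\<dots> \<le> fact (m + k) * M"
        proof -
          have "q x \<le> - a * ?r\<^sup>2 + norm b * ?r"
            using norm_cauchy_schwarz[of b x] by (simp add: q_def dot_square_norm)
          moreover have "?r + norm b * ?r - a * ?r\<^sup>2 \<le> (1 + norm b)\<^sup>2 / (4 * a)"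
          proof -
            have "0 \<le> (2 * a * ?r - (1 + norm b))\<^sup>2" by simp
            then have "4 * a * (?r + norm b * ?r - a * ?r\<^sup>2) \<le> (1 + norm b)\<^sup>2"
              by (simp add: power2_eq_square algebra_simps)
            then show ?thesis using a by (simp add: pos_le_divide_eq mult.commute)
          qed
          ultimately show ?thesis unfolding M_def by (intro mult_left_mono) auto
        qed
        finally show "(1 + ?r) ^ (m + k) * exp (q x) \<le> fact (m + k) * M" .
      qed
      finally show ?thesis .
    qed
    then show "\<exists>C. \<forall>x. (1 + norm x) ^ m * norm (f x) \<le> C" by blast
  qed (auto intro: real_polynomial_function.intros(2))
  then show ?thesis by (simp add: E_def q_def)
qed

text \<open>Normalised so that the Fourier transform reproduces it up to a constant, without change
  of width.\<close>

definition gaussian :: "real^'n::finite \<Rightarrow> complex" where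
  "gaussian x = complex_of_real (exp (- pi * (x \<bullet> x)))"

lemma gaussian_schwartz: "gaussian \<in> schwartz"
  using schwartz_gaussian[of pi 0] by (simp add: gaussian_def[abs_def])

lemma partial_gaussian: "partial j gaussian = (\<lambda>x. - 2 * complex_of_real pi * (of_real (x $ j) * gaussian x))"
proof
  fix x :: "real^'a"
  have "((\<lambda>x. - pi * (x \<bullet> x)) has_derivative (\<lambda>h. - pi * (x \<bullet> h + h \<bullet> x))) (at x)"
    by (auto intro!: derivative_eq_intros)
  from has_derivative_of_real[OF has_derivative_exp[OF this]]
  have "(gaussian has_derivative (\<lambda>h. complex_of_real (exp (- pi * (x \<bullet> x)) * (- pi * (x \<bullet> h + h \<bullet> x))))) (at x)"
    unfolding gaussian_def[abs_def] by (rule has_derivative_eq_rhs) (simp add: fun_eq_iff)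
  from partial_eqI[OF this] show "partial j gaussian x = - 2 * complex_of_real pi * (of_real (x $ j) * gaussian x)"
    by (simp add: inner_axis inner_axis' gaussian_def)
qed

definition gaussian_mass :: "'n::finite itself \<Rightarrow> complex" where
  "gaussian_mass _ = (LINT x::real^'n|lborel. gaussian x)"

lemma gaussian_mass_nonzero: "gaussian_mass TYPE('n::finite) \<noteq> 0"
proof -
  have i: "integrable lborel (\<lambda>x::real^'n. exp (- pi * (x \<bullet> x)))"
    using integrable_Re[OF schwartz_integrable[OF gaussian_schwartz]] by (simp add: gaussian_def)
  have "(LINT x::real^'n|lborel. exp (- pi * (x \<bullet> x))) \<noteq> 0"
  proof
    assume "(LINT x::real^'n|lborel. exp (- pi * (x \<bullet> x))) = 0"
    then have "AE x::real^'n in lborel. exp (- pi * (x \<bullet> x)) = 0"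
      using integral_nonneg_eq_0_iff_AE[OF i] by simp
    then have "AE x::real^'n in lborel. False" by simp
    then show False by (simp add: eventually_False ae_filter_eq_bot_iff)
  qed
  then show ?thesis by (simp add: gaussian_mass_def gaussian_def)
qed

text \<open>Both sides satisfy \<open>\<partial>\<^sub>j u = -2\<pi>t\<^sub>j u\<close>.\<close>

lemma fourier_gaussian:
  fixes t :: "real^'n::finite"
  shows "fourier gaussian t = gaussian_mass TYPE('n) * gaussian t"
proof -
  let ?G = "fourier (gaussian :: real^'n \<Rightarrow> complex)"
  have pG: "partial j ?G t = - 2 * complex_of_real pi * of_real (t $ j) * ?G t" for j t
  proof -
    have "(\<lambda>x. (- 2 * complex_of_real pi * \<i>) * (of_real (x $ j) * gaussian x)) = (\<lambda>x::real^'n. \<i> * partial j gaussian x)"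
      by (simp add: partial_gaussian ac_simps)
    then have "partial j ?G t = \<i> * fourier (partial j gaussian) t"
      unfolding partial_fourier[OF gaussian_schwartz] by (simp add: fourier_scale[OF schwartz_partial[OF gaussian_schwartz]])
    moreover have "\<i> * (2 * complex_of_real pi * \<i> * u * v) = - 2 * complex_of_real pi * u * v" for u v
      by (simp add: algebra_simps)
    ultimately show ?thesis by (simp only: fourier_partial[OF gaussian_schwartz])
  qed
  have G: "(?G has_derivative (\<lambda>h. - 2 * complex_of_real pi * of_real (t \<bullet> h) * ?G t)) (at t)" for t
    using schwartz_has_derivative[OF fourier_in_schwartz[OF gaussian_schwartz], of t]
    unfolding pG
    by (rule has_derivative_eq_rhs) (simp add: fun_eq_iff inner_vec_def sum_distrib_left sum_distrib_right ac_simps)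
  \<comment> \<open>The quotient by the Gaussian. Its derivative vanishes, so it equals its value at
    0, which is the integral of the Gaussian.\<close>
  define Q where "Q t = ?G t * complex_of_real (exp (pi * (t \<bullet> t)))" for t
  have Q: "(Q has_derivative (\<lambda>h. 0)) (at t)" for t
  proof -
    have "((\<lambda>x. pi * (x \<bullet> x)) has_derivative (\<lambda>h. pi * (t \<bullet> h + h \<bullet> t))) (at t)"
      by (auto intro!: derivative_eq_intros)
    from has_derivative_mult[OF G has_derivative_of_real[OF has_derivative_exp[OF this]]]
    show ?thesis unfolding Q_def
      by (rule has_derivative_eq_rhs) (simp add: fun_eq_iff inner_commute algebra_simps)
  qed
  have "Q t = Q 0" by (rule has_derivative_zero_unique[of UNIV]) (use Q in auto)
  also have "\<dots> = gaussian_mass TYPE('n)"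
    by (simp add: Q_def fourier_schwartz_eq[OF gaussian_schwartz] gaussian_mass_def fchar_def)
  finally have "?G t * (complex_of_real (exp (pi * (t \<bullet> t))) * gaussian t) = gaussian_mass TYPE('n) * gaussian t"
    by (simp add: Q_def mult.assoc)
  moreover have "complex_of_real (exp (pi * (t \<bullet> t))) * gaussian t = 1"
    by (simp add: gaussian_def flip: of_real_mult exp_add)
  ultimately show ?thesis by simp
qed

lemma lborel_affine_eq:
  fixes F :: "real^'n::finite \<Rightarrow> complex"
  assumes F: "F \<in> borel_measurable borel" and c: "c \<noteq> 0"
  shows "(LINT x|lborel. F x) = complex_of_real (\<bar>c\<bar> ^ CARD('n)) * (LINT x|lborel. F (s + c *\<^sub>R x))"
proof -
  have m: "(\<lambda>x. s + c *\<^sub>R x) \<in> borel_measurable borel" by measurable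
  have "(LINT x|lborel. F x) = (LINT x|density (distr lborel borel (\<lambda>x. s + c *\<^sub>R x)) (\<lambda>_. \<bar>c\<bar> ^ CARD('n)). F x)"
    using lborel_affine[OF c, of s] by simp
  also have "\<dots> = (LINT x|distr lborel borel (\<lambda>x. s + c *\<^sub>R x). (\<bar>c\<bar> ^ CARD('n)) *\<^sub>R F x)"
    by (subst integral_density[symmetric]) (use F in \<open>auto simp: ennreal_power\<close>)
  also have "\<dots> = (LINT x|lborel. (\<bar>c\<bar> ^ CARD('n)) *\<^sub>R F (s + c *\<^sub>R x))"
    by (rule integral_distr) (use F m in auto)
  finally show ?thesis by (simp add: scaleR_conv_of_real)
qed

lemma lborel_affine_integrable:
  fixes F :: "real^'n::finite \<Rightarrow> complex"
  assumes F: "integrable lborel F" and c: "c \<noteq> 0"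
  shows "integrable lborel (\<lambda>x. F (s + c *\<^sub>R x))"
proof -
  have m: "(\<lambda>x. s + c *\<^sub>R x) \<in> borel_measurable borel" by measurable
  have Fm: "F \<in> borel_measurable borel" using borel_measurable_integrable[OF F] by simp
  have "integrable (density (distr lborel borel (\<lambda>x. s + c *\<^sub>R x)) (\<lambda>_. \<bar>c\<bar> ^ CARD('n))) F"
    using F lborel_affine[OF c, of s] by simp
  then have "integrable (distr lborel borel (\<lambda>x. s + c *\<^sub>R x)) (\<lambda>x. (\<bar>c\<bar> ^ CARD('n)) *\<^sub>R F x)"
    by (subst (asm) integrable_density) (use Fm in \<open>auto simp: ennreal_power\<close>)
  then have "integrable lborel (\<lambda>x. (\<bar>c\<bar> ^ CARD('n)) *\<^sub>R F (s + c *\<^sub>R x))"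
    by (subst (asm) integrable_distr_eq) (use Fm m in auto)
  from integrable_scaleR_right[OF this, of "1 / \<bar>c\<bar> ^ CARD('n)"] show ?thesis using c by simp
qed

lemma fchar_borel_measurable [measurable]:
  "(\<lambda>z. fchar (fst z) (snd z)) \<in> borel_measurable (borel \<Otimes>\<^sub>M borel)"
  unfolding borel_prod by (intro borel_measurable_continuous_onI continuous_intros)

lemma fchar_measurable [measurable (raw)]:
  assumes "f \<in> borel_measurable M" "g \<in> borel_measurable M"
  shows "(\<lambda>x. fchar (f x) (g x)) \<in> borel_measurable M"
  using measurable_compose[OF measurable_Pair[OF assms] fchar_borel_measurable] by simp

text \<open>Both sides are the double integral of \<open>f x * fchar x t * g t\<close>.\<close>

lemma fourier_multiplication:
  fixes f g :: "real^'n::finite \<Rightarrow> complex"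
  assumes f: "f \<in> schwartz" and g: "g \<in> schwartz"
  shows "(LINT t|lborel. fourier f t * g t) = (LINT x|lborel. f x * fourier g x)"
proof -
  have [measurable]: "f \<in> borel_measurable borel" "g \<in> borel_measurable borel"
    by (intro schwartz_measurable f g)+
  have "integrable (lborel \<Otimes>\<^sub>M lborel) (\<lambda>(x, t). f x * fchar x t * g t)"
  proof (rule lborel_pair.Fubini_integrable)
    show "(\<lambda>(x, t). f x * fchar x t * g t) \<in> borel_measurable (lborel \<Otimes>\<^sub>M lborel)" by measurable
    have "(\<lambda>x. LINT t|lborel. norm (case (x, t) of (x, t) \<Rightarrow> f x * fchar x t * g t)) = (\<lambda>x. norm (f x) * (LINT t|lborel. norm (g t)))"
      by (simp add: norm_mult)
    then show "integrable lborel (\<lambda>x. LINT t|lborel. norm (case (x, t) of (x, t) \<Rightarrow> f x * fchar x t * g t))"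
      using schwartz_integrable[OF f] by simp
    show "AE x in lborel. integrable lborel (\<lambda>t. case (x, t) of (x, t) \<Rightarrow> f x * fchar x t * g t)"
      using schwartz_fchar_integrable[OF g] by (simp add: fchar_commute mult.assoc) (simp add: mult.commute[of "fchar _ _"] fchar_commute)
  qed
  from lborel_pair.Fubini_integral[OF this]
  have 1: "(LINT t|lborel. LINT x|lborel. f x * fchar x t * g t) = (LINT x|lborel. LINT t|lborel. f x * fchar x t * g t)" .
  have 2: "(LINT x|lborel. f x * fchar x t * g t) = fourier f t * g t" for t
    by (simp add: fourier_schwartz_eq[OF f])
  have 3: "(LINT t|lborel. f x * fchar x t * g t) = f x * fourier g x" for x
    by (simp add: fourier_schwartz_eq[OF g] fchar_commute[of x] mult.assoc mult.commute[of "fchar _ _"])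
  show ?thesis using 1 unfolding 2 3 .
qed

section \<open>Fourier inversion on the Schwartz space\<close>

lemma norm_gaussian_le: "norm (gaussian x) \<le> 1"
  by (simp add: gaussian_def)

lemma gaussian_tendsto: "(\<lambda>i. gaussian ((1 / real (Suc i)) *\<^sub>R x)) \<longlonglongrightarrow> 1"
proof -
  have "(\<lambda>i. gaussian ((1 / real (Suc i)) *\<^sub>R x)) \<longlonglongrightarrow> gaussian (0 *\<^sub>R x)"
    using LIMSEQ_inverse_real_of_nat unfolding gaussian_def inverse_eq_divide by (intro tendsto_intros)
  then show ?thesis by (simp add: gaussian_def)
qed

lemma gaussian_scaled_schwartz:
  fixes r :: real
  assumes "r \<noteq> 0"
  shows "(\<lambda>x::real^'n::finite. gaussian (r *\<^sub>R x)) \<in> schwartz"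
proof -
  have "(\<lambda>x::real^'n. gaussian (r *\<^sub>R x)) = (\<lambda>x. complex_of_real (exp (- (pi * r\<^sup>2) * (x \<bullet> x) + 0 \<bullet> x)))"
    by (auto simp: gaussian_def power2_eq_square ac_simps)
  then show ?thesis using schwartz_gaussian[of "pi * r\<^sup>2" "0 :: real^'n"] assms by simp
qed

text \<open>The double integral does not converge absolutely in general, so a Gaussian factor of
  width tending to infinity is inserted; its transform is a Gaussian shrinking to the point
  \<open>- y\<close>. One factor \<open>gaussian_mass\<close> comes from the transform of the
  Gaussian, the other from its integral.\<close>

theorem fourier_fourier:
  fixes f :: "real^'n::finite \<Rightarrow> complex"
  assumes f: "f \<in> schwartz"
  shows "fourier (fourier f) y = (gaussian_mass TYPE('n))\<^sup>2 * f (- y)"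
proof -
  define c where "c = gaussian_mass TYPE('n)"
  define r where "r i = 1 / real (Suc i)" for i
  have r: "r i \<noteq> 0" "r i > 0" for i by (simp_all add: r_def)
  note F = fourier_in_schwartz[OF f]
  have [measurable]: "f \<in> borel_measurable borel" "fourier f \<in> borel_measurable borel" "(gaussian :: real^'n \<Rightarrow> complex) \<in> borel_measurable borel"
    by (intro schwartz_measurable f F gaussian_schwartz)+
  \<comment> \<open>The limit of \<open>I\<close> is computed twice: directly by dominated
    convergence, and after moving the transform from \<open>f\<close> to the regularised
    character.\<close>
  define I where "I i = (LINT t|lborel. fourier f t * (fchar t y * gaussian (r i *\<^sub>R t)))" for i
  have "I \<longlonglongrightarrow> (LINT t|lborel. fourier f t * fchar t y)"
    unfolding I_def
  proof (rule integral_dominated_convergence)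
    show "integrable lborel (\<lambda>t. norm (fourier f t))" using schwartz_integrable[OF F] by simp
    show "AE t in lborel. (\<lambda>i. fourier f t * (fchar t y * gaussian (r i *\<^sub>R t))) \<longlonglongrightarrow> fourier f t * fchar t y"
      using tendsto_mult_left[OF tendsto_mult_left[OF gaussian_tendsto]] unfolding r_def by fastforce
    show "AE t in lborel. norm (fourier f t * (fchar t y * gaussian (r i *\<^sub>R t))) \<le> norm (fourier f t)" for i
      using mult_left_mono[OF norm_gaussian_le norm_ge_zero] by (intro AE_I2) (simp add: norm_mult)
  qed measurable
  then have lim1: "I \<longlonglongrightarrow> fourier (fourier f) y" by (simp add: fourier_schwartz_eq[OF F])
  have I_eq: "I i = c * (LINT z|lborel. f (- y + r i *\<^sub>R z) * gaussian z)" for i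
  proof -
    let ?g = "\<lambda>t. fchar t y * gaussian (r i *\<^sub>R t)"
    define k where "k = complex_of_real (\<bar>r i\<bar> ^ CARD('n))"
    have k: "k \<noteq> 0" using r by (simp add: k_def)
    have g: "?g \<in> schwartz" by (rule schwartz_mult_fchar(1)[OF gaussian_scaled_schwartz[OF r(1)]])
    \<comment> \<open>The substitution \<open>z = r i t\<close> in the transform of the Gaussian;
      \<open>k\<close> is its Jacobian.\<close>
    have Fg: "k * fourier ?g x = c * gaussian ((1 / r i) *\<^sub>R (x + y))" for x
    proof -
      have "c * gaussian ((1 / r i) *\<^sub>R (x + y)) = fourier gaussian ((1 / r i) *\<^sub>R (x + y))"
        by (simp add: fourier_gaussian c_def)
      also have "\<dots> = (LINT z|lborel. gaussian z * fchar z ((1 / r i) *\<^sub>R (x + y)))"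
        by (rule fourier_schwartz_eq[OF gaussian_schwartz])
      also have "\<dots> = k * (LINT t|lborel. gaussian (0 + r i *\<^sub>R t) * fchar (0 + r i *\<^sub>R t) ((1 / r i) *\<^sub>R (x + y)))"
        unfolding k_def by (rule lborel_affine_eq) (use r in measurable)
      also have "(\<lambda>t. gaussian (0 + r i *\<^sub>R t) * fchar (0 + r i *\<^sub>R t) ((1 / r i) *\<^sub>R (x + y))) = (\<lambda>t. ?g t * fchar t x)"
        using r by (auto simp: fchar_def fun_eq_iff inner_add_right algebra_simps simp flip: exp_add)
      also have "(LINT t|lborel. ?g t * fchar t x) = fourier ?g x" by (rule fourier_schwartz_eq[OF g, symmetric])
      finally show ?thesis by simp
    qed
    have "k * I i = k * (LINT x|lborel. f x * fourier ?g x)"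
      unfolding I_def fourier_multiplication[OF f g] ..
    also have "\<dots> = (LINT x|lborel. f x * (k * fourier ?g x))"
      by (simp only: mult.left_commute integral_mult_right_zero)
    also have "\<dots> = (LINT x|lborel. f x * (c * gaussian ((1 / r i) *\<^sub>R (x + y))))" by (simp only: Fg)
    also have "\<dots> = k * (LINT z|lborel. f (- y + r i *\<^sub>R z) * (c * gaussian ((1 / r i) *\<^sub>R (- y + r i *\<^sub>R z + y))))"
      unfolding k_def by (rule lborel_affine_eq) (use r in measurable)
    also have "\<dots> = k * (c * (LINT z|lborel. f (- y + r i *\<^sub>R z) * gaussian z))"
      using r by (simp add: mult.left_commute)
    finally show ?thesis using k by simp
  qed
  obtain B where B: "\<And>x. norm (f x) \<le> B" using schwartz_bound[OF f, of 0] by auto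
  have "(\<lambda>i. LINT z|lborel. f (- y + r i *\<^sub>R z) * gaussian z) \<longlonglongrightarrow> (LINT z::real^'n|lborel. f (- y) * gaussian z)"
  proof (rule integral_dominated_convergence)
    show "integrable lborel (\<lambda>z::real^'n. B * norm (gaussian z))"
      by (intro integrable_mult_right integrable_norm schwartz_integrable gaussian_schwartz)
    show "AE z in lborel. (\<lambda>i. f (- y + r i *\<^sub>R z) * gaussian z) \<longlonglongrightarrow> f (- y) * gaussian z"
    proof (intro AE_I2 tendsto_mult_right)
      fix z
      have "(\<lambda>i. - y + r i *\<^sub>R z) \<longlonglongrightarrow> - y + 0 *\<^sub>R z"
        using LIMSEQ_inverse_real_of_nat unfolding r_def inverse_eq_divide by (intro tendsto_intros)
      moreover have "isCont f (- y + 0 *\<^sub>R z)"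
        using schwartz_continuous[OF f, of UNIV] by (simp add: continuous_on_eq_continuous_at)
      ultimately have "(\<lambda>i. f (- y + r i *\<^sub>R z)) \<longlonglongrightarrow> f (- y + 0 *\<^sub>R z)" by (rule isCont_tendsto_compose[rotated])
      then show "(\<lambda>i. f (- y + r i *\<^sub>R z)) \<longlonglongrightarrow> f (- y)" by simp
    qed
    show "AE z in lborel. norm (f (- y + r i *\<^sub>R z) * gaussian z) \<le> B * norm (gaussian z)" for i
      by (simp add: norm_mult mult_right_mono B)
  qed measurable
  then have "I \<longlonglongrightarrow> c * (LINT z::real^'n|lborel. f (- y) * gaussian z)"
    unfolding I_eq[abs_def] by (rule tendsto_mult_left)
  then have "I \<longlonglongrightarrow> c\<^sup>2 * f (- y)"
    by (simp add: c_def gaussian_mass_def power2_eq_square ac_simps)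
  then show ?thesis using LIMSEQ_unique[OF lim1] c_def by blast
qed

section \<open>Functions determined by their integrals against Schwartz functions\<close>

text \<open>Integrate the averages against \<open>b\<close>, swap the integrals, and let the Gaussian kernel concentrate.\<close>

lemma gaussian_averages_zero:
  fixes H :: "real^'n::finite \<Rightarrow> complex" and b :: "real^'n \<Rightarrow> real"
  assumes H: "integrable lborel H"
    and avg: "\<And>i y. (LINT x|lborel. H x * gaussian (real (Suc i) *\<^sub>R (y - x))) = 0"
    and b: "continuous_on UNIV b" "\<And>x. \<bar>b x\<bar> \<le> B"
  shows "(LINT x|lborel. H x * of_real (b x)) = 0"
proof -
  define r where "r i = 1 / real (Suc i)" for i
  have r: "r i \<noteq> 0" "r i > 0" for i by (simp_all add: r_def)
  let ?G = "gaussian :: real^'n \<Rightarrow> complex"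
  have [measurable]: "?G \<in> borel_measurable borel" by (intro schwartz_measurable gaussian_schwartz)
  have [measurable]: "H \<in> borel_measurable borel" using borel_measurable_integrable[OF H] by simp
  have [measurable]: "b \<in> borel_measurable borel" using b by (intro borel_measurable_continuous_onI)
  have B: "B \<ge> 0" using order_trans[OF abs_ge_zero b(2)] .
  \<comment> \<open>\<open>A i\<close> is \<open>b\<close> smoothed by a Gaussian of width
    \<open>r i\<close>; it tends boundedly to \<open>gaussian_mass\<close> times
    \<open>b\<close>.\<close>
  define A where "A i x = (LINT z|lborel. ?G z * of_real (b (x + r i *\<^sub>R z)))" for i x
  have int_G: "integrable lborel (\<lambda>z. B * norm (?G z))"
    by (intro integrable_mult_right integrable_norm schwartz_integrable gaussian_schwartz)
  have Gb_bound: "norm (?G z * of_real (b w)) \<le> B * norm (?G z)" for z w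
    using b(2)[of w] by (simp add: norm_mult mult.commute mult_right_mono)
  have A_bound: "norm (A i x) \<le> (LINT z|lborel. B * norm (?G z))" for i x
  proof -
    have "norm (A i x) \<le> (LINT z|lborel. norm (?G z * of_real (b (x + r i *\<^sub>R z))))"
      unfolding A_def by (rule integral_norm_bound)
    also have "\<dots> \<le> (LINT z|lborel. B * norm (?G z))"
      by (intro integral_mono integrable_norm Gb_bound int_G Bochner_Integration.integrable_bound[OF int_G])
        (auto intro!: order_trans[OF Gb_bound abs_ge_self])
    finally show ?thesis .
  qed
  have A_meas [measurable]: "A i \<in> borel_measurable borel" for i unfolding A_def by measurable
  have A_lim: "(\<lambda>i. A i x) \<longlonglongrightarrow> gaussian_mass TYPE('n) * of_real (b x)" for x
  proof -
    have "(\<lambda>i. A i x) \<longlonglongrightarrow> (LINT z|lborel. ?G z * of_real (b x))"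
      unfolding A_def
    proof (rule integral_dominated_convergence[OF _ _ int_G])
      show "AE z in lborel. (\<lambda>i. ?G z * of_real (b (x + r i *\<^sub>R z))) \<longlonglongrightarrow> ?G z * of_real (b x)"
      proof (intro AE_I2 tendsto_mult_left tendsto_of_real)
        fix z
        have "(\<lambda>i. x + r i *\<^sub>R z) \<longlonglongrightarrow> x + 0 *\<^sub>R z"
          using LIMSEQ_inverse_real_of_nat unfolding r_def inverse_eq_divide by (intro tendsto_intros)
        moreover have "isCont b (x + 0 *\<^sub>R z)" using b(1) by (simp add: continuous_on_eq_continuous_at)
        ultimately have "(\<lambda>i. b (x + r i *\<^sub>R z)) \<longlonglongrightarrow> b (x + 0 *\<^sub>R z)" by (rule isCont_tendsto_compose[rotated])
        then show "(\<lambda>i. b (x + r i *\<^sub>R z)) \<longlonglongrightarrow> b x" by simp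
      qed
    qed (auto simp: Gb_bound)
    then show ?thesis by (simp add: gaussian_mass_def)
  qed
  have zero: "(LINT x|lborel. H x * A i x) = 0" for i
  proof -
    define k where "k = complex_of_real (\<bar>r i\<bar> ^ CARD('n))"
    have k: "k \<noteq> 0" using r by (simp add: k_def)
    let ?n = "real (Suc i)"
    have scaled: "?n *\<^sub>R (x + r i *\<^sub>R z - x) = z" for x z :: "real^'n" by (simp add: r_def flip: of_nat_Suc)
    have kA: "k * A i x = (LINT y|lborel. ?G (?n *\<^sub>R (y - x)) * of_real (b y))" for x
    proof -
      have "(LINT y|lborel. ?G (?n *\<^sub>R (y - x)) * of_real (b y))
         = k * (LINT z|lborel. ?G (?n *\<^sub>R (x + r i *\<^sub>R z - x)) * of_real (b (x + r i *\<^sub>R z)))"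
        unfolding k_def by (rule lborel_affine_eq) (use r in measurable)
      then show ?thesis by (simp only: scaled A_def)
    qed
    have int_y: "integrable lborel (\<lambda>y. ?G (?n *\<^sub>R (y - x)) * of_real (b y))" for x
    proof -
      have "integrable lborel (\<lambda>y. ?G (- ?n *\<^sub>R x + ?n *\<^sub>R y))"
        by (rule lborel_affine_integrable[OF schwartz_integrable[OF gaussian_schwartz]]) simp
      then have "integrable lborel (\<lambda>y. B * norm (?G (?n *\<^sub>R (y - x))))"
        by (simp add: algebra_simps)
      then show ?thesis
        by (rule Bochner_Integration.integrable_bound) (auto intro!: order_trans[OF Gb_bound abs_ge_self])
    qed
    \<comment> \<open>Absolute integrability holds because the inner integral over \<open>y\<close>
      is bounded by a multiple of \<open>|H x|\<close> with a factor independent of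
      \<open>x\<close>.\<close>
    have fub: "integrable (lborel \<Otimes>\<^sub>M lborel) (\<lambda>(x, y). H x * (?G (?n *\<^sub>R (y - x)) * of_real (b y)))"
    proof (rule lborel_pair.Fubini_integrable)
      show "(\<lambda>(x, y). H x * (?G (?n *\<^sub>R (y - x)) * of_real (b y))) \<in> borel_measurable (lborel \<Otimes>\<^sub>M lborel)" by measurable
      show "AE x in lborel. integrable lborel (\<lambda>y. case (x, y) of (x, y) \<Rightarrow> H x * (?G (?n *\<^sub>R (y - x)) * of_real (b y)))"
        using integrable_mult_right[OF int_y] by simp
      show "integrable lborel (\<lambda>x. LINT y|lborel. norm (case (x, y) of (x, y) \<Rightarrow> H x * (?G (?n *\<^sub>R (y - x)) * of_real (b y))))"
      proof (rule Bochner_Integration.integrable_bound)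
        show "integrable lborel (\<lambda>x. (LINT z|lborel. B * norm (?G z)) * (\<bar>r i\<bar> ^ CARD('n)) * norm (H x))"
          using H by simp
        show "AE x in lborel. norm (LINT y|lborel. norm (case (x, y) of (x, y) \<Rightarrow> H x * (?G (?n *\<^sub>R (y - x)) * of_real (b y))))
           \<le> norm ((LINT z|lborel. B * norm (?G z)) * (\<bar>r i\<bar> ^ CARD('n)) * norm (H x))"
        proof (rule AE_I2)
          fix x
          have "complex_of_real (LINT y|lborel. norm (?G (?n *\<^sub>R (y - x)) * of_real (b y)))
             = (LINT y|lborel. complex_of_real (norm (?G (?n *\<^sub>R (y - x)) * of_real (b y))))"
            by (rule integral_complex_of_real[symmetric])
          also have "\<dots> = k * (LINT z|lborel. complex_of_real (norm (?G (?n *\<^sub>R (x + r i *\<^sub>R z - x)) * of_real (b (x + r i *\<^sub>R z)))))"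
            unfolding k_def by (rule lborel_affine_eq) (use r in measurable)
          finally have eq: "(LINT y|lborel. norm (?G (?n *\<^sub>R (y - x)) * of_real (b y)))
              = \<bar>r i\<bar> ^ CARD('n) * (LINT z|lborel. norm (?G z * of_real (b (x + r i *\<^sub>R z))))"
            unfolding k_def integral_complex_of_real scaled by (simp only: of_real_mult[symmetric] of_real_eq_iff)
          have le: "(LINT z|lborel. norm (?G z * of_real (b (x + r i *\<^sub>R z)))) \<le> (LINT z|lborel. B * norm (?G z))"
            using Gb_bound int_G
            by (intro integral_mono integrable_norm Bochner_Integration.integrable_bound[OF int_G])
              (auto intro!: order_trans[OF Gb_bound abs_ge_self])
          have "(LINT y|lborel. norm (?G (?n *\<^sub>R (y - x)) * of_real (b y))) \<le> (LINT z|lborel. B * norm (?G z)) * \<bar>r i\<bar> ^ CARD('n)"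
            unfolding eq by (subst mult.commute, rule mult_right_mono[OF le]) simp
          then have "norm (H x) * (LINT y|lborel. norm (?G (?n *\<^sub>R (y - x)) * of_real (b y)))
             \<le> norm (H x) * ((LINT z|lborel. B * norm (?G z)) * \<bar>r i\<bar> ^ CARD('n))"
            by (rule mult_left_mono) simp
          moreover have "(LINT y|lborel. norm (case (x, y) of (x, y) \<Rightarrow> H x * (?G (?n *\<^sub>R (y - x)) * of_real (b y))))
             = norm (H x) * (LINT y|lborel. norm (?G (?n *\<^sub>R (y - x)) * of_real (b y)))"
            unfolding prod.case norm_mult[of "H x"] by simp
          moreover have "0 \<le> (LINT y|lborel. norm (?G (?n *\<^sub>R (y - x)) * of_real (b y)))" by simp
          ultimately show "norm (LINT y|lborel. norm (case (x, y) of (x, y) \<Rightarrow> H x * (?G (?n *\<^sub>R (y - x)) * of_real (b y))))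
             \<le> norm ((LINT z|lborel. B * norm (?G z)) * (\<bar>r i\<bar> ^ CARD('n)) * norm (H x))"
            by (smt (verit) mult.commute mult_nonneg_nonneg norm_ge_zero real_norm_def)
        qed
      qed measurable
    qed
    have "k * (LINT x|lborel. H x * A i x) = (LINT x|lborel. H x * (k * A i x))"
      by (simp only: mult.left_commute[of _ k] integral_mult_right_zero)
    also have "\<dots> = (LINT x|lborel. LINT y|lborel. H x * (?G (?n *\<^sub>R (y - x)) * of_real (b y)))"
      by (simp only: kA integral_mult_right_zero)
    also have "\<dots> = (LINT y|lborel. LINT x|lborel. H x * (?G (?n *\<^sub>R (y - x)) * of_real (b y)))"
      by (rule lborel_pair.Fubini_integral[OF fub, symmetric])
    also have "\<dots> = (LINT y|lborel. (LINT x|lborel. H x * ?G (?n *\<^sub>R (y - x))) * of_real (b y))"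
      by (simp add: mult.assoc[symmetric])
    also have "\<dots> = 0" by (simp only: avg mult_zero_left integral_zero)
    finally show ?thesis using k by simp
  qed
  have "(\<lambda>i. LINT x|lborel. H x * A i x) \<longlonglongrightarrow> (LINT x|lborel. H x * (gaussian_mass TYPE('n) * of_real (b x)))"
  proof (rule integral_dominated_convergence)
    show "integrable lborel (\<lambda>x. norm (H x) * (LINT z|lborel. B * norm (?G z)))" using H by simp
    show "AE x in lborel. (\<lambda>i. H x * A i x) \<longlonglongrightarrow> H x * (gaussian_mass TYPE('n) * of_real (b x))"
      by (intro AE_I2 tendsto_mult_left A_lim)
    show "AE x in lborel. norm (H x * A i x) \<le> norm (H x) * (LINT z|lborel. B * norm (?G z))" for i
      unfolding norm_mult by (intro AE_I2 mult_left_mono A_bound) simp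
  qed measurable
  then have "(LINT x|lborel. H x * (gaussian_mass TYPE('n) * of_real (b x))) = 0"
    unfolding zero using LIMSEQ_unique tendsto_const by blast
  then show ?thesis
    unfolding mult.left_commute[of _ "gaussian_mass TYPE('n)"] integral_mult_right_zero
    using gaussian_mass_nonzero[where 'n='n] by simp
qed

text \<open>The sets over which \<open>H\<close> has integral zero form a Dynkin system; the closed
  sets are an intersection-stable generator, and their indicators are limits of continuous functions
  with values in \<open>[0, 1]\<close>.\<close>

lemma integrable_zero_AE:
  fixes H :: "real^'n::finite \<Rightarrow> complex"
  assumes H: "integrable lborel H"
    and b: "\<And>b::real^'n \<Rightarrow> real. continuous_on UNIV b \<Longrightarrow> (\<And>x. \<bar>b x\<bar> \<le> 1) \<Longrightarrow> (LINT x|lborel. H x * of_real (b x)) = 0"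
  shows "AE x in lborel. H x = 0"
proof (rule sigma_finite_measure.density_zero[OF sigma_finite_lborel H])
  fix A :: "(real^'n) set" assume "A \<in> sets lborel"
  then have A: "A \<in> sigma_sets UNIV (Collect closed)"
    by (simp add: borel_eq_closed)
  have H': "integrable lborel (\<lambda>x. indicator A x *\<^sub>R H x)" if "A \<in> sets borel" for A
    by (rule integrable_mult_indicator[OF _ H]) (use that in simp)
  have sb: "A \<in> sigma_sets UNIV (Collect closed) \<Longrightarrow> A \<in> sets borel" for A :: "(real^'n) set"
    by (simp add: borel_eq_closed)
  have [measurable]: "H \<in> borel_measurable borel" using borel_measurable_integrable[OF H] by simp
  have Int: "Int_stable (Collect closed :: (real^'n) set set)" "Collect closed \<subseteq> Pow (UNIV :: (real^'n) set)"
    by (auto simp: Int_stable_def)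
  show "set_lebesgue_integral lborel A H = 0"
    using Int A unfolding set_lebesgue_integral_def
  proof (induction A rule: sigma_sets_induct_disjoint)
    case (basic C)
    then have C: "closed C" by simp
    show ?case
    \<comment> \<open>The empty set is separated off because \<open>infdist\<close> to it is 0 by
      convention, which would make the cutoffs \<open>b\<close> constantly 1.\<close>
    proof (cases "C = {}")
      case False
      define b where "b i x = max 0 (1 - real i * infdist x C)" for i x
      have "(\<lambda>i. LINT x|lborel. H x * of_real (b i x)) \<longlonglongrightarrow> (LINT x|lborel. indicator C x *\<^sub>R H x)"
      proof (rule integral_dominated_convergence)
        show "integrable lborel (\<lambda>x. norm (H x))" using H by simp
        show "AE x in lborel. norm (H x * of_real (b i x)) \<le> norm (H x)" for i
        proof (rule AE_I2)
          fix x
          have "\<bar>b i x\<bar> \<le> 1" using infdist_nonneg[of x C] by (auto simp: b_def)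
          then show "norm (H x * of_real (b i x)) \<le> norm (H x)" by (simp add: norm_mult mult_left_le)
        qed
        show "AE x in lborel. (\<lambda>i. H x * of_real (b i x)) \<longlonglongrightarrow> indicator C x *\<^sub>R H x"
        proof (rule AE_I2)
          fix x
          show "(\<lambda>i. H x * of_real (b i x)) \<longlonglongrightarrow> indicator C x *\<^sub>R H x"
          proof (cases "x \<in> C")
            case True
            then have "b i x = 1" for i by (simp add: b_def)
            then show ?thesis using True by simp
          next
            case F: False
            then have pos: "infdist x C > 0"
              using infdist_pos_not_in_closed[OF C \<open>C \<noteq> {}\<close>] by simp
            obtain N :: nat where N: "1 / infdist x C < N" using reals_Archimedean2 by blast
            have "b i x = 0" if "i \<ge> N" for i
            proof -
              have "1 < real N * infdist x C" using N pos by (simp add: pos_divide_less_eq)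
              also have "\<dots> \<le> real i * infdist x C" using that pos by (intro mult_right_mono) auto
              finally show ?thesis by (simp add: b_def)
            qed
            then have "\<forall>\<^sub>F i in sequentially. H x * of_real (b i x) = indicator C x *\<^sub>R H x"
              using F by (auto simp: eventually_sequentially)
            then show ?thesis by (rule tendsto_eventually)
          qed
        qed
        have [measurable]: "b i \<in> borel_measurable borel" for i
          unfolding b_def by (intro borel_measurable_continuous_onI continuous_intros)
        show "(\<lambda>x. H x * of_real (b i x)) \<in> borel_measurable lborel" for i by measurable
        show "(\<lambda>x. indicator C x *\<^sub>R H x) \<in> borel_measurable lborel"
          using borel_closed[OF C] by (intro borel_measurable_scaleR borel_measurable_indicator) auto
      qed
      moreover have "(LINT x|lborel. H x * of_real (b i x)) = 0" for i
      proof (rule b)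
        show "continuous_on UNIV (b i)" unfolding b_def by (intro continuous_intros)
        show "\<bar>b i x\<bar> \<le> 1" for x using infdist_nonneg[of x C] by (auto simp: b_def)
      qed
      ultimately show ?thesis using LIMSEQ_unique[OF _ tendsto_const] by simp
    qed simp
  next
    case (compl C)
    have "(LINT x|lborel. indicator (UNIV - C) x *\<^sub>R H x) = (LINT x|lborel. H x - indicator C x *\<^sub>R H x)"
      by (intro Bochner_Integration.integral_cong) (auto simp: indicator_def)
    also have "\<dots> = (LINT x|lborel. H x) - (LINT x|lborel. indicator C x *\<^sub>R H x)"
      using H H'[OF sb[OF compl(1)]] by simp
    also have "(LINT x|lborel. H x) = 0" using b[of "\<lambda>_. 1"] by simp
    finally show ?case using compl by simp
  next
    case (union C)
    have "(LINT x:(\<Union>i. C i)|lborel. H x) = (\<Sum>i. LINT x:C i|lborel. H x)"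
    proof (rule lebesgue_integral_countable_add)
      show "C i \<in> sets lborel" for i using union(2) sb by auto
      show "i \<noteq> j \<Longrightarrow> C i \<inter> C j = {}" for i j using union(1) by (auto simp: disjoint_family_on_def)
      show "set_integrable lborel (\<Union>i. C i) H"
        unfolding set_integrable_def using union(2) sb by (intro H') auto
    qed
    then show ?case using union(3) unfolding set_lebesgue_integral_def by simp
  qed simp
qed

lemma lebesgue_borel_representative:
  fixes h :: "'a::euclidean_space \<Rightarrow> complex"
  assumes "h \<in> borel_measurable lebesgue"
  obtains h' where "h' \<in> borel_measurable borel" "AE x in lebesgue. h x = h' x"
proof -
  have "(\<lambda>x. Re (h x)) \<in> borel_measurable lebesgue" "(\<lambda>x. Im (h x)) \<in> borel_measurable lebesgue"
    using assms by measurable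
  then obtain a b where a: "a \<in> borel_measurable lborel" "AE x in lborel. Re (h x) = a x"
    and b: "b \<in> borel_measurable lborel" "AE x in lborel. Im (h x) = b x"
    using completion_ex_borel_measurable_real by blast
  have "AE x in lborel. h x = Complex (a x) (b x)"
    using a(2) b(2) by eventually_elim (simp add: complex_eq_iff)
  then have "AE x in lebesgue. h x = Complex (a x) (b x)" by (rule AE_completion)
  moreover have "(\<lambda>x. Complex (a x) (b x)) \<in> borel_measurable borel"
    using a(1) b(1) by (simp add: borel_measurable_complex_iff)
  ultimately show ?thesis using that by blast
qed

text \<open>Tested against these functions, a function shows the averages of its product with
  \<open>gaussian\<close> over translated and rescaled Gaussians.\<close>

lemma gaussian_product_schwartz:
  fixes y :: "real^'n::finite"
  assumes "n > 0"
  shows "(\<lambda>x. gaussian x * gaussian (n *\<^sub>R (y - x))) \<in> schwartz"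
proof -
  have "(\<lambda>x. gaussian x * gaussian (n *\<^sub>R (y - x)))
     = (\<lambda>x. gaussian (n *\<^sub>R y) * complex_of_real (exp (- (pi + pi * n\<^sup>2) * (x \<bullet> x) + ((2 * pi * n\<^sup>2) *\<^sub>R y) \<bullet> x)))"
  proof
    fix x
    have "- pi * (x \<bullet> x) + - pi * ((n *\<^sub>R (y - x)) \<bullet> (n *\<^sub>R (y - x)))
       = - pi * ((n *\<^sub>R y) \<bullet> (n *\<^sub>R y)) + (- (pi + pi * n\<^sup>2) * (x \<bullet> x) + ((2 * pi * n\<^sup>2) *\<^sub>R y) \<bullet> x)"
      by (simp add: inner_diff inner_commute[of y x] algebra_simps power2_eq_square)
    then show "gaussian x * gaussian (n *\<^sub>R (y - x))
       = gaussian (n *\<^sub>R y) * complex_of_real (exp (- (pi + pi * n\<^sup>2) * (x \<bullet> x) + ((2 * pi * n\<^sup>2) *\<^sub>R y) \<bullet> x))"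
      unfolding gaussian_def of_real_mult[symmetric] exp_add[symmetric] by (simp only:)
  qed
  moreover have "0 < pi + pi * n\<^sup>2" by (intro add_pos_nonneg) auto
  ultimately show ?thesis by (simp only: schwartz_scale[OF schwartz_gaussian])
qed

text \<open>\<open>h\<close> need not be integrable. Multiplying by the nowhere vanishing
  \<open>gaussian\<close> makes it so, and the averages of the product over Gaussians are again
  integrals of \<open>h\<close> against Schwartz functions.\<close>

lemma lebesgue_orthogonal_schwartz:
  fixes h :: "real^'n::finite \<Rightarrow> complex"
  assumes h: "h \<in> borel_measurable lebesgue"
    and int: "\<And>\<phi>. \<phi> \<in> schwartz \<Longrightarrow> integrable lebesgue (\<lambda>x. h x * \<phi> x)"
    and zero: "\<And>\<phi>. \<phi> \<in> schwartz \<Longrightarrow> (LINT x|lebesgue. h x * \<phi> x) = 0"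
  shows "AE x in lebesgue. h x = 0"
proof -
  obtain h' where h': "h' \<in> borel_measurable borel" and eq: "AE x in lebesgue. h x = h' x"
    using lebesgue_borel_representative[OF h] .
  have I: "integrable lborel (\<lambda>x. h' x * \<phi> x) \<and> (LINT x|lborel. h' x * \<phi> x) = 0" if "\<phi> \<in> schwartz" for \<phi>
  proof -
    have m: "(\<lambda>x. h' x * \<phi> x) \<in> borel_measurable lborel"
      using h' schwartz_measurable[OF that] by measurable
    have e: "AE x in lebesgue. h x * \<phi> x = h' x * \<phi> x" using eq by eventually_elim simp
    have m1: "(\<lambda>x. h x * \<phi> x) \<in> borel_measurable lebesgue" using int[OF that] by (rule borel_measurable_integrable)
    have m2: "(\<lambda>x. h' x * \<phi> x) \<in> borel_measurable lebesgue" using m by (rule measurable_completion)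
    have "integrable lebesgue (\<lambda>x. h' x * \<phi> x)"
      using int[OF that] integrable_cong_AE[OF m1 m2 e] by blast
    moreover have "(LINT x|lebesgue. h' x * \<phi> x) = 0"
      using zero[OF that] integral_cong_AE[OF m1 m2 e] by simp
    ultimately show ?thesis using integrable_completion[OF m] integral_completion[OF m] by simp
  qed
  have "AE x in lborel. h' x * gaussian x = 0"
  proof (rule integrable_zero_AE)
    show "integrable lborel (\<lambda>x. h' x * gaussian x)" using I[OF gaussian_schwartz] by blast
    then show "(LINT x|lborel. h' x * gaussian x * of_real (b x)) = 0"
      if "continuous_on UNIV b" "\<And>x. \<bar>b x\<bar> \<le> 1" for b :: "real^'n \<Rightarrow> real"
    proof (rule gaussian_averages_zero[OF _ _ that])
      show "(LINT x|lborel. h' x * gaussian x * gaussian (real (Suc i) *\<^sub>R (y - x))) = 0" for i y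
        using I[OF gaussian_product_schwartz[of "real (Suc i)" y]] by (simp add: mult.assoc del: of_nat_Suc)
    qed
  qed
  then have "AE x in lborel. h' x = 0" by eventually_elim (simp add: gaussian_def)
  then have "AE x in lebesgue. h' x = 0" by (rule AE_completion)
  with eq show ?thesis by eventually_elim simp
qed

lemma representsD:
  assumes "represents h f"
  shows "h \<in> borel_measurable lebesgue"
    and "\<phi> \<in> schwartz \<Longrightarrow> integrable lebesgue (\<lambda>x. h x * \<phi> x)"
    and "\<phi> \<in> schwartz \<Longrightarrow> f \<phi> = (LINT x|lebesgue. h x * \<phi> x)"
  using assms by (simp_all add: represents_def)

lemma represents_unique:
  fixes h1 h2 :: "real^'n::finite \<Rightarrow> complex"
  assumes h1: "represents h1 f" and h2: "represents h2 f"
  shows "AE x in lebesgue. h1 x = h2 x"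
proof -
  have I: "integrable lebesgue (\<lambda>x. h1 x * \<phi> x)" "integrable lebesgue (\<lambda>x. h2 x * \<phi> x)"
    "(LINT x|lebesgue. h1 x * \<phi> x) = (LINT x|lebesgue. h2 x * \<phi> x)" if "\<phi> \<in> schwartz" for \<phi>
  proof -
    show "integrable lebesgue (\<lambda>x. h1 x * \<phi> x)" using representsD(2)[OF h1 that] .
    show "integrable lebesgue (\<lambda>x. h2 x * \<phi> x)" using representsD(2)[OF h2 that] .
    show "(LINT x|lebesgue. h1 x * \<phi> x) = (LINT x|lebesgue. h2 x * \<phi> x)"
      using representsD(3)[OF h1 that] representsD(3)[OF h2 that] by (rule subst)
  qed
  note m = representsD(1)[OF h1] representsD(1)[OF h2]
  have "AE x in lebesgue. h1 x - h2 x = 0"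
    by (rule lebesgue_orthogonal_schwartz) (use I m in \<open>simp_all add: left_diff_distrib\<close>)
  then show ?thesis by simp
qed

section \<open>Square integrable functions\<close>

lemma cmod_add_square_le: "(cmod (a + b))\<^sup>2 \<le> 2 * (cmod a)\<^sup>2 + 2 * (cmod b)\<^sup>2"
proof -
  have "(cmod (a + b))\<^sup>2 \<le> (cmod a + cmod b)\<^sup>2" by (intro power_mono norm_triangle_ineq) simp
  also have "\<dots> \<le> 2 * (cmod a)\<^sup>2 + 2 * (cmod b)\<^sup>2"
    using zero_le_power2[of "cmod a - cmod b"] by (simp add: power2_eq_square algebra_simps)
  finally show ?thesis .
qed

lemma borel_measurable_cnj [measurable (raw)]:
  "f \<in> borel_measurable M \<Longrightarrow> (\<lambda>x. cnj (f x)) \<in> borel_measurable M"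
  by (rule measurable_compose[OF _ borel_measurable_continuous_onI[OF continuous_on_cnj[OF continuous_on_id]]])

text \<open>The measure is a parameter because completeness is used twice: for Lebesgue measure in
  the Sobolev space and for counting measure in the sequence space.\<close>

definition square_integrable :: "'a measure \<Rightarrow> ('a \<Rightarrow> complex) \<Rightarrow> bool" where
  "square_integrable M u \<longleftrightarrow> u \<in> borel_measurable M \<and> integrable M (\<lambda>x. (cmod (u x))\<^sup>2)"

lemma square_integrable_add:
  assumes "square_integrable M u" "square_integrable M v"
  shows "square_integrable M (\<lambda>x. u x + v x)"
  unfolding square_integrable_def
proof
  have [measurable]: "u \<in> borel_measurable M" "v \<in> borel_measurable M"
    using assms by (auto simp: square_integrable_def)
  show "(\<lambda>x. u x + v x) \<in> borel_measurable M" by measurable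
  show "integrable M (\<lambda>x. (cmod (u x + v x))\<^sup>2)"
  proof (rule Bochner_Integration.integrable_bound)
    show "integrable M (\<lambda>x. 2 * (cmod (u x))\<^sup>2 + 2 * (cmod (v x))\<^sup>2)"
      using assms by (auto simp: square_integrable_def)
  qed (auto intro!: AE_I2 cmod_add_square_le)
qed

lemma square_integrable_scale:
  assumes "square_integrable M u" shows "square_integrable M (\<lambda>x. c * u x)"
  using assms by (auto simp: square_integrable_def norm_mult power_mult_distrib)

lemma square_integrable_diff:
  assumes "square_integrable M u" "square_integrable M v"
  shows "square_integrable M (\<lambda>x. u x - v x)"
  using square_integrable_add[OF assms(1) square_integrable_scale[OF assms(2), of "-1"]] by simp

lemma square_integrable_prod:
  assumes "square_integrable M u" "square_integrable M v"
  shows "integrable M (\<lambda>x. u x * cnj (v x))"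
proof (rule Bochner_Integration.integrable_bound)
  have [measurable]: "u \<in> borel_measurable M" "v \<in> borel_measurable M"
    using assms by (auto simp: square_integrable_def)
  show "(\<lambda>x. u x * cnj (v x)) \<in> borel_measurable M" by measurable
  show "integrable M (\<lambda>x. (cmod (u x))\<^sup>2 + (cmod (v x))\<^sup>2)"
    using assms by (auto simp: square_integrable_def)
  have "cmod a * cmod b \<le> (cmod a)\<^sup>2 + (cmod b)\<^sup>2" for a b
  proof -
    have "0 \<le> cmod a * cmod b" by simp
    then show ?thesis using sum_squares_bound[of "cmod a" "cmod b"] by linarith
  qed
  then show "AE x in M. norm (u x * cnj (v x)) \<le> norm ((cmod (u x))\<^sup>2 + (cmod (v x))\<^sup>2)"
    by (intro AE_I2) (simp add: norm_mult)
qed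

lemma square_integrable_cong_AE:
  assumes "square_integrable M u" "v \<in> borel_measurable M" "AE x in M. u x = v x"
  shows "square_integrable M v"
proof -
  have [measurable]: "u \<in> borel_measurable M" "v \<in> borel_measurable M"
    using assms by (auto simp: square_integrable_def)
  have "AE x in M. (cmod (u x))\<^sup>2 = (cmod (v x))\<^sup>2" using assms(3) by eventually_elim simp
  then have "integrable M (\<lambda>x. (cmod (u x))\<^sup>2) \<longleftrightarrow> integrable M (\<lambda>x. (cmod (v x))\<^sup>2)"
    by (intro integrable_cong_AE) measurable
  then show ?thesis using assms by (simp add: square_integrable_def)
qed

text \<open>The terms of the convergent series are bounded by some \<open>B\<close>, so
  \<open>|d k|\<close> is at most \<open>sqrt B\<close> times the geometric sequence with ratio
  \<open>sqrt (1/2)\<close>.\<close>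

lemma summable_of_weighted_squares:
  assumes "summable (\<lambda>k. 2 ^ k * (cmod (d k))\<^sup>2)"
  shows "summable d"
proof -
  obtain B where B: "\<And>k. 2 ^ k * (cmod (d k))\<^sup>2 \<le> B"
  proof -
    obtain B where "\<And>k. norm (2 ^ k * (cmod (d k))\<^sup>2) \<le> B"
      using summable_imp_Bseq[OF assms] unfolding Bseq_def by blast
    then have "2 ^ k * (cmod (d k))\<^sup>2 \<le> B" for k by (metis abs_le_D1 real_norm_def)
    then show ?thesis by (rule that)
  qed
  have B0: "B \<ge> 0" by (rule order_trans[OF _ B[of 0]]) simp
  have bound: "norm (d k) \<le> sqrt B * sqrt (1 / 2) ^ k" for k
  proof -
    have "(cmod (d k))\<^sup>2 \<le> B * (1 / 2) ^ k" using B[of k] by (simp add: field_simps)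
    then have "cmod (d k) \<le> sqrt (B * (1 / 2) ^ k)" by (rule real_le_rsqrt)
    then show ?thesis by (simp add: real_sqrt_mult real_sqrt_power)
  qed
  show ?thesis
  proof (rule summable_comparison_test[OF _ summable_mult])
    show "\<exists>N. \<forall>n\<ge>N. norm (d n) \<le> sqrt B * sqrt (1 / 2) ^ n" using bound by blast
    show "summable (\<lambda>n. sqrt (1 / 2) ^ n)" by (rule summable_geometric) (simp add: real_sqrt_lt_1_iff)
  qed
qed

text \<open>Riesz-Fischer: along a subsequence with \<open>\<parallel>u\<^sub>k\<^sub>+\<^sub>1 - u\<^sub>k\<parallel>\<^sup>2 < 4\<^sup>-\<^sup>k\<close> the sum of \<open>2\<^sup>k |u\<^sub>k\<^sub>+\<^sub>1 - u\<^sub>k|\<^sup>2\<close> is integrable,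
  which gives pointwise convergence; Fatou's lemma does the rest.\<close>

theorem square_integrable_complete:
  fixes u :: "nat \<Rightarrow> 'a \<Rightarrow> complex"
  assumes u: "\<And>m. square_integrable M (u m)"
    and Cauchy: "\<And>e. e > 0 \<Longrightarrow> \<exists>N. \<forall>m\<ge>N. \<forall>k\<ge>N. (LINT x|M. (cmod (u m x - u k x))\<^sup>2) < e"
  shows "\<exists>v. square_integrable M v \<and> (\<lambda>m. LINT x|M. (cmod (u m x - v x))\<^sup>2) \<longlonglongrightarrow> 0"
proof -
  have [measurable]: "u m \<in> borel_measurable M" for m using u by (auto simp: square_integrable_def)
  have int_diff: "integrable M (\<lambda>x. (cmod (u m x - u k x))\<^sup>2)" for m k
    using square_integrable_diff[OF u u] by (auto simp: square_integrable_def)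
  have "\<exists>N. \<forall>k. (\<forall>m\<ge>N k. \<forall>l\<ge>N k. (LINT x|M. (cmod (u m x - u l x))\<^sup>2) < (1 / 4) ^ k) \<and> N k \<le> N (Suc k)"
  proof -
    have "\<exists>N. \<forall>m\<ge>N. \<forall>l\<ge>N. (LINT x|M. (cmod (u m x - u l x))\<^sup>2) < (1 / 4) ^ k" for k
      by (rule Cauchy) simp
    then obtain N0 where N0: "\<And>k m l. m \<ge> N0 k \<Longrightarrow> l \<ge> N0 k \<Longrightarrow> (LINT x|M. (cmod (u m x - u l x))\<^sup>2) < (1 / 4) ^ k" by metis
    show ?thesis
    proof (intro exI allI conjI impI)
      fix k
      \<comment> \<open>Partial sums of the thresholds \<open>N0\<close> are thresholds as well, and
        they increase with \<open>k\<close>.\<close>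
      show "(\<Sum>i\<le>k. N0 i) \<le> (\<Sum>i\<le>Suc k. N0 i)" by simp
      have "N0 k \<le> (\<Sum>i\<le>k. N0 i)" by (rule member_le_sum) auto
      then show "(LINT x|M. (cmod (u m x - u l x))\<^sup>2) < (1 / 4) ^ k" if "m \<ge> (\<Sum>i\<le>k. N0 i)" "l \<ge> (\<Sum>i\<le>k. N0 i)" for m l
        using that by (intro N0) auto
    qed
  qed
  then obtain N where N: "\<And>k m l. m \<ge> N k \<Longrightarrow> l \<ge> N k \<Longrightarrow> (LINT x|M. (cmod (u m x - u l x))\<^sup>2) < (1 / 4) ^ k"
    and N_mono: "\<And>k. N k \<le> N (Suc k)" by blast
  define w where "w k = u (N k)" for k
  define d where "d k x = w (Suc k) x - w k x" for k x
  have [measurable]: "w k \<in> borel_measurable M" "d k \<in> borel_measurable M" for k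
    unfolding w_def d_def by measurable
  have d_int: "integrable M (\<lambda>x. (cmod (d k x))\<^sup>2)" for k unfolding d_def w_def by (rule int_diff)
  \<comment> \<open>Decay by the factor 4 leaves room for the weight \<open>2 ^ k\<close>: the
    weighted squared norms are still summable.\<close>
  have d_norm: "(LINT x|M. (cmod (d k x))\<^sup>2) < (1 / 4) ^ k" for k
    unfolding d_def w_def using N_mono by (intro N) auto
  have "(\<integral>\<^sup>+x. (\<Sum>k. ennreal (2 ^ k * (cmod (d k x))\<^sup>2)) \<partial>M) = (\<Sum>k. \<integral>\<^sup>+x. ennreal (2 ^ k * (cmod (d k x))\<^sup>2) \<partial>M)"
    by (rule nn_integral_suminf) measurable
  also have "\<dots> \<le> (\<Sum>k. ennreal ((1 / 2) ^ k))"
  proof (rule suminf_le)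
    fix k
    have "(\<integral>\<^sup>+x. ennreal (2 ^ k * (cmod (d k x))\<^sup>2) \<partial>M) = ennreal (LINT x|M. 2 ^ k * (cmod (d k x))\<^sup>2)"
      by (rule nn_integral_eq_integral) (use d_int in auto)
    also have "\<dots> \<le> ennreal ((1 / 2) ^ k)"
    proof (rule ennreal_leI)
      have "(LINT x|M. 2 ^ k * (cmod (d k x))\<^sup>2) \<le> 2 ^ k * (1 / 4) ^ k"
        using d_norm[of k] by simp
      also have "\<dots> = (1 / 2) ^ k" by (simp flip: power_mult_distrib)
      finally show "(LINT x|M. 2 ^ k * (cmod (d k x))\<^sup>2) \<le> (1 / 2) ^ k" .
    qed
    finally show "(\<integral>\<^sup>+x. ennreal (2 ^ k * (cmod (d k x))\<^sup>2) \<partial>M) \<le> ennreal ((1 / 2) ^ k)" .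
  qed auto
  also have "\<dots> = ennreal (\<Sum>k. (1 / 2) ^ k)" by (rule suminf_ennreal2) (auto intro: summable_geometric)
  also have "\<dots> < \<infinity>" by simp
  finally have "AE x in M. (\<Sum>k. ennreal (2 ^ k * (cmod (d k x))\<^sup>2)) \<noteq> \<infinity>"
    by (intro nn_integral_noteq_infinite) auto
  then have conv: "AE x in M. convergent (\<lambda>k. w k x)"
  proof eventually_elim
    case (elim x)
    have "summable (\<lambda>k. 2 ^ k * (cmod (d k x))\<^sup>2)"
      by (rule summable_suminf_not_top) (use elim in auto)
    then have "summable (\<lambda>k. d k x)" by (rule summable_of_weighted_squares)
    then have "convergent (\<lambda>n. \<Sum>k<n. d k x)" by (simp add: summable_iff_convergent)
    then have "convergent (\<lambda>n. (\<Sum>k<n. d k x) + w 0 x)" by (intro convergent_add convergent_const)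
    then show ?case by (simp add: d_def sum_lessThan_telescope[of "\<lambda>k. w k x"])
  qed
  define v where "v x = lim (\<lambda>k. w k x)" for x
  have [measurable]: "v \<in> borel_measurable M" unfolding v_def by measurable
  have lim: "AE x in M. (\<lambda>k. w k x) \<longlonglongrightarrow> v x"
    using conv by eventually_elim (simp add: v_def convergent_LIMSEQ_iff)
  \<comment> \<open>Fatou's lemma in \<open>k\<close>: the norms of \<open>u m - w k\<close> are
    controlled by the Cauchy property as soon as \<open>k \<ge> j\<close>.\<close>
  have close: "(\<integral>\<^sup>+x. ennreal ((cmod (u m x - v x))\<^sup>2) \<partial>M) \<le> ennreal ((1 / 4) ^ j)" if m: "m \<ge> N j" for m j
  proof -
    have "(\<integral>\<^sup>+x. ennreal ((cmod (u m x - v x))\<^sup>2) \<partial>M) = (\<integral>\<^sup>+x. liminf (\<lambda>k. ennreal ((cmod (u m x - w k x))\<^sup>2)) \<partial>M)"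
    proof (rule nn_integral_cong_AE)
      show "AE x in M. ennreal ((cmod (u m x - v x))\<^sup>2) = liminf (\<lambda>k. ennreal ((cmod (u m x - w k x))\<^sup>2))"
        using lim
      proof eventually_elim
        case (elim x)
        then have "(\<lambda>k. ennreal ((cmod (u m x - w k x))\<^sup>2)) \<longlonglongrightarrow> ennreal ((cmod (u m x - v x))\<^sup>2)"
          by (intro tendsto_intros)
        then show ?case by (rule lim_imp_Liminf[OF sequentially_bot, symmetric])
      qed
    qed
    also have "\<dots> \<le> liminf (\<lambda>k. \<integral>\<^sup>+x. ennreal ((cmod (u m x - w k x))\<^sup>2) \<partial>M)"
      by (rule nn_integral_liminf) measurable
    also have "\<dots> \<le> ennreal ((1 / 4) ^ j)"
    proof (rule Liminf_le)
      have mono: "N j \<le> N k" if "j \<le> k" for k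
        using that by (rule lift_Suc_mono_le[of N, OF N_mono])
      have "(\<integral>\<^sup>+x. ennreal ((cmod (u m x - w k x))\<^sup>2) \<partial>M) \<le> ennreal ((1 / 4) ^ j)" if "k \<ge> j" for k
      proof -
        have "(\<integral>\<^sup>+x. ennreal ((cmod (u m x - w k x))\<^sup>2) \<partial>M) = ennreal (LINT x|M. (cmod (u m x - w k x))\<^sup>2)"
          unfolding w_def by (rule nn_integral_eq_integral) (use int_diff in auto)
        also have "\<dots> \<le> ennreal ((1 / 4) ^ j)"
          unfolding w_def by (intro ennreal_leI less_imp_le N m mono that)
        finally show ?thesis .
      qed
      then show "\<forall>\<^sub>F k in sequentially. (\<integral>\<^sup>+x. ennreal ((cmod (u m x - w k x))\<^sup>2) \<partial>M) \<le> ennreal ((1 / 4) ^ j)"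
        by (auto simp: eventually_sequentially)
    qed simp
    finally show ?thesis .
  qed
  have sq_diff: "square_integrable M (\<lambda>x. u m x - v x)" if "m \<ge> N 0" for m
    unfolding square_integrable_def
  proof
    show "integrable M (\<lambda>x. (cmod (u m x - v x))\<^sup>2)"
      by (rule integrableI_bounded) (use close[OF that] in \<open>auto simp: ennreal_one_less_top intro: le_less_trans\<close>)
  qed measurable
  \<comment> \<open>\<open>v\<close> itself is recovered as \<open>u (N 0)\<close> minus the
    remainder just shown to be square integrable.\<close>
  have "square_integrable M (\<lambda>x. u (N 0) x - (u (N 0) x - v x))"
    by (intro square_integrable_diff u sq_diff) simp
  then have v: "square_integrable M v" by simp
  have "(\<lambda>m. LINT x|M. (cmod (u m x - v x))\<^sup>2) \<longlonglongrightarrow> 0"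
  proof (rule LIMSEQ_I)
    fix e :: real assume e: "e > 0"
    have "(\<lambda>j. (1 / 4 :: real) ^ j) \<longlonglongrightarrow> 0" by (rule LIMSEQ_power_zero) simp
    then obtain j where j: "(1 / 4 :: real) ^ j < e"
      using e by (metis order_tendstoD(2) eventually_sequentially order_refl)
    show "\<exists>n. \<forall>m\<ge>n. norm ((LINT x|M. (cmod (u m x - v x))\<^sup>2) - 0) < e"
    proof (intro exI allI impI)
      fix m assume m: "m \<ge> N j"
      have "integrable M (\<lambda>x. (cmod (u m x - v x))\<^sup>2)"
        using square_integrable_diff[OF u v] by (simp add: square_integrable_def)
      then have "ennreal (LINT x|M. (cmod (u m x - v x))\<^sup>2) \<le> ennreal ((1 / 4) ^ j)"
        using close[OF m] by (subst nn_integral_eq_integral[symmetric]) auto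
      then have "(LINT x|M. (cmod (u m x - v x))\<^sup>2) \<le> (1 / 4) ^ j" by simp
      moreover have "0 \<le> (LINT x|M. (cmod (u m x - v x))\<^sup>2)" by simp
      ultimately show "norm ((LINT x|M. (cmod (u m x - v x))\<^sup>2) - 0) < e" using j by simp
    qed
  qed
  with v show ?thesis by blast
qed

section \<open>The Sobolev space as a Hilbert space\<close>

lemma mu_pos: "0 < mu s x"
proof -
  have "0 < 1 + (norm x)\<^sup>2" by (simp add: add_pos_nonneg)
  then show ?thesis by (simp add: mu_def)
qed

lemma mu_nonzero: "mu s x \<noteq> 0"
  using mu_pos[of s x] by simp

lemma mu_minus: "mu (- s) x = 1 / mu s x"
  by (simp add: mu_def powr_minus_divide)

lemma mu_measurable [measurable]: "mu s \<in> borel_measurable borel"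
  unfolding mu_def[abs_def] by measurable

text \<open>The absolute value makes one bound serve both signs of \<open>s\<close>; applied to
  \<open>- s\<close> it bounds \<open>1 / mu s\<close>.\<close>

lemma mu_le: "mu s x \<le> (1 + norm x) ^ nat \<lceil>\<bar>s\<bar>\<rceil>"
proof -
  have 1: "1 \<le> 1 + (norm x)\<^sup>2" by simp
  have "mu s x \<le> (1 + (norm x)\<^sup>2) powr (\<bar>s\<bar> / 2)"
    unfolding mu_def by (intro powr_mono) auto
  also have "\<dots> \<le> ((1 + norm x) powr 2) powr (\<bar>s\<bar> / 2)"
    by (intro powr_mono2) (auto simp: power2_sum powr_numeral intro: add_nonneg_nonneg)
  also have "\<dots> = (1 + norm x) powr \<bar>s\<bar>" unfolding powr_powr by simp
  also have "\<dots> \<le> (1 + norm x) powr real (nat \<lceil>\<bar>s\<bar>\<rceil>)"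
    by (intro powr_mono) (auto simp: of_nat_ceiling)
  also have "\<dots> = (1 + norm x) ^ nat \<lceil>\<bar>s\<bar>\<rceil>"
    by (rule powr_realpow) (simp add: add_pos_nonneg)
  finally show ?thesis .
qed

section \<open>Tempered distributions with a function as Fourier transform\<close>

lemma tempered_bound:
  assumes "f \<in> tempered"
  obtains C N where "C \<ge> 0"
    "\<And>M \<phi>. M \<ge> N \<Longrightarrow> \<phi> \<in> schwartz \<Longrightarrow> norm (f \<phi>) \<le> C * (\<Sum>js\<in>{js. length js \<le> M}. schwartz_seminorm M js \<phi>)"
proof -
  obtain C N where C: "\<And>\<phi>. \<phi> \<in> schwartz \<Longrightarrow> norm (f \<phi>) \<le> C * (\<Sum>js\<in>{js. length js \<le> N}. schwartz_seminorm N js \<phi>)"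
    using assms unfolding tempered_def by blast
  \<comment> \<open>Heavier weights increase each seminorm and further derivatives add nonnegative
    terms, so two functionals can be compared at a common order.\<close>
  have "norm (f \<phi>) \<le> \<bar>C\<bar> * (\<Sum>js\<in>{js. length js \<le> M}. schwartz_seminorm M js \<phi>)"
    if M: "M \<ge> N" and \<phi>: "\<phi> \<in> schwartz" for M \<phi>
  proof -
    have fin: "finite {js :: 'a list. length js \<le> k}" for k
      using finite_lists_length_le[of "UNIV :: 'a set" k] by simp
    have "norm (f \<phi>) \<le> \<bar>C\<bar> * (\<Sum>js\<in>{js. length js \<le> N}. schwartz_seminorm N js \<phi>)"
      using C[OF \<phi>] by (rule order_trans) (intro mult_right_mono sum_nonneg schwartz_seminorm_nonneg \<phi>; simp)
    also have "\<dots> \<le> \<bar>C\<bar> * (\<Sum>js\<in>{js. length js \<le> N}. schwartz_seminorm M js \<phi>)"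
      by (intro mult_left_mono sum_mono schwartz_seminorm_mono[OF \<phi> M]) simp
    also have "\<dots> \<le> \<bar>C\<bar> * (\<Sum>js\<in>{js. length js \<le> M}. schwartz_seminorm M js \<phi>)"
      by (intro mult_left_mono sum_mono2 fin schwartz_seminorm_nonneg \<phi>) (use M in auto)
    finally show ?thesis .
  qed
  then show ?thesis using that[of "\<bar>C\<bar>" N] by simp
qed

lemma temperedD:
  assumes "f \<in> tempered"
  shows "\<phi> \<notin> schwartz \<Longrightarrow> f \<phi> = 0"
    and "\<phi> \<in> schwartz \<Longrightarrow> \<psi> \<in> schwartz \<Longrightarrow> f (\<lambda>x. \<phi> x + \<psi> x) = f \<phi> + f \<psi>"
    and "\<phi> \<in> schwartz \<Longrightarrow> f (\<lambda>x. c * \<phi> x) = c * f \<phi>"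
  using assms by (simp_all add: tempered_def)

lemma temperedI:
  assumes "\<And>\<phi>. \<phi> \<notin> schwartz \<Longrightarrow> f \<phi> = 0"
    and "\<And>\<phi> \<psi>. \<phi> \<in> schwartz \<Longrightarrow> \<psi> \<in> schwartz \<Longrightarrow> f (\<lambda>x. \<phi> x + \<psi> x) = f \<phi> + f \<psi>"
    and "\<And>c \<phi>. \<phi> \<in> schwartz \<Longrightarrow> f (\<lambda>x. c * \<phi> x) = c * f \<phi>"
    and "\<And>\<phi>. \<phi> \<in> schwartz \<Longrightarrow> norm (f \<phi>) \<le> C * (\<Sum>js\<in>{js. length js \<le> N}. schwartz_seminorm N js \<phi>)"
  shows "f \<in> tempered"
  unfolding tempered_def using assms by blast

lemma tempered_add:
  assumes f: "f \<in> tempered" and g: "g \<in> tempered" shows "(\<lambda>\<phi>. f \<phi> + g \<phi>) \<in> tempered"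
proof -
  obtain C N where C: "\<And>M \<phi>. M \<ge> N \<Longrightarrow> \<phi> \<in> schwartz \<Longrightarrow> norm (f \<phi>) \<le> C * (\<Sum>js\<in>{js. length js \<le> M}. schwartz_seminorm M js \<phi>)"
    using tempered_bound[OF f] by metis
  obtain D K where D: "\<And>M \<phi>. M \<ge> K \<Longrightarrow> \<phi> \<in> schwartz \<Longrightarrow> norm (g \<phi>) \<le> D * (\<Sum>js\<in>{js. length js \<le> M}. schwartz_seminorm M js \<phi>)"
    using tempered_bound[OF g] by metis
  show ?thesis
  proof (rule temperedI[where C="C + D" and N="max N K"])
    fix \<phi> :: "real^'a \<Rightarrow> complex" assume \<phi>: "\<phi> \<in> schwartz"
    show "norm (f \<phi> + g \<phi>) \<le> (C + D) * (\<Sum>js\<in>{js. length js \<le> max N K}. schwartz_seminorm (max N K) js \<phi>)"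
      using norm_triangle_ineq[of "f \<phi>" "g \<phi>"] C[OF max.cobounded1 \<phi>, of K] D[OF max.cobounded2 \<phi>, of N]
      by (simp add: distrib_right)
  qed (simp_all add: temperedD[OF f] temperedD[OF g] distrib_left)
qed

lemma tempered_scale:
  assumes f: "f \<in> tempered" shows "(\<lambda>\<phi>. c * f \<phi>) \<in> tempered"
proof -
  obtain C N where C: "\<And>M \<phi>. M \<ge> N \<Longrightarrow> \<phi> \<in> schwartz \<Longrightarrow> norm (f \<phi>) \<le> C * (\<Sum>js\<in>{js. length js \<le> M}. schwartz_seminorm M js \<phi>)"
    using tempered_bound[OF f] by metis
  show ?thesis
  proof (rule temperedI[where C="norm c * C" and N=N])
    fix \<phi> :: "real^'a \<Rightarrow> complex" assume \<phi>: "\<phi> \<in> schwartz"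
    show "norm (c * f \<phi>) \<le> (norm c * C) * (\<Sum>js\<in>{js. length js \<le> N}. schwartz_seminorm N js \<phi>)"
      using mult_left_mono[OF C[OF order_refl \<phi>], of "norm c"] by (simp add: norm_mult mult.assoc)
  qed (simp_all add: temperedD[OF f] algebra_simps)
qed

lemma representsI:
  assumes "h \<in> borel_measurable lebesgue"
    and "\<And>\<phi>. \<phi> \<in> schwartz \<Longrightarrow> integrable lebesgue (\<lambda>x. h x * \<phi> x)"
    and "\<And>\<phi>. \<phi> \<in> schwartz \<Longrightarrow> f \<phi> = (LINT x|lebesgue. h x * \<phi> x)"
  shows "represents h f"
  using assms by (simp add: represents_def)

lemma represents_add:
  assumes f: "represents h (fourier_dist f)" and g: "represents k (fourier_dist g)"
  shows "represents (\<lambda>t. h t + k t) (fourier_dist (\<lambda>\<phi>. f \<phi> + g \<phi>))"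
proof (rule representsI)
  show "(\<lambda>t. h t + k t) \<in> borel_measurable lebesgue"
    using representsD(1)[OF f] representsD(1)[OF g] by (rule borel_measurable_add)
  fix \<phi> :: "real^'a \<Rightarrow> complex" assume \<phi>: "\<phi> \<in> schwartz"
  note * = representsD(2,3)[OF f \<phi>] representsD(2,3)[OF g \<phi>]
  show "integrable lebesgue (\<lambda>x. (h x + k x) * \<phi> x)"
    unfolding distrib_right using *(1,3) by (rule Bochner_Integration.integrable_add)
  show "fourier_dist (\<lambda>\<phi>. f \<phi> + g \<phi>) \<phi> = (LINT x|lebesgue. (h x + k x) * \<phi> x)"
    unfolding distrib_right Bochner_Integration.integral_add[OF *(1,3)] *(2)[symmetric] *(4)[symmetric]
    using \<phi> by (simp add: fourier_dist_def)
qed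

lemma represents_scale:
  assumes f: "represents h (fourier_dist f)"
  shows "represents (\<lambda>t. c * h t) (fourier_dist (\<lambda>\<phi>. c * f \<phi>))"
proof (rule representsI)
  show "(\<lambda>t. c * h t) \<in> borel_measurable lebesgue"
    using representsD(1)[OF f] by (intro borel_measurable_times borel_measurable_const)
  fix \<phi> :: "real^'a \<Rightarrow> complex" assume \<phi>: "\<phi> \<in> schwartz"
  note * = representsD(2,3)[OF f \<phi>]
  show "integrable lebesgue (\<lambda>x. (c * h x) * \<phi> x)"
    unfolding mult.assoc using *(1) by (rule integrable_mult_right)
  show "fourier_dist (\<lambda>\<phi>. c * f \<phi>) \<phi> = (LINT x|lebesgue. (c * h x) * \<phi> x)"
    unfolding mult.assoc integral_mult_right_zero *(2)[symmetric]
    using \<phi> by (simp add: fourier_dist_def)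
qed

lemma fourier_fun_eqI:
  assumes "represents h (fourier_dist f)" shows "AE t in lebesgue. fourier_fun f t = h t"
  unfolding fourier_fun_def
  by (rule represents_unique[OF _ assms]) (rule someI[of "\<lambda>h. represents h (fourier_dist f)", OF assms])

text \<open>Its plain L2 pairing is the Sobolev inner product, so the unweighted L2 theory applies
  to it.\<close>

definition weighted_fourier :: "real \<Rightarrow> ((real^'n::finite \<Rightarrow> complex) \<Rightarrow> complex) \<Rightarrow> real^'n \<Rightarrow> complex" where
  "weighted_fourier s f t = fourier_fun f t * complex_of_real (mu s t)"

lemma mu_lebesgue_measurable: "(\<lambda>t. complex_of_real (mu s t)) \<in> borel_measurable lebesgue"
proof -
  have "(\<lambda>t. complex_of_real (mu s t)) \<in> borel_measurable borel" by measurable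
  then show ?thesis by (intro measurable_completion) simp
qed

text \<open>The Sobolev condition asks for some representative of the transform; uniqueness up to
  null sets transfers it to the chosen one, \<open>fourier_fun f\<close>.\<close>

lemma sobolevD:
  assumes "f \<in> sobolev s"
  shows "f \<in> tempered" and "represents (fourier_fun f) (fourier_dist f)"
    and "square_integrable lebesgue (weighted_fourier s f)"
proof -
  obtain h where f: "f \<in> tempered" and h: "represents h (fourier_dist f)"
    and int: "integrable lebesgue (\<lambda>t. (norm (h t * complex_of_real (mu s t)))\<^sup>2)"
    using assms by (auto simp: sobolev_def)
  show "f \<in> tempered" by fact
  show r: "represents (fourier_fun f) (fourier_dist f)"
    unfolding fourier_fun_def by (rule someI[of "\<lambda>h. represents h (fourier_dist f)", OF h])
  have "square_integrable lebesgue (\<lambda>t. h t * complex_of_real (mu s t))"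
    unfolding square_integrable_def
    using int representsD(1)[OF h] mu_lebesgue_measurable by (intro conjI borel_measurable_times)
  moreover have "weighted_fourier s f \<in> borel_measurable lebesgue"
    unfolding weighted_fourier_def[abs_def]
    by (intro borel_measurable_times representsD(1)[OF r] mu_lebesgue_measurable)
  moreover have "AE t in lebesgue. h t * complex_of_real (mu s t) = weighted_fourier s f t"
    using fourier_fun_eqI[OF h] by eventually_elim (simp add: weighted_fourier_def)
  ultimately show "square_integrable lebesgue (weighted_fourier s f)"
    by (rule square_integrable_cong_AE)
qed

lemma sobolevI:
  assumes "f \<in> tempered" "represents h (fourier_dist f)"
    "square_integrable lebesgue (\<lambda>t. h t * complex_of_real (mu s t))"
  shows "f \<in> sobolev s"
  using assms unfolding sobolev_def square_integrable_def by blast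

lemma sobolev_add:
  assumes f: "f \<in> sobolev s" and g: "g \<in> sobolev s"
  shows "(\<lambda>\<phi>. f \<phi> + g \<phi>) \<in> sobolev s"
    and "AE t in lebesgue. fourier_fun (\<lambda>\<phi>. f \<phi> + g \<phi>) t = fourier_fun f t + fourier_fun g t"
proof -
  note r = represents_add[OF sobolevD(2)[OF f] sobolevD(2)[OF g]]
  show "(\<lambda>\<phi>. f \<phi> + g \<phi>) \<in> sobolev s"
    using tempered_add[OF sobolevD(1)[OF f] sobolevD(1)[OF g]] r
  proof (rule sobolevI)
    show "square_integrable lebesgue (\<lambda>t. (fourier_fun f t + fourier_fun g t) * complex_of_real (mu s t))"
      using square_integrable_add[OF sobolevD(3)[OF f] sobolevD(3)[OF g]] by (simp add: weighted_fourier_def distrib_right)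
  qed
  show "AE t in lebesgue. fourier_fun (\<lambda>\<phi>. f \<phi> + g \<phi>) t = fourier_fun f t + fourier_fun g t"
    by (rule fourier_fun_eqI[OF r])
qed

lemma sobolev_scale:
  assumes f: "f \<in> sobolev s"
  shows "(\<lambda>\<phi>. c * f \<phi>) \<in> sobolev s"
    and "AE t in lebesgue. fourier_fun (\<lambda>\<phi>. c * f \<phi>) t = c * fourier_fun f t"
proof -
  note r = represents_scale[OF sobolevD(2)[OF f], of c]
  show "(\<lambda>\<phi>. c * f \<phi>) \<in> sobolev s"
    using tempered_scale[OF sobolevD(1)[OF f]] r
  proof (rule sobolevI)
    show "square_integrable lebesgue (\<lambda>t. (c * fourier_fun f t) * complex_of_real (mu s t))"
      using square_integrable_scale[OF sobolevD(3)[OF f], of c] by (simp add: weighted_fourier_def mult.assoc)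
  qed
  show "AE t in lebesgue. fourier_fun (\<lambda>\<phi>. c * f \<phi>) t = c * fourier_fun f t"
    by (rule fourier_fun_eqI[OF r])
qed

lemma sobolev_diff:
  assumes f: "f \<in> sobolev s" and g: "g \<in> sobolev s"
  shows "(\<lambda>\<phi>. f \<phi> - g \<phi>) \<in> sobolev s"
    and "AE t in lebesgue. fourier_fun (\<lambda>\<phi>. f \<phi> - g \<phi>) t = fourier_fun f t - fourier_fun g t"
proof -
  note * = sobolev_scale[OF g, of "-1"]
  show "(\<lambda>\<phi>. f \<phi> - g \<phi>) \<in> sobolev s" using sobolev_add(1)[OF f *(1)] by simp
  show "AE t in lebesgue. fourier_fun (\<lambda>\<phi>. f \<phi> - g \<phi>) t = fourier_fun f t - fourier_fun g t"
    using sobolev_add(2)[OF f *(1)] *(2) by eventually_elim simp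
qed

lemma tempered_zero: "(\<lambda>\<phi>. 0) \<in> tempered"
  by (rule temperedI[where C=0 and N=0]) auto

lemma sobolev_zero: "(\<lambda>\<phi>. 0) \<in> sobolev s"
  by (rule sobolevI[where h="\<lambda>t. 0"])
    (auto simp: tempered_zero represents_def fourier_dist_def square_integrable_def)

lemma lin_subspace_sobolev: "lin_subspace (sobolev s)"
  unfolding lin_subspace_def using sobolev_zero sobolev_add(1) sobolev_scale(1) by blast

lemma sobolev_inner_eq:
  "sobolev_inner s f g = (LINT t|lebesgue. weighted_fourier s f t * cnj (weighted_fourier s g t))"
  unfolding sobolev_inner_def weighted_fourier_def
  by (intro Bochner_Integration.integral_cong) (simp_all add: power2_eq_square)

lemma sobolev_integrable:
  assumes "f \<in> sobolev s" "g \<in> sobolev s"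
  shows "integrable lebesgue (\<lambda>t. weighted_fourier s f t * cnj (weighted_fourier s g t))"
  using assms by (intro square_integrable_prod sobolevD(3))

lemma sobolev_inner_self:
  "sobolev_inner s f f = complex_of_real (LINT t|lebesgue. (cmod (weighted_fourier s f t))\<^sup>2)"
  unfolding sobolev_inner_eq integral_complex_of_real[symmetric] by (simp only: complex_norm_square)

lemma sobolev_hnorm: "(hnorm (sobolev_inner s) f)\<^sup>2 = (LINT t|lebesgue. (cmod (weighted_fourier s f t))\<^sup>2)"
  unfolding hnorm_def sobolev_inner_self by simp

lemma sobolev_inner_cong_AE:
  assumes "f \<in> sobolev s" "g \<in> sobolev s"
    and "h \<in> borel_measurable lebesgue" "AE t in lebesgue. weighted_fourier s f t * cnj (weighted_fourier s g t) = h t"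
  shows "sobolev_inner s f g = (LINT t|lebesgue. h t)"
  unfolding sobolev_inner_eq
  using borel_measurable_integrable[OF sobolev_integrable[OF assms(1,2)]] assms(3,4) by (intro integral_cong_AE)

text \<open>The constant is \<open>gaussian_mass\<^sup>-\<^sup>2\<close> because the value of the Gaussian integral is never needed.\<close>

lemma sobolev_exists:
  fixes h :: "real^'n::finite \<Rightarrow> complex"
  assumes h: "h \<in> borel_measurable lebesgue" and sq: "square_integrable lebesgue (\<lambda>t. h t * complex_of_real (mu s t))"
  obtains f where "f \<in> sobolev s" "AE t in lebesgue. fourier_fun f t = h t"
proof -
  \<comment> \<open>The first summand absorbs \<open>1 / mu s\<close>; the second leaves
    \<open>b = 1 / (1 + norm x) ^ CARD('n)\<close>, whose square is integrable, so that
    \<open>a * b \<le> a\<^sup>2 + b\<^sup>2\<close> finishes the estimate.\<close>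
  define M where "M = nat \<lceil>\<bar>s\<bar>\<rceil> + CARD('n)"
  define c where "c = (gaussian_mass TYPE('n))\<^sup>2"
  have c: "c \<noteq> 0" using gaussian_mass_nonzero[where 'n='n] by (simp add: c_def)
  have pos: "0 < 1 + norm x" for x :: "real^'n" by (simp add: add_pos_nonneg)
  have decay: "norm (h x) / (1 + norm x) ^ M \<le> (cmod (h x * complex_of_real (mu s x)))\<^sup>2 + 1 / (1 + norm x) ^ (2 * CARD('n))" for x
  proof -
    define a where "a = cmod (h x * complex_of_real (mu s x))"
    define b where "b = 1 / (1 + norm x) ^ CARD('n)"
    have ab: "0 \<le> a" "0 \<le> b" unfolding a_def b_def by auto
    have "norm (h x) = a * mu (- s) x"
      using mu_pos[of s x] by (simp add: a_def norm_mult mu_minus abs_of_pos)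
    also have "\<dots> \<le> a * (1 + norm x) ^ nat \<lceil>\<bar>- s\<bar>\<rceil>" by (intro mult_left_mono mu_le ab)
    finally have "norm (h x) \<le> a * (1 + norm x) ^ nat \<lceil>\<bar>s\<bar>\<rceil>" by simp
    then have "norm (h x) / (1 + norm x) ^ M \<le> (a * (1 + norm x) ^ nat \<lceil>\<bar>s\<bar>\<rceil>) / (1 + norm x) ^ M"
      by (intro divide_right_mono) auto
    also have "\<dots> = a * b" using pos[of x] by (simp add: M_def b_def power_add)
    also have "\<dots> \<le> a\<^sup>2 + b\<^sup>2" using sum_squares_bound[of a b] ab mult_nonneg_nonneg[OF ab] by linarith
    also have "b\<^sup>2 = 1 / (1 + norm x) ^ (2 * CARD('n))" by (simp add: b_def power_divide power_mult[symmetric] mult.commute)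
    finally show ?thesis by (simp add: a_def)
  qed
  have w_meas: "(\<lambda>x::real^'n. (1 + norm x) ^ M) \<in> borel_measurable lebesgue"
    by (rule measurable_completion) measurable
  have w_int: "integrable lebesgue (\<lambda>x. norm (h x) / (1 + norm x) ^ M)"
  proof (rule Bochner_Integration.integrable_bound)
    have "integrable lebesgue (\<lambda>x::real^'n. 1 / (1 + norm x) ^ (2 * CARD('n)))"
      using integrable_decay[where 'n='n] by (subst integrable_completion) measurable
    then show "integrable lebesgue (\<lambda>x. (cmod (h x * complex_of_real (mu s x)))\<^sup>2 + 1 / (1 + norm x) ^ (2 * CARD('n)))"
      using sq unfolding square_integrable_def by (intro Bochner_Integration.integrable_add) blast+
    show "(\<lambda>x. norm (h x) / (1 + norm x) ^ M) \<in> borel_measurable lebesgue"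
      by (rule borel_measurable_divide[OF measurable_compose[OF h borel_measurable_norm] w_meas])
    show "AE x in lebesgue. norm (norm (h x) / (1 + norm x) ^ M) \<le> norm ((cmod (h x * complex_of_real (mu s x)))\<^sup>2 + 1 / (1 + norm x) ^ (2 * CARD('n)))"
      using decay by (intro AE_I2) (simp add: abs_of_nonneg)
  qed
  define K where "K = (LINT x|lebesgue. norm (h x) / (1 + norm x) ^ M)"
  have h_int: "integrable lebesgue (\<lambda>x. h x * \<phi> x)" "norm (LINT x|lebesgue. h x * \<phi> x) \<le> B * K"
    if \<phi>: "\<phi> \<in> borel_measurable borel" and B: "\<And>x. (1 + norm x) ^ M * norm (\<phi> x) \<le> B" for \<phi> B
  proof -
    have i: "integrable lebesgue (\<lambda>x. B * (norm (h x) / (1 + norm x) ^ M))" by (rule integrable_mult_right[OF w_int])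
    have b: "norm (h x * \<phi> x) \<le> B * (norm (h x) / (1 + norm x) ^ M)" for x
    proof -
      have "norm (\<phi> x) \<le> B / (1 + norm x) ^ M"
        using B[of x] pos[of x] by (simp add: pos_le_divide_eq mult.commute)
      from mult_left_mono[OF this, of "norm (h x)"] show ?thesis by (simp add: norm_mult mult.commute)
    qed
    have "\<phi> \<in> borel_measurable lebesgue" using \<phi> by (intro measurable_completion) simp
    then have m: "(\<lambda>x. h x * \<phi> x) \<in> borel_measurable lebesgue" using h by (intro borel_measurable_times)
    show int: "integrable lebesgue (\<lambda>x. h x * \<phi> x)"
      by (rule Bochner_Integration.integrable_bound[OF i m]) (intro AE_I2 order_trans[OF b], unfold real_norm_def, rule abs_ge_self)
    have "norm (LINT x|lebesgue. h x * \<phi> x) \<le> (LINT x|lebesgue. norm (h x * \<phi> x))" by (rule integral_norm_bound)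
    also have "\<dots> \<le> (LINT x|lebesgue. B * (norm (h x) / (1 + norm x) ^ M))"
      by (intro integral_mono integrable_norm int i b)
    finally show "norm (LINT x|lebesgue. h x * \<phi> x) \<le> B * K" unfolding K_def integral_mult_right_zero .
  qed
  have schwartz_int: "integrable lebesgue (\<lambda>x. h x * \<phi> x)" if \<phi>: "\<phi> \<in> schwartz" for \<phi>
  proof -
    obtain B where "\<And>x. (1 + norm x) ^ M * norm (\<phi> x) \<le> B" using schwartz_bound[OF \<phi>] by blast
    then show ?thesis by (rule h_int(1)[OF schwartz_measurable[OF \<phi>]])
  qed
  have reflect_meas: "(\<lambda>x. fourier \<phi> (- x)) \<in> borel_measurable borel" if "\<phi> \<in> schwartz" for \<phi> :: "real^'n \<Rightarrow> complex"
    using schwartz_measurable[OF fourier_in_schwartz[OF that]] by measurable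
  obtain C N where C: "C \<ge> 0" "\<And>\<phi> t. \<phi> \<in> schwartz \<Longrightarrow> (1 + norm (t::real^'n)) ^ M * norm (fourier \<phi> t)
     \<le> C * (\<Sum>js\<in>{js. length js \<le> N}. schwartz_seminorm N js \<phi>)"
    using fourier_decay[of M, where 'n='n] by blast
  have reflect_bound: "(1 + norm x) ^ M * norm (fourier \<phi> (- x)) \<le> C * (\<Sum>js\<in>{js. length js \<le> N}. schwartz_seminorm N js \<phi>)"
    if "\<phi> \<in> schwartz" for \<phi> and x :: "real^'n"
    using C(2)[OF that, of "- x"] by simp
  have int_f: "integrable lebesgue (\<lambda>x. h x * fourier \<phi> (- x))" if "\<phi> \<in> schwartz" for \<phi>
    by (rule h_int(1)[OF reflect_meas[OF that] reflect_bound[OF that]])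
  \<comment> \<open>The inverse transform of \<open>h\<close>, moved to the test function: by
    \<open>fourier_fourier\<close> the functional \<open>\<phi> \<mapsto> f (fourier \<phi>)\<close>
    is integration against \<open>h\<close>.\<close>
  define f where "f \<phi> = (if \<phi> \<in> schwartz then (1 / c) * (LINT x|lebesgue. h x * fourier \<phi> (- x)) else 0)" for \<phi>
  have "f \<in> tempered"
  proof (rule temperedI[where C="norm (1 / c) * (C * K)" and N=N])
    show "f \<phi> = 0" if "\<phi> \<notin> schwartz" for \<phi> using that by (simp add: f_def)
    show "f (\<lambda>x. \<phi> x + \<psi> x) = f \<phi> + f \<psi>" if "\<phi> \<in> schwartz" "\<psi> \<in> schwartz" for \<phi> \<psi>
      using that int_f by (simp add: f_def schwartz_add fourier_add distrib_left add_divide_distrib)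
    show "f (\<lambda>x. a * \<phi> x) = a * f \<phi>" if "\<phi> \<in> schwartz" for a \<phi>
    proof -
      have "(LINT x|lebesgue. h x * fourier (\<lambda>x. a * \<phi> x) (- x)) = a * (LINT x|lebesgue. h x * fourier \<phi> (- x))"
        unfolding fourier_scale[OF that] mult.left_commute[of _ a] by (rule integral_mult_right_zero)
      then show ?thesis using that by (simp add: f_def schwartz_scale)
    qed
    fix \<phi> :: "real^'n \<Rightarrow> complex" assume \<phi>: "\<phi> \<in> schwartz"
    have "norm (f \<phi>) = norm (1 / c) * norm (LINT x|lebesgue. h x * fourier \<phi> (- x))"
      using \<phi> by (simp add: f_def norm_mult norm_divide)
    also have "\<dots> \<le> norm (1 / c) * ((C * (\<Sum>js\<in>{js. length js \<le> N}. schwartz_seminorm N js \<phi>)) * K)"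
      by (intro mult_left_mono h_int(2)[OF reflect_meas[OF \<phi>] reflect_bound[OF \<phi>]]) simp
    finally show "norm (f \<phi>) \<le> (norm (1 / c) * (C * K)) * (\<Sum>js\<in>{js. length js \<le> N}. schwartz_seminorm N js \<phi>)"
      by (simp only: ac_simps)
  qed
  moreover have r: "represents h (fourier_dist f)"
  proof (rule representsI[OF h schwartz_int])
    fix \<phi> :: "real^'n \<Rightarrow> complex" assume \<phi>: "\<phi> \<in> schwartz"
    have "fourier_dist f \<phi> = (1 / c) * (LINT x|lebesgue. h x * fourier (fourier \<phi>) (- x))"
      using \<phi> by (simp add: fourier_dist_def f_def fourier_in_schwartz)
    also have "\<dots> = (1 / c) * (LINT x|lebesgue. c * (h x * \<phi> x))"
      unfolding fourier_fourier[OF \<phi>] c_def by (simp only: minus_minus mult.left_commute)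
    also have "\<dots> = (LINT x|lebesgue. h x * \<phi> x)" using c by simp
    finally show "fourier_dist f \<phi> = (LINT x|lebesgue. h x * \<phi> x)" .
  qed simp
  ultimately have "f \<in> sobolev s" using sq by (rule sobolevI)
  then show ?thesis using that fourier_fun_eqI[OF r] by blast
qed

text \<open>By hypothesis \<open>f\<close> vanishes on transforms of Schwartz functions, and every
  Schwartz function is one: applying the transform four times multiplies by a nonzero constant. Off
  the Schwartz space \<open>f\<close> is 0 by convention.\<close>

lemma sobolev_eq_zero:
  fixes f :: "(real^'n::finite \<Rightarrow> complex) \<Rightarrow> complex"
  assumes f: "f \<in> sobolev s" and zero: "AE t in lebesgue. fourier_fun f t = 0"
  shows "f = (\<lambda>\<phi>. 0)"
proof
  fix \<phi> :: "real^'n \<Rightarrow> complex"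
  define c where "c = (gaussian_mass TYPE('n))\<^sup>2"
  have c: "c \<noteq> 0" using gaussian_mass_nonzero[where 'n='n] by (simp add: c_def)
  show "f \<phi> = 0"
  proof (cases "\<phi> \<in> schwartz")
    case True
    have F: "f (fourier \<psi>) = 0" if \<psi>: "\<psi> \<in> schwartz" for \<psi>
    proof -
      have "f (fourier \<psi>) = (LINT x|lebesgue. fourier_fun f x * \<psi> x)"
        using representsD(3)[OF sobolevD(2)[OF f] \<psi>] \<psi> by (simp add: fourier_dist_def)
      also have "\<dots> = 0"
        by (rule integral_eq_zero_AE) (use zero in eventually_elim, simp)
      finally show ?thesis .
    qed
    let ?\<psi> = "fourier (fourier (fourier \<phi>))"
    have S: "fourier \<phi> \<in> schwartz" "fourier (fourier \<phi>) \<in> schwartz" "?\<psi> \<in> schwartz"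
      using True by (simp_all add: fourier_in_schwartz)
    have "fourier ?\<psi> = (\<lambda>x. c\<^sup>2 * \<phi> x)"
      by (rule ext) (simp add: fourier_fourier[OF S(2)] fourier_fourier[OF True] c_def power2_eq_square)
    then have "c\<^sup>2 * f \<phi> = f (fourier ?\<psi>)" using temperedD(3)[OF sobolevD(1)[OF f] True] by simp
    also have "\<dots> = 0" by (rule F[OF S(3)])
    finally show ?thesis using c by simp
  qed (rule temperedD(1)[OF sobolevD(1)[OF f]])
qed

theorem sobolev_hilbert: "hilbert_fun (sobolev_inner s) (sobolev s :: ((real^'n::finite \<Rightarrow> complex) \<Rightarrow> complex) set)"
proof
  show "lin_subspace (sobolev s)" by (rule lin_subspace_sobolev)
  have meas: "(\<lambda>t. weighted_fourier s f t * cnj (weighted_fourier s g t)) \<in> borel_measurable lebesgue"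
    if "f \<in> sobolev s" "g \<in> sobolev s" for f g :: "(real^'n \<Rightarrow> complex) \<Rightarrow> complex"
    using sobolev_integrable[OF that] by (rule borel_measurable_integrable)
  fix u v w :: "(real^'n \<Rightarrow> complex) \<Rightarrow> complex"
  {
    assume u: "u \<in> sobolev s" and w: "w \<in> sobolev s"
    assume v: "v \<in> sobolev s"
    have "AE t in lebesgue. weighted_fourier s (\<lambda>p. u p + v p) t * cnj (weighted_fourier s w t)
        = weighted_fourier s u t * cnj (weighted_fourier s w t) + weighted_fourier s v t * cnj (weighted_fourier s w t)"
      using sobolev_add(2)[OF u v] by eventually_elim (simp add: weighted_fourier_def algebra_simps)
    from sobolev_inner_cong_AE[OF sobolev_add(1)[OF u v] w borel_measurable_add[OF meas[OF u w] meas[OF v w]] this]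
    show "sobolev_inner s (\<lambda>p. u p + v p) w = sobolev_inner s u w + sobolev_inner s v w"
      by (simp only: sobolev_inner_eq[of s u] sobolev_inner_eq[of s v]
          Bochner_Integration.integral_add[OF sobolev_integrable[OF u w] sobolev_integrable[OF v w]])
  }
  {
    assume u: "u \<in> sobolev s" and w: "w \<in> sobolev s"
    show "sobolev_inner s (\<lambda>p. c * u p) w = c * sobolev_inner s u w" for c
    proof -
      have "AE t in lebesgue. weighted_fourier s (\<lambda>p. c * u p) t * cnj (weighted_fourier s w t)
          = c * (weighted_fourier s u t * cnj (weighted_fourier s w t))"
        using sobolev_scale(2)[OF u, of c] by eventually_elim (simp add: weighted_fourier_def algebra_simps)
      from sobolev_inner_cong_AE[OF sobolev_scale(1)[OF u] w borel_measurable_times[OF borel_measurable_const meas[OF u w]] this]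
      show ?thesis by (simp only: sobolev_inner_eq[of s u] integral_mult_right_zero)
    qed
  }
  show "sobolev_inner s v u = cnj (sobolev_inner s u v)"
  proof -
    have "sobolev_inner s v u = (LINT t|lebesgue. cnj (weighted_fourier s u t * cnj (weighted_fourier s v t)))"
      unfolding sobolev_inner_eq by (simp add: mult.commute)
    also have "\<dots> = cnj (sobolev_inner s u v)" unfolding sobolev_inner_eq by (rule Bochner_Integration.integral_cnj)
    finally show ?thesis .
  qed
  show "0 \<le> Re (sobolev_inner s u u)" unfolding sobolev_inner_self by simp
  show "u = (\<lambda>p. 0)" if u: "u \<in> sobolev s" and "sobolev_inner s u u = 0"
  proof (rule sobolev_eq_zero[OF u])
    have "(LINT t|lebesgue. (cmod (weighted_fourier s u t))\<^sup>2) = 0"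
      using that(2) unfolding sobolev_inner_self by simp
    moreover have "integrable lebesgue (\<lambda>t. (cmod (weighted_fourier s u t))\<^sup>2)"
      using sobolevD(3)[OF u] by (simp add: square_integrable_def)
    ultimately have "AE t in lebesgue. (cmod (weighted_fourier s u t))\<^sup>2 = 0"
      by (subst (asm) integral_nonneg_eq_0_iff_AE) auto
    then show "AE t in lebesgue. fourier_fun u t = 0"
      by eventually_elim (simp add: weighted_fourier_def mu_nonzero)
  qed
next
  fix X :: "nat \<Rightarrow> (real^'n \<Rightarrow> complex) \<Rightarrow> complex"
  assume X: "\<And>m. X m \<in> sobolev s"
    and C: "\<And>e. e > 0 \<Longrightarrow> \<exists>N. \<forall>m\<ge>N. \<forall>k\<ge>N. hnorm (sobolev_inner s) (\<lambda>p. X m p - X k p) < e"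
  let ?W = "weighted_fourier s"
  note X_sq = sobolevD(3)[OF X]
  have diff: "(hnorm (sobolev_inner s) (\<lambda>p. f p - g p))\<^sup>2 = (LINT t|lebesgue. (cmod (?W f t - ?W g t))\<^sup>2)"
    if f: "f \<in> sobolev s" and g: "g \<in> sobolev s" for f g :: "(real^'n \<Rightarrow> complex) \<Rightarrow> complex"
    unfolding sobolev_hnorm
  proof (rule integral_cong_AE)
    show "(\<lambda>t. (cmod (?W (\<lambda>p. f p - g p) t))\<^sup>2) \<in> borel_measurable lebesgue"
      using sobolevD(3)[OF sobolev_diff(1)[OF f g]] unfolding square_integrable_def
      by (blast intro: borel_measurable_integrable)
    show "(\<lambda>t. (cmod (?W f t - ?W g t))\<^sup>2) \<in> borel_measurable lebesgue"
      using square_integrable_diff[OF sobolevD(3)[OF f] sobolevD(3)[OF g]] unfolding square_integrable_def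
      by (blast intro: borel_measurable_integrable)
    show "AE t in lebesgue. (cmod (?W (\<lambda>p. f p - g p) t))\<^sup>2 = (cmod (?W f t - ?W g t))\<^sup>2"
      using sobolev_diff(2)[OF f g] by eventually_elim (simp add: weighted_fourier_def left_diff_distrib)
  qed
  have hn: "0 \<le> hnorm (sobolev_inner s) f" for f :: "(real^'n \<Rightarrow> complex) \<Rightarrow> complex"
    unfolding hnorm_def sobolev_inner_self by simp
  have "\<exists>N. \<forall>m\<ge>N. \<forall>k\<ge>N. (LINT t|lebesgue. (cmod (?W (X m) t - ?W (X k) t))\<^sup>2) < e" if "e > 0" for e
  proof -
    obtain N where N: "\<And>m k. m \<ge> N \<Longrightarrow> k \<ge> N \<Longrightarrow> hnorm (sobolev_inner s) (\<lambda>p. X m p - X k p) < sqrt e"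
      using C[of "sqrt e"] \<open>e > 0\<close> by auto
    have "(LINT t|lebesgue. (cmod (?W (X m) t - ?W (X k) t))\<^sup>2) < e" if "m \<ge> N" "k \<ge> N" for m k
      using power_strict_mono[OF N[OF that] hn, of 2] \<open>e > 0\<close> unfolding diff[OF X X] by simp
    then show ?thesis by blast
  qed
  from square_integrable_complete[OF X_sq this]
  obtain v where v: "square_integrable lebesgue v"
    and lim: "(\<lambda>m. LINT t|lebesgue. (cmod (?W (X m) t - v t))\<^sup>2) \<longlonglongrightarrow> 0" by blast
  have v_meas: "v \<in> borel_measurable lebesgue" using v by (simp add: square_integrable_def)
  \<comment> \<open>Dividing the L2 limit of the weighted transforms by the weight gives the
    transform of the limit in the Sobolev space.\<close>
  define h where "h t = v t * complex_of_real (mu (- s) t)" for t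
  have hv: "h t * complex_of_real (mu s t) = v t" for t
    using mu_pos[of s t] by (simp add: h_def mu_minus)
  have h: "h \<in> borel_measurable lebesgue"
    unfolding h_def[abs_def] by (intro borel_measurable_times v_meas mu_lebesgue_measurable)
  obtain f where f: "f \<in> sobolev s" and fh: "AE t in lebesgue. fourier_fun f t = h t"
    using sobolev_exists[OF h, of s] v unfolding hv by blast
  have "(hnorm (sobolev_inner s) (\<lambda>p. X m p - f p))\<^sup>2 = (LINT t|lebesgue. (cmod (?W (X m) t - v t))\<^sup>2)" for m
    unfolding diff[OF X f]
  proof (rule integral_cong_AE)
    show "(\<lambda>t. (cmod (?W (X m) t - ?W f t))\<^sup>2) \<in> borel_measurable lebesgue"
      using square_integrable_diff[OF sobolevD(3)[OF X] sobolevD(3)[OF f]] unfolding square_integrable_def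
      by (blast intro: borel_measurable_integrable)
    show "(\<lambda>t. (cmod (?W (X m) t - v t))\<^sup>2) \<in> borel_measurable lebesgue"
      using square_integrable_diff[OF sobolevD(3)[OF X] v] unfolding square_integrable_def
      by (blast intro: borel_measurable_integrable)
    show "AE t in lebesgue. (cmod (?W (X m) t - ?W f t))\<^sup>2 = (cmod (?W (X m) t - v t))\<^sup>2"
      using fh by eventually_elim (simp add: weighted_fourier_def hv)
  qed
  then have "(\<lambda>m. (hnorm (sobolev_inner s) (\<lambda>p. X m p - f p))\<^sup>2) \<longlonglongrightarrow> 0" using lim by simp
  from tendsto_real_sqrt[OF this] have "(\<lambda>m. hnorm (sobolev_inner s) (\<lambda>p. X m p - f p)) \<longlonglongrightarrow> 0"
    using hn by simp
  with f show "\<exists>u\<in>sobolev s. (\<lambda>m. hnorm (sobolev_inner s) (\<lambda>p. X m p - u p)) \<longlonglongrightarrow> 0" by blast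
qed

text \<open>Translating the transform of a test function is the same as multiplying the test
  function by a character before transforming.\<close>

lemma fourier_fun_shift:
  assumes f: "f \<in> sobolev s"
  shows "AE t in lebesgue. fourier_fun (shift k f) t = fchar t (lattice_vec k) * fourier_fun f t"
proof (rule fourier_fun_eqI, rule representsI)
  note r = sobolevD(2)[OF f]
  have "(\<lambda>t. fchar t (lattice_vec k)) \<in> borel_measurable borel"
    by (intro borel_measurable_continuous_onI continuous_intros)
  then have "(\<lambda>t. fchar t (lattice_vec k)) \<in> borel_measurable lebesgue" by (intro measurable_completion) simp
  then show "(\<lambda>t. fchar t (lattice_vec k) * fourier_fun f t) \<in> borel_measurable lebesgue"
    using representsD(1)[OF r] by (intro borel_measurable_times)
  fix \<phi> :: "real^'a \<Rightarrow> complex" assume \<phi>: "\<phi> \<in> schwartz"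
  let ?\<psi> = "\<lambda>t. fchar t (lattice_vec k) * \<phi> t"
  have \<psi>: "?\<psi> \<in> schwartz" by (rule schwartz_mult_fchar(1)[OF \<phi>])
  have eq: "(\<lambda>t. fchar t (lattice_vec k) * fourier_fun f t * \<phi> t) = (\<lambda>t. fourier_fun f t * ?\<psi> t)"
    by (simp add: ac_simps)
  show "integrable lebesgue (\<lambda>t. fchar t (lattice_vec k) * fourier_fun f t * \<phi> t)"
    unfolding eq by (rule representsD(2)[OF r \<psi>])
  have "(\<lambda>x. fourier \<phi> (x + lattice_vec k)) = fourier ?\<psi>"
    by (rule ext) (simp add: fourier_fchar fchar_add ac_simps)
  then have "fourier_dist (shift k f) \<phi> = fourier_dist f ?\<psi>"
    using \<phi> \<psi> by (simp add: fourier_dist_def shift_def)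
  also have "\<dots> = (LINT t|lebesgue. fourier_fun f t * ?\<psi> t)" by (rule representsD(3)[OF r \<psi>])
  finally show "fourier_dist (shift k f) \<phi> = (LINT t|lebesgue. fchar t (lattice_vec k) * fourier_fun f t * \<phi> t)"
    unfolding eq .
qed

section \<open>The weighted sequence space as a Hilbert space\<close>

abbreviation counting :: "(int^'n::finite) measure" where
  "counting \<equiv> count_space UNIV"

definition weighted_seq :: "real \<Rightarrow> (int^'n::finite \<Rightarrow> complex) \<Rightarrow> int^'n \<Rightarrow> complex" where
  "weighted_seq s c k = c k * complex_of_real (mu s (lattice_vec k))"

text \<open>Unconditional summation is replaced by integration over counting measure; the lemmas on
  square integrable functions then apply to sequences.\<close>

lemma ell2_iff: "c \<in> ell2 s \<longleftrightarrow> square_integrable counting (weighted_seq s c)"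
proof -
  let ?g = "\<lambda>k. (cmod (weighted_seq s c k))\<^sup>2"
  have "c \<in> ell2 s \<longleftrightarrow> ?g summable_on UNIV"
    by (simp add: ell2_def weighted_seq_def norm_mult power_mult_distrib)
  also have "\<dots> \<longleftrightarrow> Infinite_Set_Sum.abs_summable_on ?g UNIV"
    unfolding summable_on_iff_abs_summable_on_real[of ?g] by (rule abs_summable_equivalent)
  also have "\<dots> \<longleftrightarrow> square_integrable counting (weighted_seq s c)"
    by (simp add: abs_summable_on_def square_integrable_def)
  finally show ?thesis .
qed

lemma ell2_inner_eq:
  assumes "c \<in> ell2 s" "d \<in> ell2 s"
  shows "ell2_inner s c d = (LINT k|counting. weighted_seq s c k * cnj (weighted_seq s d k))"
proof -
  have "integrable counting (\<lambda>k. weighted_seq s c k * cnj (weighted_seq s d k))"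
    using assms unfolding ell2_iff by (rule square_integrable_prod)
  then have "Infinite_Set_Sum.abs_summable_on (\<lambda>k. weighted_seq s c k * cnj (weighted_seq s d k)) UNIV"
    by (simp add: abs_summable_on_def)
  from infsetsum_infsum[OF this] show ?thesis
    by (simp add: infsetsum_def ell2_inner_def weighted_seq_def power2_eq_square ac_simps)
qed

lemma ell2_inner_self:
  assumes "c \<in> ell2 s"
  shows "ell2_inner s c c = complex_of_real (LINT k|counting. (cmod (weighted_seq s c k))\<^sup>2)"
  unfolding ell2_inner_eq[OF assms assms] integral_complex_of_real[symmetric] by (simp only: complex_norm_square)

lemma ell2_hnorm:
  assumes "c \<in> ell2 s"
  shows "(hnorm (ell2_inner s) c)\<^sup>2 = (LINT k|counting. (cmod (weighted_seq s c k))\<^sup>2)"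
  unfolding hnorm_def ell2_inner_self[OF assms] by simp

lemma ell2_add: "c \<in> ell2 s \<Longrightarrow> d \<in> ell2 s \<Longrightarrow> (\<lambda>k. c k + d k) \<in> ell2 s"
  using square_integrable_add[of counting "weighted_seq s c" "weighted_seq s d"]
  by (simp add: ell2_iff weighted_seq_def[abs_def] distrib_right)

lemma ell2_scale: "c \<in> ell2 s \<Longrightarrow> (\<lambda>k. a * c k) \<in> ell2 s"
  using square_integrable_scale[of counting "weighted_seq s c" a]
  by (simp add: ell2_iff weighted_seq_def[abs_def] mult.assoc)

lemma ell2_diff: "c \<in> ell2 s \<Longrightarrow> d \<in> ell2 s \<Longrightarrow> (\<lambda>k. c k - d k) \<in> ell2 s"
  using square_integrable_diff[of counting "weighted_seq s c" "weighted_seq s d"]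
  by (simp add: ell2_iff weighted_seq_def[abs_def] left_diff_distrib)

lemma ell2_zero: "(\<lambda>k. 0) \<in> ell2 s"
  by (simp add: ell2_iff weighted_seq_def square_integrable_def)

lemma ell2_delta: "(\<lambda>k. if k = j then 1 else 0) \<in> ell2 s"
proof -
  have "(\<lambda>k. (cmod (if k = j then 1 else 0))\<^sup>2 * (mu s (lattice_vec k))\<^sup>2) summable_on UNIV \<longleftrightarrow>
      (\<lambda>k. (cmod (if k = j then 1 else 0))\<^sup>2 * (mu s (lattice_vec k))\<^sup>2) summable_on {j}"
    by (rule summable_on_cong_neutral) auto
  then show ?thesis by (simp add: ell2_def)
qed

lemma weighted_seq_integrable:
  assumes "c \<in> ell2 s" "d \<in> ell2 s"
  shows "integrable counting (\<lambda>k. weighted_seq s c k * cnj (weighted_seq s d k))"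
  using assms unfolding ell2_iff by (rule square_integrable_prod)

lemma weighted_seq_arith:
  "weighted_seq s (\<lambda>k. c k + d k) k = weighted_seq s c k + weighted_seq s d k"
  "weighted_seq s (\<lambda>k. c k - d k) k = weighted_seq s c k - weighted_seq s d k"
  "weighted_seq s (\<lambda>k. a * c k) k = a * weighted_seq s c k"
  by (simp_all add: weighted_seq_def algebra_simps)

theorem ell2_hilbert: "hilbert_fun (ell2_inner s) (ell2 s :: (int^'n::finite \<Rightarrow> complex) set)"
proof
  show "lin_subspace (ell2 s)" unfolding lin_subspace_def using ell2_zero ell2_add ell2_scale by blast
  fix u v w :: "int^'n \<Rightarrow> complex"
  show "ell2_inner s (\<lambda>p. u p + v p) w = ell2_inner s u w + ell2_inner s v w"
    if "u \<in> ell2 s" "v \<in> ell2 s" "w \<in> ell2 s"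
    using that by (simp add: ell2_inner_eq ell2_add weighted_seq_arith distrib_right weighted_seq_integrable)
  show "ell2_inner s (\<lambda>p. c * u p) w = c * ell2_inner s u w" if "u \<in> ell2 s" "w \<in> ell2 s" for c
    using that by (simp add: ell2_inner_eq ell2_scale weighted_seq_arith mult.assoc)
  show "ell2_inner s v u = cnj (ell2_inner s u v)" if "u \<in> ell2 s" "v \<in> ell2 s"
  proof -
    have "ell2_inner s v u = (LINT k|counting. cnj (weighted_seq s u k * cnj (weighted_seq s v k)))"
      unfolding ell2_inner_eq[OF that(2,1)] by (simp add: mult.commute)
    also have "\<dots> = cnj (ell2_inner s u v)"
      unfolding ell2_inner_eq[OF that] by (rule Bochner_Integration.integral_cnj)
    finally show ?thesis .
  qed
  show "0 \<le> Re (ell2_inner s u u)" if "u \<in> ell2 s" unfolding ell2_inner_self[OF that] by simp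
  show "u = (\<lambda>p. 0)" if u: "u \<in> ell2 s" and "ell2_inner s u u = 0"
  proof -
    have "(LINT k|counting. (cmod (weighted_seq s u k))\<^sup>2) = 0"
      using that(2) unfolding ell2_inner_self[OF u] by simp
    moreover have "integrable counting (\<lambda>k. (cmod (weighted_seq s u k))\<^sup>2)"
      using u by (simp add: ell2_iff square_integrable_def)
    ultimately have "AE k in counting. (cmod (weighted_seq s u k))\<^sup>2 = 0"
      by (subst (asm) integral_nonneg_eq_0_iff_AE) auto
    then show ?thesis by (simp add: AE_count_space weighted_seq_def mu_nonzero fun_eq_iff)
  qed
next
  fix X :: "nat \<Rightarrow> int^'n \<Rightarrow> complex"
  assume X: "\<And>m. X m \<in> ell2 s"
    and C: "\<And>e. e > 0 \<Longrightarrow> \<exists>N. \<forall>m\<ge>N. \<forall>k\<ge>N. hnorm (ell2_inner s) (\<lambda>p. X m p - X k p) < e"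
  let ?w = "weighted_seq s"
  have diff: "(hnorm (ell2_inner s) (\<lambda>p. f p - g p))\<^sup>2 = (LINT k|counting. (cmod (?w f k - ?w g k))\<^sup>2)"
    if f: "f \<in> ell2 s" and g: "g \<in> ell2 s" for f g :: "int^'n \<Rightarrow> complex"
    unfolding ell2_hnorm[OF ell2_diff[OF f g]] weighted_seq_arith ..
  have hn: "0 \<le> hnorm (ell2_inner s) f" if "f \<in> ell2 s" for f :: "int^'n \<Rightarrow> complex"
    unfolding hnorm_def ell2_inner_self[OF that] by simp
  have X_sq: "square_integrable counting (?w (X m))" for m using X by (simp add: ell2_iff)
  have "\<exists>N. \<forall>m\<ge>N. \<forall>k\<ge>N. (LINT t|counting. (cmod (?w (X m) t - ?w (X k) t))\<^sup>2) < e" if "e > 0" for e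
  proof -
    obtain N where N: "\<And>m k. m \<ge> N \<Longrightarrow> k \<ge> N \<Longrightarrow> hnorm (ell2_inner s) (\<lambda>p. X m p - X k p) < sqrt e"
      using C[of "sqrt e"] \<open>e > 0\<close> by auto
    have "(LINT t|counting. (cmod (?w (X m) t - ?w (X k) t))\<^sup>2) < e" if "m \<ge> N" "k \<ge> N" for m k
      using power_strict_mono[OF N[OF that] hn[OF ell2_diff[OF X X]], of 2] \<open>e > 0\<close> unfolding diff[OF X X] by simp
    then show ?thesis by blast
  qed
  from square_integrable_complete[OF X_sq this]
  obtain v where v: "square_integrable counting v"
    and lim: "(\<lambda>m. LINT t|counting. (cmod (?w (X m) t - v t))\<^sup>2) \<longlonglongrightarrow> 0" by blast
  define f where "f k = v k / complex_of_real (mu s (lattice_vec k))" for k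
  have wf: "?w f = v" by (simp add: fun_eq_iff weighted_seq_def f_def mu_nonzero)
  have f: "f \<in> ell2 s" using v by (simp add: ell2_iff wf)
  have "(\<lambda>m. (hnorm (ell2_inner s) (\<lambda>p. X m p - f p))\<^sup>2) \<longlonglongrightarrow> 0"
    unfolding diff[OF X f] wf by (rule lim)
  from tendsto_real_sqrt[OF this] have "(\<lambda>m. hnorm (ell2_inner s) (\<lambda>p. X m p - f p)) \<longlonglongrightarrow> 0"
    using hn[OF ell2_diff[OF X f]] by simp
  with f show "\<exists>u\<in>ell2 s. (\<lambda>m. hnorm (ell2_inner s) (\<lambda>p. X m p - u p)) \<longlonglongrightarrow> 0" by blast
qed

section \<open>The tiling by translates of the torus\<close>

text \<open>The index of the tile containing \<open>x\<close>; the offset \<open>1 / 2\<close> in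
  the floor matches the half-open cube.\<close>

definition lattice_part :: "real^'n::finite \<Rightarrow> int^'n" where
  "lattice_part x = (\<chi> i. \<lfloor>x $ i + 1 / 2\<rfloor>)"

lemma in_tile_iff: "x - lattice_vec k \<in> torus \<longleftrightarrow> k = lattice_part x"
proof -
  have "(- 1 / 2 \<le> x $ i - real_of_int (k $ i) \<and> x $ i - real_of_int (k $ i) < 1 / 2) \<longleftrightarrow> k $ i = \<lfloor>x $ i + 1 / 2\<rfloor>" for i
    using floor_eq_iff[of "x $ i + 1 / 2" "k $ i"] by linarith
  then show ?thesis by (auto simp: torus_def lattice_vec_def lattice_part_def vec_eq_iff)
qed

lemma lattice_part_add: "t \<in> torus \<Longrightarrow> lattice_part (t + lattice_vec k) = k"
  using in_tile_iff[of "t + lattice_vec k" k] by simp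

lemma torus_borel: "(torus :: (real^'n::finite) set) \<in> sets borel"
proof -
  have eq: "torus = (\<Inter>i. {t::real^'n. - 1/2 \<le> t $ i} \<inter> {t. t $ i < 1/2})"
    by (auto simp: torus_def)
  have "{t::real^'n. - 1/2 \<le> t $ i} \<in> sets borel" "{t::real^'n. t $ i < 1/2} \<in> sets borel" for i :: 'n
    by measurable
  then show ?thesis by (subst eq) (intro sets.countable_INT'' sets.Int; simp)
qed

lemma torus_lebesgue [measurable]: "torus \<in> sets lebesgue"
  by (rule sets_completionI_sets) (simp add: torus_borel)

abbreviation torus_measure :: "(real^'n::finite) measure" where
  "torus_measure \<equiv> lebesgue_on torus"

lemma emeasure_torus: "emeasure lebesgue (torus :: (real^'n::finite) set) < \<infinity>"
proof -
  have "bounded (torus :: (real^'n) set)"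
  proof (rule bounded_subset)
    show "bounded (cbox (\<chi> i. - 1/2) (\<chi> i. 1/2 :: real^'n))" by (rule bounded_cbox)
    show "torus \<subseteq> cbox (\<chi> i. - 1/2) (\<chi> i. 1/2 :: real^'n)"
      by (auto simp: torus_def mem_box_cart less_imp_le)
  qed
  then have "emeasure lborel (torus :: (real^'n) set) < \<infinity>" by (rule emeasure_bounded_finite)
  then show ?thesis using torus_borel[where 'n='n] by simp
qed

interpretation torus: finite_measure "torus_measure :: (real^'n::finite) measure"
proof
  show "emeasure torus_measure (space (torus_measure :: (real^'n) measure)) \<noteq> \<infinity>"
    using emeasure_torus[where 'n='n] by (subst emeasure_restrict_space) (auto simp del: emeasure_completion)
qed

interpretation counting: sigma_finite_measure "count_space (UNIV :: (int^'n::finite) set)"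
  by (rule sigma_finite_measure_count_space_countable) auto

interpretation torus_counting: pair_sigma_finite "torus_measure :: (real^'n::finite) measure" "count_space (UNIV :: (int^'n::finite) set)" ..

text \<open>On the torus times the lattice, the inverse of splitting a point into its position in a
  tile and the index of that tile.\<close>

definition untile :: "(real^'n::finite) \<times> (int^'n) \<Rightarrow> real^'n" where
  "untile z = fst z + lattice_vec (snd z)"

lemma lebesgue_translation:
  shows "(\<lambda>x::real^'n::finite. x + a) \<in> lebesgue \<rightarrow>\<^sub>M lebesgue"
    and "distr lebesgue lebesgue (\<lambda>x. x + a) = (lebesgue :: (real^'n) measure)"
proof -
  have "(\<lambda>x::real^'n. a + (\<Sum>j\<in>Basis. (1 * (x \<bullet> j)) *\<^sub>R j)) = (\<lambda>x. x + a)"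
    by (simp add: euclidean_representation add.commute)
  then show "(\<lambda>x::real^'n. x + a) \<in> lebesgue \<rightarrow>\<^sub>M lebesgue"
    and "distr lebesgue lebesgue (\<lambda>x. x + a) = (lebesgue :: (real^'n) measure)"
    using lebesgue_affine_measurable[of "\<lambda>_::real^'n. 1" a] lebesgue_affine_euclidean[of "\<lambda>_::real^'n. 1" a]
    by (simp_all add: density_1)
qed

lemma measurable_torus_counting:
  assumes "\<And>k. (\<lambda>t. f (t, k)) \<in> torus_measure \<rightarrow>\<^sub>M N"
  shows "f \<in> (torus_measure \<Otimes>\<^sub>M counting) \<rightarrow>\<^sub>M N"
proof -
  have "(\<lambda>(k, t). f (t, k)) \<in> (counting \<Otimes>\<^sub>M torus_measure) \<rightarrow>\<^sub>M N"
    by (rule measurable_pair_measure_countable1) (use assms in auto)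
  from measurable_compose[OF measurable_pair_swap' this] show ?thesis by (simp add: split_beta')
qed

lemma untile_measurable: "untile \<in> (torus_measure \<Otimes>\<^sub>M counting) \<rightarrow>\<^sub>M lebesgue"
proof (rule measurable_torus_counting)
  show "(\<lambda>t. untile (t, k)) \<in> torus_measure \<rightarrow>\<^sub>M lebesgue" for k
    unfolding untile_def fst_conv snd_conv by (rule measurable_restrict_space1[OF lebesgue_translation(1)])
qed

text \<open>Tonelli, translation invariance on each tile, and the fact that every point lies in
  exactly one tile. It reduces integrals over fibers to Fubini on a product with counting
  measure.\<close>

theorem distr_untile:
  "distr (torus_measure \<Otimes>\<^sub>M counting) lebesgue untile = (lebesgue :: (real^'n::finite) measure)"
proof (rule measure_eqI)
  fix A :: "(real^'n) set" assume "A \<in> sets (distr (torus_measure \<Otimes>\<^sub>M counting) lebesgue untile)"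
  then have A: "A \<in> sets lebesgue" by simp
  let ?T = "torus :: (real^'n) set"
  have shift: "(\<lambda>t. indicator A (t + lattice_vec k) :: ennreal) \<in> borel_measurable lebesgue" for k
    by (rule measurable_compose[OF lebesgue_translation(1) borel_measurable_indicator[OF A]])
  have "emeasure (distr (torus_measure \<Otimes>\<^sub>M counting) lebesgue untile) A
      = (\<integral>\<^sup>+x. indicator A x \<partial>distr (torus_measure \<Otimes>\<^sub>M counting) lebesgue untile)"
    using A by simp
  also have "\<dots> = (\<integral>\<^sup>+z. indicator A (untile z) \<partial>(torus_measure \<Otimes>\<^sub>M counting))"
    by (rule nn_integral_distr[OF untile_measurable]) (use A in simp)
  also have "\<dots> = (\<integral>\<^sup>+t. \<integral>\<^sup>+k. indicator A (untile (t, k)) \<partial>counting \<partial>torus_measure)"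
    by (rule counting.nn_integral_fst[symmetric])
       (rule measurable_compose[OF untile_measurable borel_measurable_indicator[OF A]])
  also have "\<dots> = (\<integral>\<^sup>+t. (\<integral>\<^sup>+k. indicator A (t + lattice_vec k) \<partial>counting) * indicator ?T t \<partial>lebesgue)"
    unfolding untile_def fst_conv snd_conv by (rule nn_integral_restrict_space) simp
  also have "\<dots> = (\<integral>\<^sup>+t. \<integral>\<^sup>+k. indicator A (t + lattice_vec k) * indicator ?T t \<partial>counting \<partial>lebesgue)"
    by (subst nn_integral_multc) simp_all
  also have "\<dots> = (\<integral>\<^sup>+k. \<integral>\<^sup>+t. indicator A (t + lattice_vec k) * indicator ?T t \<partial>lebesgue \<partial>counting)"
    by (rule nn_integral_count_space_nn_integral) (auto intro: borel_measurable_times_ennreal shift)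
  also have "\<dots> = (\<integral>\<^sup>+k. \<integral>\<^sup>+x. indicator A x * indicator ?T (x - lattice_vec k) \<partial>lebesgue \<partial>counting)"
  proof (rule nn_integral_cong)
    fix k :: "int^'n"
    have "(\<lambda>x. indicator ?T (x - lattice_vec k) :: ennreal) \<in> borel_measurable lebesgue"
      using measurable_compose[OF lebesgue_translation(1)[of "- lattice_vec k"] borel_measurable_indicator[OF torus_lebesgue]]
      by simp
    then have m: "(\<lambda>x. indicator A x * indicator ?T (x - lattice_vec k) :: ennreal) \<in> borel_measurable lebesgue"
      using A by (intro borel_measurable_times_ennreal borel_measurable_indicator)
    have "(\<integral>\<^sup>+x. indicator A x * indicator ?T (x - lattice_vec k) \<partial>lebesgue)
       = (\<integral>\<^sup>+x. indicator A x * indicator ?T (x - lattice_vec k) \<partial>distr lebesgue lebesgue (\<lambda>x. x + lattice_vec k))"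
      by (simp only: lebesgue_translation(2))
    also have "\<dots> = (\<integral>\<^sup>+t. indicator A (t + lattice_vec k) * indicator ?T (t + lattice_vec k - lattice_vec k) \<partial>lebesgue)"
      by (rule nn_integral_distr[OF lebesgue_translation(1)]) (use m in simp)
    finally show "(\<integral>\<^sup>+t. indicator A (t + lattice_vec k) * indicator ?T t \<partial>lebesgue)
      = (\<integral>\<^sup>+x. indicator A x * indicator ?T (x - lattice_vec k) \<partial>lebesgue)" by simp
  qed
  also have "\<dots> = (\<integral>\<^sup>+x. \<integral>\<^sup>+k. indicator A x * indicator ?T (x - lattice_vec k) \<partial>counting \<partial>lebesgue)"
  proof (rule nn_integral_count_space_nn_integral[symmetric])
    fix k :: "int^'n"
    have "(\<lambda>x. indicator ?T (x - lattice_vec k) :: ennreal) \<in> borel_measurable lebesgue"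
      using measurable_compose[OF lebesgue_translation(1)[of "- lattice_vec k"] borel_measurable_indicator[OF torus_lebesgue]]
      by simp
    then show "(\<lambda>x. indicator A x * indicator ?T (x - lattice_vec k) :: ennreal) \<in> borel_measurable lebesgue"
      using A by (intro borel_measurable_times_ennreal borel_measurable_indicator)
  qed simp
  also have "\<dots> = (\<integral>\<^sup>+x. indicator A x \<partial>lebesgue)"
  proof (rule nn_integral_cong)
    fix x :: "real^'n"
    have "(\<integral>\<^sup>+k. indicator A x * indicator ?T (x - lattice_vec k) \<partial>counting)
       = (\<integral>\<^sup>+k. indicator A x * indicator {lattice_part x} k \<partial>counting)"
      by (intro nn_integral_cong) (auto simp: indicator_def in_tile_iff)
    also have "\<dots> = indicator A x" by (simp add: nn_integral_cmult_indicator)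
    finally show "(\<integral>\<^sup>+k. indicator A x * indicator ?T (x - lattice_vec k) \<partial>counting) = (indicator A x :: ennreal)" .
  qed
  also have "\<dots> = emeasure lebesgue A" using A by simp
  finally show "emeasure (distr (torus_measure \<Otimes>\<^sub>M counting) lebesgue untile) A = emeasure lebesgue A" .
qed simp

text \<open>The exceptional set has a null preimage under \<open>untile\<close>, so for almost every
  \<open>t\<close> it is avoided by all the countably many translates at once.\<close>

lemma AE_torus_shift:
  assumes "AE x in lebesgue. P x" shows "AE t in torus_measure. \<forall>k. P (t + lattice_vec k)"
proof -
  have "AE x in distr (torus_measure \<Otimes>\<^sub>M counting) lebesgue untile. P x" using assms by (simp only: distr_untile)
  then have "AE z in torus_measure \<Otimes>\<^sub>M counting. P (untile z)" by (rule AE_distrD[OF untile_measurable])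
  from torus_counting.AE_pair[OF this]
  show ?thesis by (simp add: untile_def AE_count_space)
qed

lemma torus_integral:
  fixes F :: "real^'n::finite \<Rightarrow> 'b::{banach, second_countable_topology}"
  assumes F: "integrable lebesgue F"
  shows "AE t in torus_measure. integrable counting (\<lambda>k. F (t + lattice_vec k))"
    and "integrable torus_measure (\<lambda>t. LINT k|counting. F (t + lattice_vec k))"
    and "(LINT t|torus_measure. LINT k|counting. F (t + lattice_vec k)) = (LINT x|lebesgue. F x)"
proof -
  have Fm: "F \<in> borel_measurable lebesgue" using F by (rule borel_measurable_integrable)
  have "integrable (distr (torus_measure \<Otimes>\<^sub>M counting) lebesgue untile) F" using F by (simp only: distr_untile)
  then have i: "integrable (torus_measure \<Otimes>\<^sub>M counting) (\<lambda>z. F (untile z))"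
    by (subst (asm) integrable_distr_eq[OF untile_measurable Fm])
  show "AE t in torus_measure. integrable counting (\<lambda>k. F (t + lattice_vec k))"
    using torus_counting.AE_integrable_fst'[OF i] by (simp add: untile_def)
  show "integrable torus_measure (\<lambda>t. LINT k|counting. F (t + lattice_vec k))"
    using torus_counting.integrable_fst'[OF i] by (simp add: untile_def)
  have "(LINT t|torus_measure. LINT k|counting. F (untile (t, k))) = (LINT z|(torus_measure \<Otimes>\<^sub>M counting). F (untile z))"
    by (rule torus_counting.integral_fst'[OF i])
  also have "\<dots> = (LINT x|distr (torus_measure \<Otimes>\<^sub>M counting) lebesgue untile. F x)"
    by (rule integral_distr[OF untile_measurable Fm, symmetric])
  finally show "(LINT t|torus_measure. LINT k|counting. F (t + lattice_vec k)) = (LINT x|lebesgue. F x)"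
    unfolding distr_untile by (simp add: untile_def)
qed

section \<open>Fibers\<close>

text \<open>The factor \<open>1 / mu s (lattice_vec k)\<close> in \<open>fiber_map\<close> cancels
  the weight of the sequence space: in weighted form, a fiber is the weighted transform sampled on a
  translate of the lattice.\<close>

lemma weighted_fiber: "weighted_seq s (fiber_map s f t) k = weighted_fourier s f (t + lattice_vec k)"
  by (simp add: weighted_seq_def fiber_map_def weighted_fourier_def mu_nonzero)

lemma fiber_in_ell2:
  assumes "f \<in> sobolev s" shows "AE t in torus_measure. fiber_map s f t \<in> ell2 s"
proof -
  have "integrable lebesgue (\<lambda>x. (cmod (weighted_fourier s f x))\<^sup>2)"
    using sobolevD(3)[OF assms] by (simp add: square_integrable_def)
  from torus_integral(1)[OF this] show ?thesis
    by (simp add: ell2_iff square_integrable_def weighted_fiber)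
qed

theorem sobolev_inner_fiber:
  assumes f: "f \<in> sobolev s" and g: "g \<in> sobolev s"
  shows "integrable torus_measure (\<lambda>t. LINT k|counting. weighted_fourier s f (t + lattice_vec k) * cnj (weighted_fourier s g (t + lattice_vec k)))"
    and "sobolev_inner s f g = (LINT t|torus_measure. LINT k|counting. weighted_fourier s f (t + lattice_vec k) * cnj (weighted_fourier s g (t + lattice_vec k)))"
    and "AE t in torus_measure. ell2_inner s (fiber_map s f t) (fiber_map s g t)
      = (LINT k|counting. weighted_fourier s f (t + lattice_vec k) * cnj (weighted_fourier s g (t + lattice_vec k)))"
proof -
  note * = torus_integral[OF sobolev_integrable[OF f g]]
  show "integrable torus_measure (\<lambda>t. LINT k|counting. weighted_fourier s f (t + lattice_vec k) * cnj (weighted_fourier s g (t + lattice_vec k)))"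
    by (rule *(2))
  show "sobolev_inner s f g = (LINT t|torus_measure. LINT k|counting. weighted_fourier s f (t + lattice_vec k) * cnj (weighted_fourier s g (t + lattice_vec k)))"
    unfolding sobolev_inner_eq by (rule *(3)[symmetric])
  show "AE t in torus_measure. ell2_inner s (fiber_map s f t) (fiber_map s g t)
      = (LINT k|counting. weighted_fourier s f (t + lattice_vec k) * cnj (weighted_fourier s g (t + lattice_vec k)))"
    using fiber_in_ell2[OF f] fiber_in_ell2[OF g]
    by eventually_elim (simp add: ell2_inner_eq weighted_fiber)
qed

lemma fiber_diff:
  assumes f: "f \<in> sobolev s" and g: "g \<in> sobolev s"
  shows "AE t in torus_measure. fiber_map s (\<lambda>\<phi>. f \<phi> - g \<phi>) t = (\<lambda>k. fiber_map s f t k - fiber_map s g t k)"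
  using AE_torus_shift[OF sobolev_diff(2)[OF f g]]
  by eventually_elim (simp add: fiber_map_def right_diff_distrib)

text \<open>The fibers of the difference vanish almost everywhere, so its Sobolev norm is 0.\<close>

lemma fiber_eqI:
  assumes f: "f \<in> sobolev s" and g: "g \<in> sobolev s"
    and eq: "AE t in torus_measure. fiber_map s f t = fiber_map s g t"
  shows "f = g"
proof -
  interpret S: hilbert_fun "sobolev_inner s" "sobolev s" by (rule sobolev_hilbert)
  let ?d = "\<lambda>\<phi>. f \<phi> - g \<phi>"
  have d: "?d \<in> sobolev s" by (rule sobolev_diff(1)[OF f g])
  have "AE t in torus_measure. (LINT k|counting. weighted_fourier s ?d (t + lattice_vec k) * cnj (weighted_fourier s ?d (t + lattice_vec k))) = 0"
    using fiber_diff[OF f g] eq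
  proof eventually_elim
    case (elim t)
    then have "weighted_fourier s ?d (t + lattice_vec k) = 0" for k
      unfolding weighted_fiber[symmetric] by (simp add: weighted_seq_def)
    then show ?case by simp
  qed
  then have "sobolev_inner s ?d ?d = 0"
    unfolding sobolev_inner_fiber(2)[OF d d] by (rule integral_eq_zero_AE)
  then have "?d = (\<lambda>_. 0)" by (rule S.ip_definite[OF d])
  then show ?thesis by (metis eq_iff_diff_eq_0 ext)
qed

text \<open>The sequences \<open>G t\<close> are glued along the tiles to one function on the whole
  space. The majorant \<open>b\<close> stands in for integrability of
  \<open>t \<mapsto> |G t|^2\<close>, so measurability is asked coordinate by coordinate.\<close>

theorem fiber_surj:
  fixes G :: "real^'n::finite \<Rightarrow> int^'n \<Rightarrow> complex"
  assumes meas: "\<And>k. (\<lambda>t. G t k) \<in> borel_measurable torus_measure"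
    and G: "AE t in torus_measure. G t \<in> ell2 s"
    and b: "integrable torus_measure b" "AE t in torus_measure. (hnorm (ell2_inner s) (G t))\<^sup>2 \<le> b t"
  obtains f where "f \<in> sobolev s" "AE t in torus_measure. fiber_map s f t = G t"
proof -
  \<comment> \<open>In tile \<open>k\<close> over \<open>t\<close> the value is the weighted
    \<open>k\<close>-th coordinate of \<open>G t\<close>, which is what the weighted transform of
    \<open>f\<close> has to be there.\<close>
  define v where "v x = weighted_seq s (G (x - lattice_vec (lattice_part x))) (lattice_part x)" for x
  have v_untile: "v (untile (t, k)) = weighted_seq s (G t) k" if "t \<in> torus" for t k
    using that by (simp add: v_def untile_def lattice_part_add)
  have wG_meas: "(\<lambda>t. weighted_seq s (G t) k) \<in> borel_measurable torus_measure" for k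
    unfolding weighted_seq_def by (intro borel_measurable_times meas borel_measurable_const)
  have v_meas: "v \<in> borel_measurable lebesgue"
  proof (rule measurable_piecewise_restrict)
    let ?C = "range (\<lambda>k. {x :: real^'n. x - lattice_vec k \<in> torus})"
    show "countable ?C" by simp
    have tile: "{x :: real^'n. x - lattice_vec k \<in> torus} \<in> sets lebesgue" for k
      using measurable_sets[OF lebesgue_translation(1)[of "- lattice_vec k"] torus_lebesgue]
      by (simp add: vimage_def)
    then show "\<Omega> \<inter> space lebesgue \<in> sets lebesgue" if "\<Omega> \<in> ?C" for \<Omega> using that by auto
    show "space lebesgue \<subseteq> \<Union>?C" using in_tile_iff by auto
    fix \<Omega> assume "\<Omega> \<in> ?C"
    then obtain k where \<Omega>: "\<Omega> = {x. x - lattice_vec k \<in> torus}" by blast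
    have "(\<lambda>x. weighted_seq s (G (x + - lattice_vec k)) k) \<in> borel_measurable (restrict_space lebesgue \<Omega>)"
      by (rule measurable_compose[OF measurable_restrict_space3[OF lebesgue_translation(1)] wG_meas]) (auto simp: \<Omega>)
    then show "v \<in> borel_measurable (restrict_space lebesgue \<Omega>)"
      by (rule measurable_cong[THEN iffD1, rotated]) (auto simp: \<Omega> v_def in_tile_iff space_restrict_space)
  qed
  have "integrable (torus_measure \<Otimes>\<^sub>M counting) (\<lambda>z. (cmod (v (untile z)))\<^sup>2)"
  proof (rule integrableI_bounded)
    show m: "(\<lambda>z. (cmod (v (untile z)))\<^sup>2) \<in> borel_measurable (torus_measure \<Otimes>\<^sub>M counting)"
      using measurable_compose[OF untile_measurable v_meas] by measurable
    have "(\<integral>\<^sup>+z. ennreal (norm ((cmod (v (untile z)))\<^sup>2)) \<partial>(torus_measure \<Otimes>\<^sub>M counting))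
       = (\<integral>\<^sup>+t. \<integral>\<^sup>+k. ennreal (norm ((cmod (v (untile (t, k))))\<^sup>2)) \<partial>counting \<partial>torus_measure)"
      by (rule counting.nn_integral_fst[symmetric]) (use m in measurable)
    also have "\<dots> \<le> (\<integral>\<^sup>+t. ennreal (b t) \<partial>torus_measure)"
    proof (rule nn_integral_mono_AE)
      show "AE t in torus_measure. (\<integral>\<^sup>+k. ennreal (norm ((cmod (v (untile (t, k))))\<^sup>2)) \<partial>counting) \<le> ennreal (b t)"
        using G b(2) AE_space
      proof eventually_elim
        case (elim t)
        then have t: "t \<in> torus" by simp
        have "(\<integral>\<^sup>+k. ennreal (norm ((cmod (v (untile (t, k))))\<^sup>2)) \<partial>counting) = (\<integral>\<^sup>+k. ennreal ((cmod (weighted_seq s (G t) k))\<^sup>2) \<partial>counting)"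
          by (simp add: v_untile[OF t])
        also have "\<dots> = ennreal (LINT k|counting. (cmod (weighted_seq s (G t) k))\<^sup>2)"
          by (rule nn_integral_eq_integral) (use elim in \<open>auto simp: ell2_iff square_integrable_def\<close>)
        also have "\<dots> \<le> ennreal (b t)"
          using elim by (intro ennreal_leI) (simp add: ell2_hnorm)
        finally show ?case .
      qed
    qed
    also have "\<dots> < \<infinity>"
    proof -
      have "(\<integral>\<^sup>+t. ennreal (b t) \<partial>torus_measure) \<le> (\<integral>\<^sup>+t. ennreal (norm (b t)) \<partial>torus_measure)"
        by (intro nn_integral_mono ennreal_leI) simp
      also have "\<dots> < \<infinity>" using b(1) by (simp add: integrable_iff_bounded)
      finally show ?thesis .
    qed
    finally show "(\<integral>\<^sup>+z. ennreal (norm ((cmod (v (untile z)))\<^sup>2)) \<partial>(torus_measure \<Otimes>\<^sub>M counting)) < \<infinity>" .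
  qed
  then have "integrable (distr (torus_measure \<Otimes>\<^sub>M counting) lebesgue untile) (\<lambda>x. (cmod (v x))\<^sup>2)"
    using v_meas by (subst integrable_distr_eq[OF untile_measurable]) measurable
  then have v_sq: "square_integrable lebesgue v" using v_meas by (simp add: distr_untile square_integrable_def)
  define h where "h x = v x * complex_of_real (mu (- s) x)" for x
  have hv: "(\<lambda>x. h x * complex_of_real (mu s x)) = v"
    by (simp add: fun_eq_iff h_def mu_minus mu_nonzero)
  have h: "h \<in> borel_measurable lebesgue"
    unfolding h_def[abs_def] by (intro borel_measurable_times v_meas mu_lebesgue_measurable)
  obtain f where f: "f \<in> sobolev s" and fh: "AE x in lebesgue. fourier_fun f x = h x"
    using sobolev_exists[OF h, of s] v_sq unfolding hv by blast
  have "AE t in torus_measure. fiber_map s f t = G t"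
    using AE_torus_shift[OF fh] AE_space
  proof eventually_elim
    case (elim t)
    then have t: "t \<in> torus" by simp
    have "weighted_seq s (fiber_map s f t) k = weighted_seq s (G t) k" for k
    proof -
      have "weighted_seq s (fiber_map s f t) k = h (t + lattice_vec k) * complex_of_real (mu s (t + lattice_vec k))"
        using elim(1) by (simp add: weighted_fiber weighted_fourier_def)
      also have "\<dots> = v (t + lattice_vec k)" using fun_cong[OF hv, of "t + lattice_vec k"] .
      also have "\<dots> = weighted_seq s (G t) k" using v_untile[OF t, of k] by (simp add: untile_def)
      finally show ?thesis .
    qed
    then show ?case by (auto simp: weighted_seq_def mu_nonzero)
  qed
  with f show ?thesis by (rule that)
qed

section \<open>Orthogonal projections and limits of operators\<close>

context hilbert_fun
begin

text \<open>Riesz' theorem in the Hilbert space \<open>U\<close>, for the functional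
  \<open>w \<mapsto> ip w u\<close>; the vector representing it is the projection.\<close>

lemma orth_proj:
  assumes U: "closed_subspace ip W U" and u: "u \<in> W"
  shows orth_proj_mem: "orth_proj ip U u \<in> U"
    and ip_orth_proj: "w \<in> U \<Longrightarrow> ip (orth_proj ip U u) w = ip u w"
proof -
  interpret U: hilbert_fun ip U by (rule closed_subspace_hilbert[OF U])
  have UW: "w \<in> U \<Longrightarrow> w \<in> W" for w using U by (auto simp: closed_subspace_def)
  have "\<exists>v\<in>U. \<forall>w\<in>U. ip w u = ip w v"
    by (rule U.Riesz[where K="hnorm ip u"])
      (use Cauchy_Schwarz[OF _ u] in \<open>simp_all add: UW u ip_lin mult.commute\<close>)
  then obtain v where v: "v \<in> U" "\<And>w. w \<in> U \<Longrightarrow> ip w u = ip w v" by blast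
  have v': "ip (\<lambda>p. u p - v' p) w = 0 \<longleftrightarrow> ip w u = ip w v'" if "v' \<in> U" "w \<in> U" for v' w
    using ip_diff[OF u UW UW] that ip_sym[OF UW[OF that(2)] u] ip_sym[OF UW[OF that(2)] UW[OF that(1)]] by auto
  have "orth_proj ip U u = v"
    unfolding orth_proj_def
  proof (rule the_equality)
    show "v \<in> U \<and> (\<forall>w\<in>U. ip (\<lambda>p. u p - v p) w = 0)" using v v' by blast
    fix v'' assume *: "v'' \<in> U \<and> (\<forall>w\<in>U. ip (\<lambda>p. u p - v'' p) w = 0)"
    show "v'' = v"
      by (rule U.ip_eqI) (use * v v' in auto)
  qed
  then show "orth_proj ip U u \<in> U" using v by simp
  show "ip (orth_proj ip U u) w = ip u w" if "w \<in> U"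
    using v(2)[OF that] ip_sym[OF UW[OF that] u] ip_sym[OF UW[OF that] UW[OF v(1)]] \<open>orth_proj ip U u = v\<close> by simp
qed

lemma orth_proj_eqI:
  assumes U: "closed_subspace ip W U" and u: "u \<in> W" and v: "v \<in> U" "\<And>w. w \<in> U \<Longrightarrow> ip v w = ip u w"
  shows "orth_proj ip U u = v"
proof -
  interpret U: hilbert_fun ip U by (rule closed_subspace_hilbert[OF U])
  note P = orth_proj[OF U u]
  show ?thesis
  proof (rule U.ip_eqI[OF P(1) v(1)])
    fix w assume w: "w \<in> U"
    show "ip w (orth_proj ip U u) = ip w v"
      unfolding U.ip_sym[OF P(1) w] U.ip_sym[OF v(1) w] P(2)[OF w] v(2)[OF w] ..
  qed
qed

lemma orth_proj_id:
  assumes U: "closed_subspace ip W U" and u: "u \<in> U" shows "orth_proj ip U u = u"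
  using assms by (intro orth_proj_eqI) (auto simp: closed_subspace_def)

lemma orth_proj_diff:
  assumes U: "closed_subspace ip W U" and u: "u \<in> W" and v: "v \<in> W"
  shows "orth_proj ip U (\<lambda>p. u p - v p) = (\<lambda>p. orth_proj ip U u p - orth_proj ip U v p)"
proof -
  have UW: "w \<in> U \<Longrightarrow> w \<in> W" for w using U by (auto simp: closed_subspace_def)
  note P = orth_proj[OF U u] and Q = orth_proj[OF U v]
  show ?thesis
  proof (rule orth_proj_eqI[OF U mem_diff[OF u v]])
    show "(\<lambda>p. orth_proj ip U u p - orth_proj ip U v p) \<in> U"
      using U P(1) Q(1) by (simp add: closed_subspace_def lin_subspace_diff)
    fix w assume w: "w \<in> U"
    show "ip (\<lambda>p. orth_proj ip U u p - orth_proj ip U v p) w = ip (\<lambda>p. u p - v p) w"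
      unfolding ip_diff[OF u v UW[OF w]] ip_diff[OF UW[OF P(1)] UW[OF Q(1)] UW[OF w]] P(2)[OF w] Q(2)[OF w] ..
  qed
qed

lemma orth_proj_norm:
  assumes U: "closed_subspace ip W U" and u: "u \<in> W"
  shows "hnorm ip (orth_proj ip U u) \<le> hnorm ip u"
proof -
  let ?v = "orth_proj ip U u"
  have UW: "w \<in> U \<Longrightarrow> w \<in> W" for w using U by (auto simp: closed_subspace_def)
  note P = orth_proj[OF U u]
  have v: "?v \<in> W" using P(1) UW by blast
  have "(hnorm ip ?v)\<^sup>2 \<le> cmod (ip ?v ?v)"
    unfolding hnorm_square[OF v] by (rule complex_Re_le_cmod)
  also have "\<dots> \<le> hnorm ip u * hnorm ip ?v"
    unfolding P(2)[OF P(1)] by (rule Cauchy_Schwarz[OF u v])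
  finally have "hnorm ip ?v * hnorm ip ?v \<le> hnorm ip u * hnorm ip ?v" by (simp add: power2_eq_square)
  then show ?thesis using hnorm_ge[OF v] hnorm_ge[OF u]
    by (cases "hnorm ip ?v = 0") auto
qed

lemma bounded_operator_id: "bounded_operator ip W W (\<lambda>u. u)"
  unfolding bounded_operator_def by (intro conjI exI[of _ 1]) auto

lemma bounded_operator_compose:
  assumes T: "bounded_operator ip W W T" and S: "bounded_operator ip W W S"
  shows "bounded_operator ip W W (\<lambda>u. S (T u))"
proof -
  note TD = bounded_operatorD[OF T] and SD = bounded_operatorD[OF S]
  obtain K where K: "K > 0" "\<And>u. u \<in> W \<Longrightarrow> hnorm ip (T u) \<le> K * hnorm ip u"
    using bounded_operator_bound[OF T] by blast
  obtain M where M: "M > 0" "\<And>u. u \<in> W \<Longrightarrow> hnorm ip (S u) \<le> M * hnorm ip u"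
    using bounded_operator_bound[OF S] by blast
  have "hnorm ip (S (T u)) \<le> (M * K) * hnorm ip u" if "u \<in> W" for u
    unfolding mult.assoc
    by (rule order_trans[OF M(2)[OF TD(1)[OF that]] mult_left_mono[OF K(2)[OF that] less_imp_le[OF M(1)]]])
  then show ?thesis
    unfolding bounded_operator_def by (intro conjI exI[of _ "M * K"]) (simp_all add: TD SD)
qed

text \<open>Here \<open>T\<close> may take values outside its domain \<open>U\<close>.\<close>

lemma bounded_operator_tendsto:
  assumes U: "U \<subseteq> W" "lin_subspace U" and T: "bounded_operator ip U W T"
    and X: "\<And>m. X m \<in> U" and u: "u \<in> U" and lim: "(\<lambda>m. hnorm ip (\<lambda>p. X m p - u p)) \<longlonglongrightarrow> 0"
  shows "(\<lambda>m. hnorm ip (\<lambda>p. T (X m) p - T u p)) \<longlonglongrightarrow> 0"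
proof -
  note TD = bounded_operatorD[OF T]
  obtain K where K: "\<And>u. u \<in> U \<Longrightarrow> hnorm ip (T u) \<le> K * hnorm ip u"
    using T unfolding bounded_operator_def by blast
  show ?thesis
  proof (rule tendsto_sandwich[of "\<lambda>_. 0"])
  show "(\<lambda>m. K * hnorm ip (\<lambda>p. X m p - u p)) \<longlonglongrightarrow> 0" using tendsto_mult_left[OF lim, of K] by simp
  show "\<forall>\<^sub>F m in sequentially. hnorm ip (\<lambda>p. T (X m) p - T u p) \<le> K * hnorm ip (\<lambda>p. X m p - u p)"
    using K[OF lin_subspace_diff[OF U(2) X u]] bounded_operator_diff[OF T U(2) X u] by simp
  show "\<forall>\<^sub>F m in sequentially. 0 \<le> hnorm ip (\<lambda>p. T (X m) p - T u p)"
    using hnorm_ge[OF mem_diff[OF TD(1)[OF X] TD(1)[OF u]]] by simp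
qed simp
qed

lemma hnorm_tendsto_unique:
  assumes X: "\<And>m. X m \<in> W" and u: "u \<in> W" and v: "v \<in> W"
    and "(\<lambda>m. hnorm ip (\<lambda>p. X m p - u p)) \<longlonglongrightarrow> 0" "(\<lambda>m. hnorm ip (\<lambda>p. X m p - v p)) \<longlonglongrightarrow> 0"
  shows "u = v"
proof (rule ip_eqI[OF u v])
  fix w assume w: "w \<in> W"
  have "ip u w = ip v w"
    by (rule LIMSEQ_unique[OF ip_tendsto[OF X u w assms(4)] ip_tendsto[OF X v w assms(5)]])
  then show "ip w u = ip w v" using ip_sym[OF u w] ip_sym[OF v w] by simp
qed

lemma hnorm_tendsto:
  assumes X: "\<And>m. X m \<in> W" and u: "u \<in> W" and lim: "(\<lambda>m. hnorm ip (\<lambda>p. X m p - u p)) \<longlonglongrightarrow> 0"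
  shows "(\<lambda>m. hnorm ip (X m)) \<longlonglongrightarrow> hnorm ip u"
proof (rule LIM_zero_cancel, rule tendsto_norm_zero_cancel, rule tendsto_sandwich[of "\<lambda>_. 0"])
  show "\<forall>\<^sub>F m in sequentially. norm (hnorm ip (X m) - hnorm ip u) \<le> hnorm ip (\<lambda>p. X m p - u p)"
  proof (rule always_eventually, rule allI)
    fix m
    show "norm (hnorm ip (X m) - hnorm ip u) \<le> hnorm ip (\<lambda>p. X m p - u p)"
      using hnorm_triangle[OF mem_diff[OF X[of m] u] u] hnorm_triangle[OF mem_diff[OF u X[of m]] X[of m]]
        hnorm_minus_commute[OF X[of m] u] by simp
  qed
qed (use lim in auto)

lemma ip_tendsto2:
  assumes X: "\<And>m. X m \<in> W" and u: "u \<in> W" and limX: "(\<lambda>m. hnorm ip (\<lambda>p. X m p - u p)) \<longlonglongrightarrow> 0"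
    and Y: "\<And>m. Y m \<in> W" and v: "v \<in> W" and limY: "(\<lambda>m. hnorm ip (\<lambda>p. Y m p - v p)) \<longlonglongrightarrow> 0"
  shows "(\<lambda>m. ip (X m) (Y m)) \<longlonglongrightarrow> ip u v"
proof -
  have "(\<lambda>m. ip (X m) (\<lambda>p. Y m p - v p)) \<longlonglongrightarrow> 0"
  proof (rule tendsto_norm_zero_cancel, rule tendsto_sandwich[of "\<lambda>_. 0"])
    show "(\<lambda>m. hnorm ip (X m) * hnorm ip (\<lambda>p. Y m p - v p)) \<longlonglongrightarrow> 0"
      using tendsto_mult[OF hnorm_tendsto[OF X u limX] limY] by simp
  qed (use Cauchy_Schwarz[OF X mem_diff[OF Y v]] in auto)
  from tendsto_add[OF this ip_tendsto[OF X u v limX]]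
  show ?thesis using X Y v by (simp add: ip_diff_right)
qed

end

section \<open>A countable dense set of sequences\<close>

text \<open>Finitely supported sequences with rational real and imaginary parts, indexed by lists
  over a countable type so that almost-everywhere statements can be quantified over them. Entries
  with a repeated index add up.\<close>

fun rational_seq :: "((int^'n::finite) \<times> rat \<times> rat) list \<Rightarrow> int^'n \<Rightarrow> complex" where
  "rational_seq [] = (\<lambda>p. 0)"
| "rational_seq ((k, a, b) # l) = (\<lambda>p. rational_seq l p + Complex (of_rat a) (of_rat b) * (if p = k then 1 else 0))"

lemma rational_seq_ell2: "rational_seq l \<in> ell2 s"
  by (induction l rule: rational_seq.induct) (auto intro!: ell2_zero ell2_add ell2_scale ell2_delta)

lemma rational_complex_dense: "e > 0 \<Longrightarrow> \<exists>a b. cmod (z - Complex (of_rat a) (of_rat b)) < e"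
proof -
  assume e: "e > 0"
  obtain a where a: "Re z - e / 2 < of_rat a" "of_rat a < Re z"
    using of_rat_dense[of "Re z - e / 2" "Re z"] e by auto
  obtain b where b: "Im z - e / 2 < of_rat b" "of_rat b < Im z"
    using of_rat_dense[of "Im z - e / 2" "Im z"] e by auto
  have "cmod (z - Complex (of_rat a) (of_rat b)) \<le> \<bar>Re z - of_rat a\<bar> + \<bar>Im z - of_rat b\<bar>"
    using cmod_le[of "z - Complex (of_rat a) (of_rat b)"] by simp
  also have "\<dots> < e" using a b by simp
  finally show ?thesis by blast
qed

lemma rational_seq_dense:
  assumes u: "u \<in> ell2 s" and e: "e > 0"
  shows "\<exists>l. hnorm (ell2_inner s) (\<lambda>p. u p - rational_seq l p) < e"
proof -
  interpret E: hilbert_fun "ell2_inner s" "ell2 s" by (rule ell2_hilbert)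
  let ?n = "hnorm (ell2_inner s)"
  let ?\<delta> = "\<lambda>k p. if p = k then 1 else 0 :: complex"
  have finite_case: "\<exists>l. ?n (\<lambda>p. (\<Sum>k\<in>F. u k * ?\<delta> k p) - rational_seq l p) < e" if "finite F" "e > 0" for F e
    using that
  proof (induction arbitrary: e)
    case empty
    then show ?case by (intro exI[of _ "[]"]) (simp add: E.hnorm_zero)
  next
    case (insert k F)
    have sF: "(\<lambda>p. \<Sum>k\<in>F. u k * ?\<delta> k p) \<in> ell2 s" using insert(1)
      by induction (auto intro!: ell2_zero ell2_add ell2_scale ell2_delta)
    obtain l where l: "?n (\<lambda>p. (\<Sum>k\<in>F. u k * ?\<delta> k p) - rational_seq l p) < e / 2"
      using insert.IH[of "e / 2"] insert.prems by auto
    define N where "N = ?n (?\<delta> k)"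
    have N: "N \<ge> 0" unfolding N_def by (rule E.hnorm_ge[OF ell2_delta])
    \<comment> \<open>The error in one coordinate is scaled by the norm \<open>N\<close> of the unit
      sequence at \<open>k\<close>; the \<open>+ 1\<close> guards the division.\<close>
    obtain a b where ab: "cmod (u k - Complex (of_rat a) (of_rat b)) < e / (2 * (N + 1))"
      using rational_complex_dense[of "e / (2 * (N + 1))" "u k"] insert.prems N by auto
    let ?q = "Complex (of_rat a) (of_rat b)"
    have "?n (\<lambda>p. (\<Sum>k\<in>insert k F. u k * ?\<delta> k p) - rational_seq ((k, a, b) # l) p)
       = ?n (\<lambda>p. ((\<Sum>k\<in>F. u k * ?\<delta> k p) - rational_seq l p) + (u k - ?q) * ?\<delta> k p)"
      using insert(1,2) by (intro arg_cong[of _ _ ?n]) (auto simp: algebra_simps)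
    also have "\<dots> \<le> ?n (\<lambda>p. (\<Sum>k\<in>F. u k * ?\<delta> k p) - rational_seq l p) + ?n (\<lambda>p. (u k - ?q) * ?\<delta> k p)"
      by (intro E.hnorm_triangle ell2_diff sF rational_seq_ell2 ell2_scale ell2_delta)
    also have "?n (\<lambda>p. (u k - ?q) * ?\<delta> k p) = cmod (u k - ?q) * N"
      unfolding N_def by (rule E.hnorm_scale[OF ell2_delta])
    also have "\<dots> \<le> e / (2 * (N + 1)) * N" using ab N by (intro mult_right_mono) auto
    also have "\<dots> \<le> e / 2" using N insert.prems by (simp add: field_simps)
    finally show ?case using l by (intro exI[of _ "(k, a, b) # l"]) simp
  qed
  \<comment> \<open>An exhaustion of the lattice by finite sets, taken from the enumeration
    \<open>to_nat\<close>; truncations of \<open>u\<close> to it converge by dominated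
    convergence.\<close>
  define F where "F m = {k :: int^'a. to_nat k < m}" for m
  have fin: "finite (F m)" for m
    unfolding F_def by (rule finite_imageD[of to_nat]) (auto intro: finite_subset[of _ "{..<m}"] inj_on_subset[OF inj_to_nat])
  define c where "c m = (\<lambda>p. \<Sum>k\<in>F m. u k * ?\<delta> k p)" for m
  have c_eq: "c m p = (if p \<in> F m then u p else 0)" for m p
    unfolding c_def using fin[of m] by (simp add: sum.If_cases if_distrib cong: if_cong)
  have c: "c m \<in> ell2 s" for m
    unfolding c_def using fin[of m] by induction (auto intro!: ell2_zero ell2_add ell2_scale ell2_delta)
  have int: "integrable counting (\<lambda>k. (cmod (weighted_seq s u k))\<^sup>2)"
    using u by (simp add: ell2_iff square_integrable_def)
  have "(\<lambda>m. LINT k|counting. (cmod (weighted_seq s u k - weighted_seq s (c m) k))\<^sup>2) \<longlonglongrightarrow> (LINT k::int^'a|counting. (0::real))"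
  proof (rule integral_dominated_convergence[OF _ _ int])
    show "AE k in counting. (\<lambda>m. (cmod (weighted_seq s u k - weighted_seq s (c m) k))\<^sup>2) \<longlonglongrightarrow> 0"
    proof (rule AE_I2)
      fix k :: "int^'a"
      have "\<forall>\<^sub>F m in sequentially. (cmod (weighted_seq s u k - weighted_seq s (c m) k))\<^sup>2 = 0"
        unfolding eventually_sequentially
        by (intro exI[of _ "Suc (to_nat k)"]) (auto simp: weighted_seq_def c_eq F_def)
      then show "(\<lambda>m. (cmod (weighted_seq s u k - weighted_seq s (c m) k))\<^sup>2) \<longlonglongrightarrow> 0" by (rule tendsto_eventually)
    qed
    show "AE k in counting. norm ((cmod (weighted_seq s u k - weighted_seq s (c m) k))\<^sup>2) \<le> (cmod (weighted_seq s u k))\<^sup>2" for m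
      by (rule AE_I2) (simp add: weighted_seq_def c_eq)
  qed auto
  then have "(\<lambda>m. (?n (\<lambda>p. u p - c m p))\<^sup>2) \<longlonglongrightarrow> 0"
    by (simp add: ell2_hnorm[OF ell2_diff[OF u c]] weighted_seq_arith)
  then have "\<forall>\<^sub>F m in sequentially. (?n (\<lambda>p. u p - c m p))\<^sup>2 < (e / 2)\<^sup>2"
    by (rule order_tendstoD(2)) (use e in simp)
  then obtain m where m: "(?n (\<lambda>p. u p - c m p))\<^sup>2 < (e / 2)\<^sup>2"
    by (auto simp: eventually_sequentially)
  then have m': "?n (\<lambda>p. u p - c m p) < e / 2" by (rule power2_less_imp_less) (use e in simp)
  obtain l where l: "?n (\<lambda>p. c m p - rational_seq l p) < e / 2"
    using finite_case[OF fin, of "e / 2" m] e unfolding c_def by auto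
  have "?n (\<lambda>p. u p - rational_seq l p) < e"
    using E.hnorm_diff_triangle[OF u c[of m] rational_seq_ell2[of l s]] m' l by simp
  then show ?thesis by blast
qed

section \<open>Range functions and range operators\<close>

lemma closed_subspace_limit:
  assumes W: "closed_subspace ip H W" and X: "\<And>m. X m \<in> W" and lim: "(\<lambda>m. hnorm ip (\<lambda>p. X m p - u p)) \<longlonglongrightarrow> 0"
    and u: "u \<in> H"
  shows "u \<in> W"
proof -
  have "\<forall>X u. (\<forall>m::nat. X m \<in> W) \<and> u \<in> H \<and> (\<lambda>m. hnorm ip (\<lambda>p. X m p - u p)) \<longlonglongrightarrow> 0 \<longrightarrow> u \<in> W"
    by (rule W[unfolded closed_subspace_def, THEN conjunct2, THEN conjunct2])
  from this[rule_format, of X u] show ?thesis using X u lim by simp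
qed

text \<open>Completeness of Lebesgue measure, applied after extension by zero from the torus to the
  whole space.\<close>

lemma torus_measurable_AE:
  fixes f g :: "real^'n::finite \<Rightarrow> complex"
  assumes f: "f \<in> borel_measurable torus_measure" and eq: "AE t in torus_measure. f t = g t"
  shows "g \<in> borel_measurable torus_measure"
proof -
  have iff: "h \<in> borel_measurable torus_measure \<longleftrightarrow> (\<lambda>t. indicator torus t *\<^sub>R h t) \<in> borel_measurable lebesgue"
    for h :: "real^'n \<Rightarrow> complex"
    by (rule borel_measurable_restrict_space_iff) simp
  have "AE t in lebesgue. t \<in> torus \<longrightarrow> f t = g t"
    using eq by (subst (asm) AE_restrict_space_iff) auto
  then have "AE t in lebesgue. indicator torus t *\<^sub>R f t = indicator torus t *\<^sub>R g t"
    by eventually_elim (auto simp: indicator_def)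
  with f[unfolded iff] show ?thesis unfolding iff by (rule borel_measurable_AE)
qed

text \<open>Pairing with unit sequences reads off coordinates; this is how a measurable range
  function yields measurable coordinates of projections.\<close>

lemma ell2_inner_delta: "ell2_inner s c (\<lambda>p. if p = k then 1 else 0) = c k * complex_of_real ((mu s (lattice_vec k))\<^sup>2)"
proof -
  have "ell2_inner s c (\<lambda>p. if p = k then 1 else 0)
     = (\<Sum>\<^sub>\<infinity>p\<in>{k}. c p * cnj (if p = k then 1 else 0) * complex_of_real ((mu s (lattice_vec p))\<^sup>2))"
    unfolding ell2_inner_def by (rule infsum_cong_neutral) auto
  then show ?thesis by simp
qed

text \<open>Equals the inner product of the fibers wherever both lie in \<open>ell2 s\<close>, that
  is almost everywhere; being a section integral in Fubini's theorem, it comes with integrability in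
  \<open>t\<close>.\<close>

definition fiber_inner ::
  "real \<Rightarrow> ((real^'n::finite \<Rightarrow> complex) \<Rightarrow> complex) \<Rightarrow> ((real^'n \<Rightarrow> complex) \<Rightarrow> complex) \<Rightarrow> real^'n \<Rightarrow> complex" where
  "fiber_inner s f g t = (LINT k|counting. weighted_fourier s f (t + lattice_vec k) * cnj (weighted_fourier s g (t + lattice_vec k)))"

lemma fiber_inner:
  assumes f: "f \<in> sobolev s" and g: "g \<in> sobolev s"
  shows fiber_inner_integrable: "integrable torus_measure (fiber_inner s f g)"
    and sobolev_inner_fiber_inner: "sobolev_inner s f g = (LINT t|torus_measure. fiber_inner s f g t)"
    and fiber_inner_AE: "AE t in torus_measure. ell2_inner s (fiber_map s f t) (fiber_map s g t) = fiber_inner s f g t"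
  using sobolev_inner_fiber[OF assms] unfolding fiber_inner_def[abs_def] .

text \<open>Used with \<open>a\<close> and \<open>b\<close> equal to 1 or to the value of an
  indicator at \<open>t\<close>.\<close>

lemma fiber_inner_cong:
  assumes "\<And>k. fiber_map s f t k = a * fiber_map s f' t k" "\<And>k. fiber_map s g t k = b * fiber_map s g' t k"
  shows "fiber_inner s f g t = a * cnj b * fiber_inner s f' g' t"
proof -
  have "weighted_fourier s f (t + lattice_vec k) * cnj (weighted_fourier s g (t + lattice_vec k))
     = a * cnj b * (weighted_fourier s f' (t + lattice_vec k) * cnj (weighted_fourier s g' (t + lattice_vec k)))" for k
    unfolding weighted_fiber[symmetric] using assms by (simp add: weighted_seq_def)
  then show ?thesis by (simp add: fiber_inner_def)
qed

lemma fiber_map_measurable: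
  assumes "f \<in> sobolev s" shows "(\<lambda>t. fiber_map s f t k) \<in> borel_measurable torus_measure"
proof -
  have "weighted_fourier s f \<in> borel_measurable lebesgue"
    using sobolevD(3)[OF assms] by (simp add: square_integrable_def)
  from measurable_compose[OF lebesgue_translation(1) this]
  have "(\<lambda>t. weighted_fourier s f (t + lattice_vec k)) \<in> borel_measurable torus_measure"
    by (rule measurable_restrict_space1)
  then have "(\<lambda>t. weighted_fourier s f (t + lattice_vec k) / complex_of_real (mu s (lattice_vec k))) \<in> borel_measurable torus_measure"
    by (intro borel_measurable_divide borel_measurable_const)
  moreover have "weighted_fourier s f (t + lattice_vec k) / complex_of_real (mu s (lattice_vec k)) = fiber_map s f t k" for t
    unfolding weighted_fiber[symmetric] by (simp add: weighted_seq_def mu_nonzero)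
  ultimately show ?thesis by simp
qed

lemma lattice_vec_minus: "lattice_vec (- k) = - lattice_vec k"
  by (simp add: lattice_vec_def vec_eq_iff)

text \<open>On the Fourier side a shift multiplies by a character of modulus 1, whose conjugate
  belongs to the opposite shift.\<close>

lemma sobolev_inner_shift:
  assumes u: "u \<in> sobolev s" "shift (- k) u \<in> sobolev s" and v: "v \<in> sobolev s" "shift k v \<in> sobolev s"
  shows "sobolev_inner s u (shift k v) = sobolev_inner s (shift (- k) u) v"
proof -
  have "AE t in lebesgue. weighted_fourier s u t * cnj (weighted_fourier s (shift k v) t)
     = weighted_fourier s (shift (- k) u) t * cnj (weighted_fourier s v t)"
    using fourier_fun_shift[OF v(1), of k] fourier_fun_shift[OF u(1), of "- k"]
    by eventually_elim (simp add: weighted_fourier_def lattice_vec_minus fchar_minus mult_ac)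
  from sobolev_inner_cong_AE[OF u(1) v(2) borel_measurable_integrable[OF sobolev_integrable[OF u(2) v(1)]] this]
  show ?thesis by (simp only: sobolev_inner_eq[of s "shift (- k) u"])
qed

section \<open>Elements of a shift-invariant space with prescribed fibers\<close>

locale si_space =
  fixes s :: real and V :: "((real^'n::finite \<Rightarrow> complex) \<Rightarrow> complex) set"
    and J :: "real^'n \<Rightarrow> (int^'n \<Rightarrow> complex) set"
  assumes csi: "closed_shift_invariant s V" and arf: "associated_range_function s V J"
begin

abbreviation "SI \<equiv> sobolev_inner s"
abbreviation "EI \<equiv> ell2_inner s"
abbreviation "proj t \<equiv> orth_proj EI (J t)"
abbreviation "fib \<equiv> fiber_map s"
abbreviation "en \<equiv> hnorm EI"

lemma V_closed: "closed_subspace SI (sobolev s) V" and V_shift: "f \<in> V \<Longrightarrow> shift k f \<in> V"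
  using csi by (auto simp: closed_shift_invariant_def)

lemma V_sobolev: "f \<in> V \<Longrightarrow> f \<in> sobolev s"
  using V_closed by (auto simp: closed_subspace_def)

lemma V_iff: "f \<in> V \<longleftrightarrow> f \<in> sobolev s \<and> (AE t in torus_measure. fib f t \<in> J t)"
  using arf by (auto simp: associated_range_function_def)

lemma J_closed: "t \<in> torus \<Longrightarrow> closed_subspace EI (ell2 s) (J t)"
  using arf by (auto simp: associated_range_function_def measurable_range_function_def)

lemma J_ell2: "t \<in> torus \<Longrightarrow> a \<in> J t \<Longrightarrow> a \<in> ell2 s"
  using J_closed by (auto simp: closed_subspace_def)

lemma J_sub: "t \<in> torus \<Longrightarrow> lin_subspace (J t)"
  using J_closed by (auto simp: closed_subspace_def)

lemma proj_measurable: "a \<in> ell2 s \<Longrightarrow> b \<in> ell2 s \<Longrightarrow> (\<lambda>t. EI (proj t a) b) \<in> borel_measurable torus_measure"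
  using arf by (auto simp: associated_range_function_def measurable_range_function_def)

sublocale S: hilbert_fun SI "sobolev s" by (rule sobolev_hilbert)
sublocale VH: hilbert_fun SI V by (rule S.closed_subspace_hilbert[OF V_closed])
sublocale E: hilbert_fun EI "ell2 s" by (rule ell2_hilbert)

lemma J_hilbert: "t \<in> torus \<Longrightarrow> hilbert_fun EI (J t)"
  by (rule E.closed_subspace_hilbert[OF J_closed])

lemma proj_J: "t \<in> torus \<Longrightarrow> a \<in> ell2 s \<Longrightarrow> proj t a \<in> J t"
  by (rule E.orth_proj_mem[OF J_closed])

lemma AE_torus: "AE t in torus_measure. t \<in> torus"
  by (rule AE_I2) simp

lemma V_AE: "f \<in> V \<Longrightarrow> AE t in torus_measure. fib f t \<in> J t"
  by (simp add: V_iff)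

text \<open>\<open>a\<close> is constant and the torus has finite measure, so \<open>|a|^2\<close>
  is an integrable majorant for the projected fibers.\<close>

lemma proj_element:
  assumes a: "a \<in> ell2 s"
  obtains f where "f \<in> V" "AE t in torus_measure. fib f t = proj t a"
proof -
  have meas: "(\<lambda>t. proj t a k) \<in> borel_measurable torus_measure" for k
  proof -
    have "(\<lambda>t. EI (proj t a) (\<lambda>p. if p = k then 1 else 0) / complex_of_real ((mu s (lattice_vec k))\<^sup>2)) \<in> borel_measurable torus_measure"
      by (intro borel_measurable_divide borel_measurable_const proj_measurable a ell2_delta)
    then show ?thesis by (simp add: ell2_inner_delta mu_nonzero)
  qed
  have PJ: "AE t in torus_measure. proj t a \<in> J t"
    using AE_torus by eventually_elim (rule proj_J[OF _ a])
  have Pe: "AE t in torus_measure. proj t a \<in> ell2 s"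
    using AE_torus PJ by eventually_elim (rule J_ell2)
  have bound: "AE t in torus_measure. (en (proj t a))\<^sup>2 \<le> (en a)\<^sup>2"
    using AE_torus Pe
    by eventually_elim (intro power_mono E.orth_proj_norm J_closed a E.hnorm_ge)
  have "integrable torus_measure (\<lambda>t. (en a)\<^sup>2)" by simp
  from fiber_surj[OF meas Pe this bound]
  obtain f where f: "f \<in> sobolev s" "AE t in torus_measure. fib f t = proj t a" .
  have "AE t in torus_measure. fib f t \<in> J t" using f(2) PJ by eventually_elim simp
  then have "f \<in> V" using f(1) by (simp add: V_iff)
  then show ?thesis using f(2) by (rule that)
qed

lemma cutoff:
  assumes f: "f \<in> V" and A: "A \<in> sets torus_measure"
  obtains g where "g \<in> V" "AE t in torus_measure. fib g t = (\<lambda>k. indicator A t * fib f t k)"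
proof -
  note fs = V_sobolev[OF f]
  let ?G = "\<lambda>t k. indicator A t * fib f t k"
  have meas: "(\<lambda>t. ?G t k) \<in> borel_measurable torus_measure" for k
    by (intro borel_measurable_times fiber_map_measurable[OF fs] borel_measurable_indicator A)
  have GJ: "AE t in torus_measure. ?G t \<in> J t"
    using AE_torus V_AE[OF f] by eventually_elim (rule lin_subspace_scale[OF J_sub])
  have Ge: "AE t in torus_measure. ?G t \<in> ell2 s"
    using AE_torus GJ by eventually_elim (rule J_ell2)
  \<comment> \<open>The fiber norms of \<open>f\<close> itself provide the majorant.\<close>
  have b: "integrable torus_measure (\<lambda>t. Re (fiber_inner s f f t))"
    by (rule integrable_Re[OF fiber_inner_integrable[OF fs fs]])
  have bound: "AE t in torus_measure. (en (?G t))\<^sup>2 \<le> Re (fiber_inner s f f t)"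
    using fiber_in_ell2[OF fs] fiber_inner_AE[OF fs fs]
  proof eventually_elim
    case (elim t)
    have "en (?G t) = cmod (indicator A t) * en (fib f t)" by (rule E.hnorm_scale[OF elim(1)])
    also have "\<dots> \<le> en (fib f t)" using E.hnorm_ge[OF elim(1)] by (simp add: indicator_def)
    finally have "(en (?G t))\<^sup>2 \<le> (en (fib f t))\<^sup>2"
      using E.hnorm_ge[OF ell2_scale[OF elim(1)]] by (intro power_mono)
    then show ?case using E.hnorm_square[OF elim(1)] elim(2) by simp
  qed
  from fiber_surj[OF meas Ge b bound]
  obtain g where g: "g \<in> sobolev s" "AE t in torus_measure. fib g t = ?G t" .
  have "AE t in torus_measure. fib g t \<in> J t" using g(2) GJ by eventually_elim simp
  then have "g \<in> V" using g(1) by (simp add: V_iff)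
  then show ?thesis using g(2) by (rule that)
qed

text \<open>The null set in the hypothesis may depend on \<open>f\<close>; countably many of them
  are united. \<open>Q\<close> is arbitrary, so the passage to all of \<open>J t\<close> is left to
  a continuity argument at each \<open>t\<close>.\<close>

lemma AE_test:
  assumes "\<And>f. f \<in> V \<Longrightarrow> AE t in torus_measure. Q t (fib f t)"
  shows "AE t in torus_measure. \<forall>l. Q t (proj t (rational_seq l))"
proof -
  have "AE t in torus_measure. Q t (proj t (rational_seq l))" for l
  proof -
    obtain f where f: "f \<in> V" "AE t in torus_measure. fib f t = proj t (rational_seq l)"
      using proj_element[OF rational_seq_ell2] .
    show ?thesis using assms[OF f(1)] f(2) by eventually_elim simp
  qed
  then show ?thesis by (simp add: AE_all_countable)
qed

text \<open>The projection fixes \<open>x\<close> and does not increase norms, so projecting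
  rational approximations of \<open>x\<close> gives approximations inside
  \<open>J t\<close>.\<close>

lemma proj_dense:
  assumes t: "t \<in> torus" and x: "x \<in> J t"
  obtains X where "\<And>m. \<exists>l. X m = proj t (rational_seq l)" "\<And>m. X m \<in> J t"
    "(\<lambda>m. en (\<lambda>p. X m p - x p)) \<longlonglongrightarrow> 0"
proof -
  note xe = J_ell2[OF t x]
  have "\<exists>l. en (\<lambda>p. x p - rational_seq l p) < 1 / Suc m" for m
    by (rule rational_seq_dense[OF xe]) simp
  then obtain l where l: "\<And>m. en (\<lambda>p. x p - rational_seq (l m) p) < 1 / Suc m" by metis
  define X where "X m = proj t (rational_seq (l m))" for m
  have XJ: "X m \<in> J t" for m unfolding X_def by (rule proj_J[OF t rational_seq_ell2])
  have est: "en (\<lambda>p. X m p - x p) \<le> 1 / Suc m" for m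
  proof -
    have "en (\<lambda>p. X m p - x p) = en (\<lambda>p. x p - X m p)"
      by (rule E.hnorm_minus_commute[OF J_ell2[OF t XJ] xe])
    also have "(\<lambda>p. x p - X m p) = proj t (\<lambda>p. x p - rational_seq (l m) p)"
      unfolding E.orth_proj_diff[OF J_closed[OF t] xe rational_seq_ell2] E.orth_proj_id[OF J_closed[OF t] x] X_def ..
    also have "en \<dots> \<le> en (\<lambda>p. x p - rational_seq (l m) p)"
      by (rule E.orth_proj_norm[OF J_closed[OF t] ell2_diff[OF xe rational_seq_ell2]])
    also have "\<dots> \<le> 1 / Suc m" using l[of m] by simp
    finally show ?thesis .
  qed
  have "(\<lambda>m. en (\<lambda>p. X m p - x p)) \<longlonglongrightarrow> 0"
  proof (rule tendsto_sandwich[of "\<lambda>_. 0"])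
    show "(\<lambda>m. 1 / real (Suc m)) \<longlonglongrightarrow> 0"
      using LIMSEQ_inverse_real_of_nat by (simp add: inverse_eq_divide)
    show "\<forall>\<^sub>F m in sequentially. 0 \<le> en (\<lambda>p. X m p - x p)"
      using E.hnorm_ge[OF ell2_diff[OF J_ell2[OF t XJ] xe]] by simp
  qed (use est in auto)
  moreover have "\<exists>l. X m = proj t (rational_seq l)" for m unfolding X_def by blast
  ultimately show ?thesis using XJ that by blast
qed

lemma bounded_operator_J:
  assumes t: "t \<in> torus" and T: "bounded_operator EI (J t) U T" and "\<And>x. x \<in> J t \<Longrightarrow> T x \<in> U'"
  shows "bounded_operator EI (J t) U' T"
  using assms(2,3) unfolding bounded_operator_def by blast

text \<open>At each good \<open>t\<close> two bounded operators agree on a dense subset of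
  \<open>J t\<close>, hence on all of it. Boundedness enters for one \<open>t\<close> at a
  time.\<close>

lemma AE_operator_unique:
  assumes T1: "AE t in torus_measure. bounded_operator EI (J t) (ell2 s) (T1 t)"
    and T2: "AE t in torus_measure. bounded_operator EI (J t) (ell2 s) (T2 t)"
    and eq: "\<And>f. f \<in> V \<Longrightarrow> AE t in torus_measure. T1 t (fib f t) = T2 t (fib f t)"
  shows "AE t in torus_measure. \<forall>x\<in>J t. T1 t x = T2 t x"
proof -
  have "AE t in torus_measure. \<forall>l. T1 t (proj t (rational_seq l)) = T2 t (proj t (rational_seq l))"
    by (rule AE_test) (rule eq)
  then show ?thesis using T1 T2 AE_torus
  proof eventually_elim
    case (elim t)
    note t = elim(4)
    have Jt: "J t \<subseteq> ell2 s" using J_ell2[OF t] by blast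
    show ?case
    proof
      fix x assume x: "x \<in> J t"
      obtain X where X: "\<And>m. \<exists>l. X m = proj t (rational_seq l)" "\<And>m. X m \<in> J t"
        and lim: "(\<lambda>m. en (\<lambda>p. X m p - x p)) \<longlonglongrightarrow> 0" by (rule proj_dense[OF t x]) blast
      have same: "T1 t (X m) = T2 t (X m)" for m using elim(1) X(1)[of m] by auto
      show "T1 t x = T2 t x"
      proof (rule E.hnorm_tendsto_unique)
        show "(\<lambda>m. en (\<lambda>p. T1 t (X m) p - T1 t x p)) \<longlonglongrightarrow> 0"
          by (rule E.bounded_operator_tendsto[OF Jt J_sub[OF t] elim(2) X(2) x lim])
        show "(\<lambda>m. en (\<lambda>p. T1 t (X m) p - T2 t x p)) \<longlonglongrightarrow> 0"
          unfolding same by (rule E.bounded_operator_tendsto[OF Jt J_sub[OF t] elim(3) X(2) x lim])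
        show "T1 t (X m) \<in> ell2 s" for m by (rule bounded_operatorD(1)[OF elim(2) X(2)])
        show "T1 t x \<in> ell2 s" by (rule bounded_operatorD(1)[OF elim(2) x])
        show "T2 t x \<in> ell2 s" by (rule bounded_operatorD(1)[OF elim(3) x])
      qed
    qed
  qed
qed

end

section \<open>The adjoint of a shift-preserving operator and its fibers\<close>

locale si_operator = si_space +
  fixes L R
  assumes sp: "shift_preserving s V V L" and cro: "corresponding_range_operator s V J L R"
begin

lemma L_bounded: "bounded_operator SI V V L" and L_shift: "f \<in> V \<Longrightarrow> L (shift k f) = shift k (L f)"
  using sp by (auto simp: shift_preserving_def)

lemma L_V: "f \<in> V \<Longrightarrow> L f \<in> V"
  by (rule bounded_operatorD(1)[OF L_bounded])

lemma R_bounded_ell2: "AE t in torus_measure. bounded_operator EI (J t) (ell2 s) (R t)"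
  and R_measurable: "a \<in> ell2 s \<Longrightarrow> b \<in> ell2 s \<Longrightarrow> (\<lambda>t. EI (R t (proj t a)) b) \<in> borel_measurable torus_measure"
  and R_fib: "f \<in> V \<Longrightarrow> AE t in torus_measure. fib (L f) t = R t (fib f t)"
  using cro by (auto simp: corresponding_range_operator_def measurable_range_operator_def)

text \<open>By definition a range operator takes values in \<open>ell2 s\<close>. That it maps
  \<open>J t\<close> into itself comes from \<open>L\<close> mapping \<open>V\<close> into
  \<open>V\<close>: on a dense set directly, elsewhere by closedness of \<open>J t\<close>.\<close>

lemma R_bounded: "AE t in torus_measure. bounded_operator EI (J t) (J t) (R t)"
proof -
  have "AE t in torus_measure. \<forall>l. R t (proj t (rational_seq l)) \<in> J t"
  proof (rule AE_test)
    fix f assume f: "f \<in> V"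
    show "AE t in torus_measure. R t (fib f t) \<in> J t"
      using R_fib[OF f] V_AE[OF L_V[OF f]] by eventually_elim simp
  qed
  then show ?thesis using R_bounded_ell2 AE_torus
  proof eventually_elim
    case (elim t)
    note t = elim(3)
    have Jt: "J t \<subseteq> ell2 s" using J_ell2[OF t] by blast
    have "R t x \<in> J t" if x: "x \<in> J t" for x
    proof -
      obtain X where X: "\<And>m. \<exists>l. X m = proj t (rational_seq l)" "\<And>m. X m \<in> J t"
        and lim: "(\<lambda>m. en (\<lambda>p. X m p - x p)) \<longlonglongrightarrow> 0" by (rule proj_dense[OF t x]) blast
      have RX: "R t (X m) \<in> J t" for m using elim(1) X(1)[of m] by auto
      have lim': "(\<lambda>m. en (\<lambda>p. R t (X m) p - R t x p)) \<longlonglongrightarrow> 0"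
        by (rule E.bounded_operator_tendsto[OF Jt J_sub[OF t] elim(2) X(2) x lim])
      have "R t x \<in> ell2 s" by (rule bounded_operatorD(1)[OF elim(2) x])
      with RX lim' show ?thesis by (rule closed_subspace_limit[OF J_closed[OF t]])
    qed
    then show ?case by (rule bounded_operator_J[OF t elim(2)])
  qed
qed

abbreviation "La \<equiv> adjoint_on SI V L"
abbreviation "Ra t \<equiv> adjoint_on EI (J t) (R t)"

lemma La_bounded: "bounded_operator SI V V La"
  by (rule VH.adjoint_bounded[OF L_bounded])

lemma La_V: "f \<in> V \<Longrightarrow> La f \<in> V"
  by (rule VH.adjoint_mem[OF L_bounded])

text \<open>The adjoint of \<open>shift k\<close> is \<open>shift (- k)\<close>, and
  \<open>L\<close> commutes with that one too.\<close>

lemma La_shift: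
  assumes f: "f \<in> V" shows "La (shift k f) = shift k (La f)"
proof (rule VH.adjoint_eqI[OF L_bounded])
  fix u assume u: "u \<in> V"
  have "SI (L u) (shift k f) = SI (shift (- k) (L u)) f"
    by (rule sobolev_inner_shift) (intro V_sobolev V_shift L_V u f)+
  also have "\<dots> = SI (L (shift (- k) u)) f" by (simp add: L_shift[OF u])
  also have "\<dots> = SI (shift (- k) u) (La f)"
    by (rule VH.ip_adjoint[OF L_bounded f V_shift[OF u], symmetric])
  also have "\<dots> = SI u (shift k (La f))"
    by (rule sobolev_inner_shift[symmetric]) (intro V_sobolev V_shift La_V u f)+
  finally show "SI (L u) (shift k f) = SI u (shift k (La f))" .
qed (intro V_shift La_V f)+

text \<open>Commuting with shifts gives compatibility with characters; since \<open>L\<close> acts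
  on fibers by the linear maps \<open>R t\<close>, it is compatible with arbitrary scalar factors
  depending on \<open>t\<close>, in particular with indicators.\<close>

lemma cutoff_L:
  assumes f: "f \<in> V" and A: "A \<in> sets torus_measure"
  obtains g where "g \<in> V" "AE t in torus_measure. fib g t = (\<lambda>k. indicator A t * fib f t k)"
    "AE t in torus_measure. fib (L g) t = (\<lambda>k. indicator A t * fib (L f) t k)"
proof -
  obtain g where g: "g \<in> V" "AE t in torus_measure. fib g t = (\<lambda>k. indicator A t * fib f t k)"
    using cutoff[OF f A] .
  have "AE t in torus_measure. fib (L g) t = (\<lambda>k. indicator A t * fib (L f) t k)"
    using R_fib[OF g(1)] R_fib[OF f] g(2) R_bounded V_AE[OF f]
    by eventually_elim (simp add: bounded_operatorD(3))
  then show ?thesis using that g by blast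
qed

lemma indicator_torus_integral:
  fixes F :: "real^'a \<Rightarrow> complex"
  assumes "AE t in torus_measure. G t = indicator A t * F t" and "integrable torus_measure F" "integrable torus_measure G" "A \<in> sets torus_measure"
  shows "(LINT t|torus_measure. G t) = (LINT t:A|torus_measure. F t)"
  unfolding set_lebesgue_integral_def
proof (rule integral_cong_AE)
  show "G \<in> borel_measurable torus_measure" using assms(3) by (rule borel_measurable_integrable)
  show "(\<lambda>t. indicator A t *\<^sub>R F t) \<in> borel_measurable torus_measure"
    using borel_measurable_integrable[OF assms(2)] assms(4) by (intro borel_measurable_scaleR borel_measurable_indicator)
  show "AE t in torus_measure. G t = indicator A t *\<^sub>R F t"
    using assms(1) by eventually_elim (auto simp: indicator_def)
qed

text \<open>Cutting \<open>f\<close> to an arbitrary measurable set \<open>A\<close> turns the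
  scalar equation \<open>SI h (La g) = SI (L h) g\<close> into an equality of integrals over
  \<open>A\<close>, and integrable functions with equal integrals over all \<open>A\<close> agree
  almost everywhere.\<close>

lemma adjoint_fib_inner:
  assumes f: "f \<in> V" and g: "g \<in> V"
  shows "AE t in torus_measure. EI (fib f t) (fib (La g) t) = EI (R t (fib f t)) (fib g t)"
proof -
  note fs = V_sobolev[OF f] and gs = V_sobolev[OF g]
  note Lfs = V_sobolev[OF L_V[OF f]] and Lags = V_sobolev[OF La_V[OF g]]
  have "AE t in torus_measure. fiber_inner s f (La g) t = fiber_inner s (L f) g t"
  proof (rule sigma_finite_measure.density_unique_banach)
    show "sigma_finite_measure (torus_measure :: (real^'a) measure)" by (rule torus.sigma_finite_measure_axioms)
    show "integrable torus_measure (fiber_inner s f (La g))" by (rule fiber_inner_integrable[OF fs Lags])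
    show "integrable torus_measure (fiber_inner s (L f) g)" by (rule fiber_inner_integrable[OF Lfs gs])
    fix A assume A: "A \<in> sets (torus_measure :: (real^'a) measure)"
    obtain h where h: "h \<in> V" "AE t in torus_measure. fib h t = (\<lambda>k. indicator A t * fib f t k)"
      "AE t in torus_measure. fib (L h) t = (\<lambda>k. indicator A t * fib (L f) t k)"
      using cutoff_L[OF f A] .
    note hs = V_sobolev[OF h(1)] and Lhs = V_sobolev[OF L_V[OF h(1)]]
    have "(LINT t:A|torus_measure. fiber_inner s f (La g) t) = (LINT t|torus_measure. fiber_inner s h (La g) t)"
    proof (rule indicator_torus_integral[symmetric, OF _ fiber_inner_integrable[OF fs Lags] fiber_inner_integrable[OF hs Lags] A])
      show "AE t in torus_measure. fiber_inner s h (La g) t = indicator A t * fiber_inner s f (La g) t"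
        using h(2) by eventually_elim (use fiber_inner_cong[of s h _ _ f "La g" 1 "La g"] in simp)
    qed
    also have "\<dots> = SI h (La g)" by (rule sobolev_inner_fiber_inner[OF hs Lags, symmetric])
    also have "\<dots> = SI (L h) g" by (rule VH.ip_adjoint[OF L_bounded g h(1)])
    also have "\<dots> = (LINT t|torus_measure. fiber_inner s (L h) g t)" by (rule sobolev_inner_fiber_inner[OF Lhs gs])
    also have "\<dots> = (LINT t:A|torus_measure. fiber_inner s (L f) g t)"
    proof (rule indicator_torus_integral[OF _ fiber_inner_integrable[OF Lfs gs] fiber_inner_integrable[OF Lhs gs] A])
      show "AE t in torus_measure. fiber_inner s (L h) g t = indicator A t * fiber_inner s (L f) g t"
        using h(3) by eventually_elim (use fiber_inner_cong[of s "L h" _ _ "L f" g 1 g] in simp)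
    qed
    finally show "(LINT t:A|torus_measure. fiber_inner s f (La g) t) = (LINT t:A|torus_measure. fiber_inner s (L f) g t)" .
  qed
  then show ?thesis
    using fiber_inner_AE[OF fs Lags] fiber_inner_AE[OF Lfs gs] R_fib[OF f] by eventually_elim simp
qed

text \<open>For fixed \<open>g\<close> the preceding identity holds against a dense set of vectors
  of \<open>J t\<close>, hence against all of them, and this characterises the adjoint of
  \<open>R t\<close>.\<close>

theorem fib_adjoint:
  assumes g: "g \<in> V"
  shows "AE t in torus_measure. fib (La g) t = Ra t (fib g t)"
proof -
  have "AE t in torus_measure. \<forall>l. EI (proj t (rational_seq l)) (fib (La g) t) = EI (R t (proj t (rational_seq l))) (fib g t)"
    by (rule AE_test) (rule adjoint_fib_inner[OF _ g])
  then show ?thesis using R_bounded V_AE[OF g] V_AE[OF La_V[OF g]] AE_torus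
  proof eventually_elim
    case (elim t)
    note t = elim(5)
    interpret J: hilbert_fun EI "J t" by (rule J_hilbert[OF t])
    show ?case
    proof (rule J.ip_eqI[OF elim(4) J.adjoint_mem[OF elim(2,3)]])
      fix x assume x: "x \<in> J t"
      obtain X where X: "\<And>m. \<exists>l. X m = proj t (rational_seq l)" "\<And>m. X m \<in> J t"
        and lim: "(\<lambda>m. en (\<lambda>p. X m p - x p)) \<longlonglongrightarrow> 0" by (rule proj_dense[OF t x]) blast
      have "EI (X m) (fib (La g) t) = EI (X m) (Ra t (fib g t))" for m
        using elim(1) X(1)[of m] J.ip_adjoint[OF elim(2,3) X(2)] by auto
      then have "(\<lambda>m. EI (X m) (Ra t (fib g t))) \<longlonglongrightarrow> EI x (fib (La g) t)"
        using J.ip_tendsto[OF X(2) x elim(4) lim] by simp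
      then show "EI x (fib (La g) t) = EI x (Ra t (fib g t))"
        by (rule LIMSEQ_unique[OF _ J.ip_tendsto[OF X(2) x J.adjoint_mem[OF elim(2,3)] lim]])
    qed
  qed
qed

lemma Ra_bounded: "AE t in torus_measure. bounded_operator EI (J t) (J t) (Ra t)"
  using R_bounded AE_torus
  by eventually_elim (rule hilbert_fun.adjoint_bounded[OF J_hilbert])

lemma into_ell2:
  assumes "AE t in torus_measure. bounded_operator EI (J t) (J t) (T t)"
  shows "AE t in torus_measure. bounded_operator EI (J t) (ell2 s) (T t)"
  using assms AE_torus
proof eventually_elim
  case (elim t)
  show ?case
    by (rule bounded_operator_J[OF elim(2,1)]) (rule J_ell2[OF elim(2) bounded_operatorD(1)[OF elim(1)]])
qed

text \<open>Adjunction and symmetry of the projection rewrite the function as the conjugate of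
  \<open>EI (R t (proj t b)) a\<close>. The two agree where \<open>R t\<close> is bounded on
  \<open>J t\<close>, so measurability is transferred across a null set.\<close>

lemma Ra_measurable:
  assumes a: "a \<in> ell2 s" and b: "b \<in> ell2 s"
  shows "(\<lambda>t. EI (Ra t (proj t a)) b) \<in> borel_measurable torus_measure"
proof (rule torus_measurable_AE)
  show "(\<lambda>t. cnj (EI (R t (proj t b)) a)) \<in> borel_measurable torus_measure"
    by (rule borel_measurable_cnj[OF R_measurable[OF b a]])
  show "AE t in torus_measure. cnj (EI (R t (proj t b)) a) = EI (Ra t (proj t a)) b"
    using R_bounded AE_torus
  proof eventually_elim
    case (elim t)
    note t = elim(2)
    interpret J: hilbert_fun EI "J t" by (rule J_hilbert[OF t])
    note Pa = proj_J[OF t a] and Pb = proj_J[OF t b]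
    note RPb = bounded_operatorD(1)[OF elim(1) Pb] and RaPa = J.adjoint_mem[OF elim(1) Pa]
    note ab = E.ip_orth_proj[OF J_closed[OF t] a] E.ip_orth_proj[OF J_closed[OF t] b]
    have "EI (R t (proj t b)) a = EI (R t (proj t b)) (proj t a)"
      using ab(1)[OF RPb] E.ip_sym[OF a J_ell2[OF t RPb]] J.ip_sym[OF Pa RPb] by simp
    also have "\<dots> = EI (proj t b) (Ra t (proj t a))"
      by (rule J.ip_adjoint[OF elim(1) Pa Pb, symmetric])
    also have "\<dots> = EI b (Ra t (proj t a))" by (rule ab(2)[OF RaPa])
    finally show ?case using E.ip_sym[OF b J_ell2[OF t RaPa]] by simp
  qed
qed

theorem adjoint_corresponds:
  "shift_preserving s V V La" "corresponding_range_operator s V J La Ra"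
  using La_bounded La_shift into_ell2[OF Ra_bounded] Ra_measurable fib_adjoint
  unfolding shift_preserving_def corresponding_range_operator_def measurable_range_operator_def by blast+

section \<open>Uniqueness, self-adjointness and unitarity fiber by fiber\<close>

lemma corresponding_unique:
  assumes "corresponding_range_operator s V J La R'"
  shows "AE t in torus_measure. \<forall>a\<in>J t. R' t a = Ra t a"
proof (rule AE_operator_unique)
  show "AE t in torus_measure. bounded_operator EI (J t) (ell2 s) (R' t)"
    using assms by (simp add: corresponding_range_operator_def measurable_range_operator_def)
  show "AE t in torus_measure. bounded_operator EI (J t) (ell2 s) (Ra t)" by (rule into_ell2[OF Ra_bounded])
  fix f assume f: "f \<in> V"
  have "AE t in torus_measure. fib (La f) t = R' t (fib f t)"
    using assms f by (simp add: corresponding_range_operator_def)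
  then show "AE t in torus_measure. R' t (fib f t) = Ra t (fib f t)"
    using fib_adjoint[OF f] by eventually_elim simp
qed

text \<open>Towards fibers, \<open>Ra t\<close> and \<open>R t\<close> are compared on the fibers of
  elements of \<open>V\<close>; back to \<open>V\<close>, injectivity of the fiber map is
  used.\<close>

theorem selfadjoint_iff: "selfadjoint_on SI V L \<longleftrightarrow> (AE t in torus_measure. selfadjoint_on EI (J t) (R t))"
proof
  assume sa: "selfadjoint_on SI V L"
  have "AE t in torus_measure. \<forall>x\<in>J t. Ra t x = R t x"
  proof (rule AE_operator_unique[OF into_ell2[OF Ra_bounded] R_bounded_ell2])
    fix f assume f: "f \<in> V"
    then have eq: "La f = L f" using sa by (simp add: selfadjoint_on_def)
    show "AE t in torus_measure. Ra t (fib f t) = R t (fib f t)"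
      using fib_adjoint[OF f] R_fib[OF f] by eventually_elim (simp add: eq)
  qed
  then show "AE t in torus_measure. selfadjoint_on EI (J t) (R t)"
    using R_bounded by eventually_elim (simp add: selfadjoint_on_def)
next
  assume sa: "AE t in torus_measure. selfadjoint_on EI (J t) (R t)"
  have "La f = L f" if f: "f \<in> V" for f
  proof (rule fiber_eqI[OF V_sobolev[OF La_V[OF f]] V_sobolev[OF L_V[OF f]]])
    show "AE t in torus_measure. fib (La f) t = fib (L f) t"
      using sa fib_adjoint[OF f] R_fib[OF f] V_AE[OF f]
      by eventually_elim (simp add: selfadjoint_on_def)
  qed
  then show "selfadjoint_on SI V L" using L_bounded by (simp add: selfadjoint_on_def)
qed

theorem unitary_iff: "unitary_on SI V L \<longleftrightarrow> (AE t in torus_measure. unitary_on EI (J t) (R t))"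
proof
  assume un: "unitary_on SI V L"
  have id: "AE t in torus_measure. bounded_operator EI (J t) (ell2 s) (\<lambda>x. x)"
    using into_ell2[of "\<lambda>t x. x"] AE_torus hilbert_fun.bounded_operator_id[OF J_hilbert] by (metis (mono_tags, lifting) eventually_mono)
  \<comment> \<open>Both products are bounded on \<open>J t\<close>, so they can be compared with
    the identity by \<open>AE_operator_unique\<close>.\<close>
  have comp: "AE t in torus_measure. bounded_operator EI (J t) (ell2 s) (\<lambda>x. Ra t (R t x))"
    "AE t in torus_measure. bounded_operator EI (J t) (ell2 s) (\<lambda>x. R t (Ra t x))"
    by (rule into_ell2, use R_bounded Ra_bounded AE_torus in eventually_elim,
        rule hilbert_fun.bounded_operator_compose[OF J_hilbert]; assumption)+
  have "AE t in torus_measure. \<forall>x\<in>J t. Ra t (R t x) = x"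
  proof (rule AE_operator_unique[OF comp(1) id])
    fix f assume f: "f \<in> V"
    then have eq: "La (L f) = f" using un by (simp add: unitary_on_def)
    show "AE t in torus_measure. Ra t (R t (fib f t)) = fib f t"
      using fib_adjoint[OF L_V[OF f]] R_fib[OF f] by eventually_elim (simp add: eq)
  qed
  moreover have "AE t in torus_measure. \<forall>x\<in>J t. R t (Ra t x) = x"
  proof (rule AE_operator_unique[OF comp(2) id])
    fix f assume f: "f \<in> V"
    then have eq: "L (La f) = f" using un by (simp add: unitary_on_def)
    show "AE t in torus_measure. R t (Ra t (fib f t)) = fib f t"
      using fib_adjoint[OF f] R_fib[OF La_V[OF f]] by eventually_elim (simp add: eq)
  qed
  ultimately show "AE t in torus_measure. unitary_on EI (J t) (R t)"
    using R_bounded by eventually_elim (simp add: unitary_on_def)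
next
  assume un: "AE t in torus_measure. unitary_on EI (J t) (R t)"
  have "La (L f) = f" if f: "f \<in> V" for f
  proof (rule fiber_eqI[OF V_sobolev[OF La_V[OF L_V[OF f]]] V_sobolev[OF f]])
    show "AE t in torus_measure. fib (La (L f)) t = fib f t"
      using un fib_adjoint[OF L_V[OF f]] R_fib[OF f] V_AE[OF f]
      by eventually_elim (simp add: unitary_on_def)
  qed
  moreover have "L (La f) = f" if f: "f \<in> V" for f
  proof (rule fiber_eqI[OF V_sobolev[OF L_V[OF La_V[OF f]]] V_sobolev[OF f]])
    show "AE t in torus_measure. fib (L (La f)) t = fib f t"
      using un fib_adjoint[OF f] R_fib[OF La_V[OF f]] V_AE[OF f]
      by eventually_elim (simp add: unitary_on_def)
  qed
  ultimately show "unitary_on SI V L" using L_bounded by (simp add: unitary_on_def)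
qed

section \<open>Quadratic forms and spectra of the fibers\<close>

lemma SI_form:
  assumes f: "f \<in> V"
  shows "Re (SI (L f) f) = (LINT t|torus_measure. Re (fiber_inner s (L f) f t))"
    and "(hnorm SI f)\<^sup>2 = (LINT t|torus_measure. Re (fiber_inner s f f t))"
  using integral_Re[OF fiber_inner_integrable[OF V_sobolev[OF L_V[OF f]] V_sobolev[OF f]]]
    integral_Re[OF fiber_inner_integrable[OF V_sobolev[OF f] V_sobolev[OF f]]]
  by (simp_all add: S.hnorm_square[OF V_sobolev[OF f]]
      sobolev_inner_fiber_inner[OF V_sobolev[OF L_V[OF f]] V_sobolev[OF f]]
      sobolev_inner_fiber_inner[OF V_sobolev[OF f] V_sobolev[OF f]])

lemma fib_form:
  assumes f: "f \<in> V"
  shows "AE t in torus_measure. Re (fiber_inner s (L f) f t) = Re (EI (R t (fib f t)) (fib f t))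
     \<and> Re (fiber_inner s f f t) = (en (fib f t))\<^sup>2"
  using R_fib[OF f] fiber_inner_AE[OF V_sobolev[OF L_V[OF f]] V_sobolev[OF f]]
    fiber_inner_AE[OF V_sobolev[OF f] V_sobolev[OF f]] fiber_in_ell2[OF V_sobolev[OF f]]
  by eventually_elim (simp add: E.hnorm_square)

text \<open>The sign \<open>\<sigma> = \<plusminus>1\<close> treats lower and upper bounds at once.\<close>

lemma form_bound_iff:
  "(\<forall>f\<in>V. \<sigma> * C * (hnorm SI f)\<^sup>2 \<le> \<sigma> * Re (SI (L f) f))
    \<longleftrightarrow> (AE t in torus_measure. \<forall>x\<in>J t. \<sigma> * C * (en x)\<^sup>2 \<le> \<sigma> * Re (EI (R t x) x))"
proof
  assume form: "\<forall>f\<in>V. \<sigma> * C * (hnorm SI f)\<^sup>2 \<le> \<sigma> * Re (SI (L f) f)"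
  have fiberwise: "AE t in torus_measure. \<sigma> * C * (en (fib f t))\<^sup>2 \<le> \<sigma> * Re (EI (R t (fib f t)) (fib f t))" if f: "f \<in> V" for f
  proof -
    note fs = V_sobolev[OF f] and Lfs = V_sobolev[OF L_V[OF f]]
    \<comment> \<open>Nonnegativity of its integral over \<open>A\<close> is the form inequality for
      \<open>f\<close> cut to \<open>A\<close>; since \<open>A\<close> is arbitrary,
      \<open>F\<close> is nonnegative almost everywhere.\<close>
    define F where "F t = \<sigma> * Re (fiber_inner s (L f) f t) - \<sigma> * C * Re (fiber_inner s f f t)" for t
    have F_int: "integrable torus_measure F"
      unfolding F_def by (intro Bochner_Integration.integrable_diff integrable_mult_right integrable_Re fiber_inner_integrable fs Lfs)
    have "AE t in torus_measure. F t \<ge> 0"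
    proof (rule sigma_finite_measure.density_nonneg[OF torus.sigma_finite_measure_axioms F_int])
      fix A assume A: "A \<in> sets (torus_measure :: (real^'a) measure)"
      obtain h where h: "h \<in> V" "AE t in torus_measure. fib h t = (\<lambda>k. indicator A t * fib f t k)"
        "AE t in torus_measure. fib (L h) t = (\<lambda>k. indicator A t * fib (L f) t k)"
        using cutoff_L[OF f A] .
      note hs = V_sobolev[OF h(1)] and Lhs = V_sobolev[OF L_V[OF h(1)]]
      define H where "H t = \<sigma> * Re (fiber_inner s (L h) h t) - \<sigma> * C * Re (fiber_inner s h h t)" for t
      have H_int: "integrable torus_measure H"
        unfolding H_def by (intro Bochner_Integration.integrable_diff integrable_mult_right integrable_Re fiber_inner_integrable hs Lhs)
      have "AE t in torus_measure. H t = indicator A t *\<^sub>R F t"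
        using h(2,3)
      proof eventually_elim
        case (elim t)
        \<comment> \<open>Both arguments carry the factor \<open>indicator A t\<close>, which is
          real and idempotent and so appears once.\<close>
        have "fiber_inner s (L h) h t = indicator A t * fiber_inner s (L f) f t"
          "fiber_inner s h h t = indicator A t * fiber_inner s f f t"
          using fiber_inner_cong[of s "L h" t "indicator A t" "L f" h "indicator A t" f]
            fiber_inner_cong[of s h t "indicator A t" f h "indicator A t" f] elim
          by (auto simp: indicator_def)
        then show ?case by (simp add: H_def F_def indicator_def)
      qed
      then have "(LINT t:A|torus_measure. F t) = (LINT t|torus_measure. H t)"
        unfolding set_lebesgue_integral_def
        using borel_measurable_integrable[OF F_int] borel_measurable_integrable[OF H_int] A
        by (intro integral_cong_AE borel_measurable_scaleR borel_measurable_indicator) auto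
      also have "\<dots> = \<sigma> * Re (SI (L h) h) - \<sigma> * C * (hnorm SI h)\<^sup>2"
        unfolding H_def SI_form[OF h(1)]
        by (simp add: integrable_Re fiber_inner_integrable hs Lhs)
      also have "\<dots> \<ge> 0" using form h(1) by simp
      finally show "(LINT t:A|torus_measure. F t) \<ge> 0" .
    qed
    then show ?thesis using fib_form[OF f] by eventually_elim (simp add: F_def)
  qed
  show "AE t in torus_measure. \<forall>x\<in>J t. \<sigma> * C * (en x)\<^sup>2 \<le> \<sigma> * Re (EI (R t x) x)"
  proof -
    have "AE t in torus_measure. \<forall>l. \<sigma> * C * (en (proj t (rational_seq l)))\<^sup>2 \<le> \<sigma> * Re (EI (R t (proj t (rational_seq l))) (proj t (rational_seq l)))"
      by (rule AE_test) (rule fiberwise)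
    then show ?thesis using R_bounded AE_torus
    proof eventually_elim
      case (elim t)
      note t = elim(3)
      interpret J: hilbert_fun EI "J t" by (rule J_hilbert[OF t])
      show ?case
      proof
        fix x assume x: "x \<in> J t"
        obtain X where X: "\<And>m. \<exists>l. X m = proj t (rational_seq l)" "\<And>m. X m \<in> J t"
          and lim: "(\<lambda>m. en (\<lambda>p. X m p - x p)) \<longlonglongrightarrow> 0" by (rule proj_dense[OF t x]) blast
        note Rx = bounded_operatorD(1)[OF elim(2)]
        have limR: "(\<lambda>m. en (\<lambda>p. R t (X m) p - R t x p)) \<longlonglongrightarrow> 0"
          by (rule J.bounded_operator_tendsto[OF order_refl J_sub[OF t] elim(2) X(2) x lim])
        show "\<sigma> * C * (en x)\<^sup>2 \<le> \<sigma> * Re (EI (R t x) x)"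
        proof (rule LIMSEQ_le)
          show "(\<lambda>m. \<sigma> * C * (en (X m))\<^sup>2) \<longlonglongrightarrow> \<sigma> * C * (en x)\<^sup>2"
            by (intro tendsto_intros J.hnorm_tendsto[OF X(2) x lim])
          show "(\<lambda>m. \<sigma> * Re (EI (R t (X m)) (X m))) \<longlonglongrightarrow> \<sigma> * Re (EI (R t x) x)"
            by (intro tendsto_intros J.ip_tendsto2[OF Rx[OF X(2)] Rx[OF x] limR X(2) x lim])
          show "\<exists>N. \<forall>m\<ge>N. \<sigma> * C * (en (X m))\<^sup>2 \<le> \<sigma> * Re (EI (R t (X m)) (X m))"
          proof (intro exI allI impI)
            fix m show "\<sigma> * C * (en (X m))\<^sup>2 \<le> \<sigma> * Re (EI (R t (X m)) (X m))"
              using elim(1) X(1)[of m] by auto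
          qed
        qed
      qed
    qed
  qed
next
  assume form: "AE t in torus_measure. \<forall>x\<in>J t. \<sigma> * C * (en x)\<^sup>2 \<le> \<sigma> * Re (EI (R t x) x)"
  show "\<forall>f\<in>V. \<sigma> * C * (hnorm SI f)\<^sup>2 \<le> \<sigma> * Re (SI (L f) f)"
  proof
    fix f assume f: "f \<in> V"
    note fs = V_sobolev[OF f] and Lfs = V_sobolev[OF L_V[OF f]]
    have "(LINT t|torus_measure. \<sigma> * C * Re (fiber_inner s f f t)) \<le> (LINT t|torus_measure. \<sigma> * Re (fiber_inner s (L f) f t))"
    proof (rule integral_mono_AE)
      show "AE t in torus_measure. \<sigma> * C * Re (fiber_inner s f f t) \<le> \<sigma> * Re (fiber_inner s (L f) f t)"
        using form fib_form[OF f] V_AE[OF f] by eventually_elim simp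
    qed (intro integrable_mult_right integrable_Re fiber_inner_integrable fs Lfs)+
    then show "\<sigma> * C * (hnorm SI f)\<^sup>2 \<le> \<sigma> * Re (SI (L f) f)"
      unfolding SI_form[OF f] by simp
  qed
qed

text \<open>The spectral criterion is available for self-adjoint fibers, so self-adjointness stays
  in the conjunction while spectra are exchanged for form bounds. The factors \<open>1\<close> and
  \<open>-1\<close> are the two values of \<open>\<sigma>\<close> in
  \<open>form_bound_iff\<close>.\<close>

theorem selfadjoint_spectrum_fiberwise:
  "selfadjoint_on SI V L \<and> spectrum_on SI V L \<subseteq> complex_of_real ` {A..B} \<longleftrightarrow>
   (AE t in torus_measure. selfadjoint_on EI (J t) (R t) \<and> spectrum_on EI (J t) (R t) \<subseteq> complex_of_real ` {A..B})"
proof -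
  have "AE t in torus_measure. selfadjoint_on EI (J t) (R t) \<longrightarrow>
     (spectrum_on EI (J t) (R t) \<subseteq> complex_of_real ` {A..B} \<longleftrightarrow>
      (\<forall>x\<in>J t. 1 * A * (en x)\<^sup>2 \<le> 1 * Re (EI (R t x) x)) \<and> (\<forall>x\<in>J t. -1 * B * (en x)\<^sup>2 \<le> -1 * Re (EI (R t x) x)))"
    using AE_torus
  proof eventually_elim
    case (elim t)
    show ?case using hilbert_fun.selfadjoint_spectrum_iff[OF J_hilbert[OF elim], of "R t" A B] by auto
  qed
  then have "(AE t in torus_measure. selfadjoint_on EI (J t) (R t) \<and> spectrum_on EI (J t) (R t) \<subseteq> complex_of_real ` {A..B})
    \<longleftrightarrow> (AE t in torus_measure. selfadjoint_on EI (J t) (R t) \<and>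
      (\<forall>x\<in>J t. 1 * A * (en x)\<^sup>2 \<le> 1 * Re (EI (R t x) x)) \<and> (\<forall>x\<in>J t. -1 * B * (en x)\<^sup>2 \<le> -1 * Re (EI (R t x) x)))"
    by (intro iffI; elim eventually_rev_mp eventually_mono; auto)
  also have "\<dots> \<longleftrightarrow> selfadjoint_on SI V L \<and> (\<forall>f\<in>V. 1 * A * (hnorm SI f)\<^sup>2 \<le> 1 * Re (SI (L f) f))
      \<and> (\<forall>f\<in>V. -1 * B * (hnorm SI f)\<^sup>2 \<le> -1 * Re (SI (L f) f))"
    by (simp only: AE_conj_iff selfadjoint_iff form_bound_iff)
  also have "\<dots> \<longleftrightarrow> selfadjoint_on SI V L \<and> spectrum_on SI V L \<subseteq> complex_of_real ` {A..B}"
    using VH.selfadjoint_spectrum_iff[of L A B] by auto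
  finally show ?thesis by blast
qed

end

theorem theorem3p2:
  fixes s :: real
    and V :: "((real^'n::finite \<Rightarrow> complex) \<Rightarrow> complex) set"
    and J :: "real^'n \<Rightarrow> (int^'n \<Rightarrow> complex) set"
    and L :: "((real^'n \<Rightarrow> complex) \<Rightarrow> complex) \<Rightarrow> ((real^'n \<Rightarrow> complex) \<Rightarrow> complex)"
    and R :: "real^'n \<Rightarrow> (int^'n \<Rightarrow> complex) \<Rightarrow> (int^'n \<Rightarrow> complex)"
  assumes "closed_shift_invariant s V"
    and "associated_range_function s V J"
    and "shift_preserving s V V L"
    and "corresponding_range_operator s V J L R"
  shows
    "(shift_preserving s V V (adjoint_on (sobolev_inner s) V L) \<and>
      corresponding_range_operator s V J (adjoint_on (sobolev_inner s) V L)
        (\<lambda>t. adjoint_on (ell2_inner s) (J t) (R t)) \<and>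
      (\<forall>Rstar. corresponding_range_operator s V J (adjoint_on (sobolev_inner s) V L) Rstar \<longrightarrow>
         (AE t in lebesgue_on torus. \<forall>a\<in>J t. Rstar t a = adjoint_on (ell2_inner s) (J t) (R t) a)))
     \<and>
     (\<forall>A B :: real. A \<le> B \<longrightarrow>
        ((selfadjoint_on (sobolev_inner s) V L \<and>
          spectrum_on (sobolev_inner s) V L \<subseteq> complex_of_real ` {A..B})
         \<longleftrightarrow>
         (AE t in lebesgue_on torus.
            selfadjoint_on (ell2_inner s) (J t) (R t) \<and>
            spectrum_on (ell2_inner s) (J t) (R t) \<subseteq> complex_of_real ` {A..B})))
     \<and>
     (unitary_on (sobolev_inner s) V L \<longleftrightarrow>
        (AE t in lebesgue_on torus. unitary_on (ell2_inner s) (J t) (R t)))"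
proof -
  interpret si_operator s V J L R using assms by unfold_locales
  show ?thesis
    using adjoint_corresponds corresponding_unique selfadjoint_spectrum_fiberwise unitary_iff by blast
qed

end
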